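(* There exist constants $c,C>0$ and $\alpha_0>0$ such that the following holds for all $\alpha\in\mathbb{R}$ with $|\alpha|\ge\alpha_0$, with $c,C$ independent of $\alpha$ and $l$. For every $\lambda\in\mathbb{R}$ and $l\in\mathbb{Z}\setminus\{0\}$, the operator $\mathbb{Q}_lL_{\alpha,l}$ in $Y_l$ satisfies $$\sup_{\zeta\in\sigma(\mathbb{Q}_lL_{\alpha,l})}\mathrm{Re}\,\zeta\le -c\,|\alpha l|^{1/2}$$ and $$\|(i\lambda+\mathbb{Q}_lL_{\alpha,l})^{-1}\|_{Y_l\to Y_l}\le\begin{cases}\dfrac{C}{|\alpha l|\,\big(|\frac{\lambda}{\alpha l}|-1\big)} & \text{if } |\frac{\lambda}{\alpha l}|>1+\frac{1}{|\alpha l|^{1/2}},\\[2mm] \dfrac{C}{|\alpha l|^{1/2}} & \text{if } 1-\frac{1}{|\alpha l|^{1/2}}<|\frac{\lambda}{\alpha l}|\le 1+\frac{1}{|\alpha l|^{1/2}},\\[2mm] \dfrac{C}{|\alpha l|^{2/3}\big(1-|\frac{\lambda}{\alpha l}|\big)^{1/3}} & \text{if } |\frac{\lambda}{\alpha l}|\le 1-\frac{1}{|\alpha l|^{1/2}}.\end{cases}$$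
   Context: $\mathbb{T}=\mathbb{R}/2\pi\mathbb{Z}$ and $L^2(\mathbb{T})$ is the complex Hilbert space. For $l\in\mathbb{Z}\setminus\{0\}$ and $\alpha\in\mathbb{R}$: $A_l=\partial_y^2-l^2$ with domain $W^{2,2}(\mathbb{T})$; $M_g$ denotes multiplication by the function $g$; $\hat\Lambda_l=M_{\sin y}(I+A_l^{-1})$, a bounded operator on $L^2(\mathbb{T})$; $L_{\alpha,l}=A_l-i\alpha l\,\hat\Lambda_l$ with domain $W^{2,2}(\mathbb{T})$. $Y_l=L^2(\mathbb{T})$ if $|l|\ge2$ and $Y_l=\{f\in L^2(\mathbb{T}):\int_0^{2\pi}f\,dy=0\}$ if $|l|=1$; $\mathbb{Q}_l$ is the orthogonal projection of $L^2(\mathbb{T})$ onto $Y_l$. $\mathbb{Q}_lL_{\alpha,l}$ is regarded as an operator in $Y_l$ with domain $W^{2,2}(\mathbb{T})\cap Y_l$, and $\sigma(\mathbb{Q}_lL_{\alpha,l})$ is its spectrum in $Y_l$. *)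

theory Defs
  imports "HOL-Analysis.Analysis"
begin

text \<open>
  Elements of \<open>L\<^sup>2\<close> of the circle \<open>\<real>/2\<pi>\<int>\<close> are classes, modulo equality almost everywhere, of
  square-integrable functions on the fundamental domain \<open>[0, 2\<pi>]\<close>; values of a representative
  off that interval are irrelevant.
\<close>

abbreviation circle :: "real measure" where
  "circle \<equiv> lebesgue_on {0..2*pi}"

definition square_integrable :: "(real \<Rightarrow> complex) \<Rightarrow> bool" where
  "square_integrable f \<longleftrightarrow>
     f \<in> borel_measurable circle \<and> integrable circle (\<lambda>y. (cmod (f y))\<^sup>2)"

definition L2_rel :: "(real \<Rightarrow> complex) \<Rightarrow> (real \<Rightarrow> complex) \<Rightarrow> bool" where
  "L2_rel f g \<longleftrightarrow> square_integrable f \<and> square_integrable g \<and> (AE y in circle. f y = g y)"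

lemma square_integrable_0: "square_integrable (\<lambda>y. 0)"
  by (simp add: square_integrable_def)

lemma square_integrable_scale:
  "square_integrable f \<Longrightarrow> square_integrable (\<lambda>y. c * f y)"
  by (auto simp: square_integrable_def norm_mult power_mult_distrib)

lemma square_integrable_add:
  assumes "square_integrable f" "square_integrable g"
  shows "square_integrable (\<lambda>y. f y + g y)"
proof -
  have [measurable]: "f \<in> borel_measurable circle" "g \<in> borel_measurable circle"
    using assms by (auto simp: square_integrable_def)
  have "integrable circle (\<lambda>y. 2 * (cmod (f y))\<^sup>2 + 2 * (cmod (g y))\<^sup>2)"
    using assms by (auto simp: square_integrable_def)
  then have "integrable circle (\<lambda>y. (cmod (f y + g y))\<^sup>2)"
  proof (rule Bochner_Integration.integrable_bound)
    show "AE y in circle. norm ((cmod (f y + g y))\<^sup>2) \<le> norm (2 * (cmod (f y))\<^sup>2 + 2 * (cmod (g y))\<^sup>2)"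
    proof (rule AE_I2)
      fix y
      have "(cmod (f y + g y))\<^sup>2 \<le> (cmod (f y) + cmod (g y))\<^sup>2"
        by (intro power_mono norm_triangle_ineq) auto
      also have "\<dots> \<le> 2 * (cmod (f y))\<^sup>2 + 2 * (cmod (g y))\<^sup>2"
        using sum_squares_bound[of "cmod (f y)" "cmod (g y)"] by (simp add: power2_sum)
      finally show "norm ((cmod (f y + g y))\<^sup>2) \<le> norm (2 * (cmod (f y))\<^sup>2 + 2 * (cmod (g y))\<^sup>2)"
        by simp
    qed
  qed measurable
  then show ?thesis by (simp add: square_integrable_def)
qed

lemma integrable_mult_cnj:
  assumes "square_integrable f" "square_integrable g"
  shows "integrable circle (\<lambda>y. f y * cnj (g y))"
proof -
  have [measurable]: "f \<in> borel_measurable circle" "g \<in> borel_measurable circle"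
    using assms by (auto simp: square_integrable_def)
  have [measurable]: "(\<lambda>y. cnj (g y)) \<in> borel_measurable circle"
    by (rule borel_measurable_continuous_on[of cnj]) (auto intro: continuous_intros)
  have "integrable circle (\<lambda>y. (cmod (f y))\<^sup>2 + (cmod (g y))\<^sup>2)"
    using assms by (auto simp: square_integrable_def)
  then show ?thesis
  proof (rule Bochner_Integration.integrable_bound)
    show "AE y in circle. norm (f y * cnj (g y)) \<le> norm ((cmod (f y))\<^sup>2 + (cmod (g y))\<^sup>2)"
    proof (rule AE_I2)
      fix y
      have "2 * (cmod (f y) * cmod (g y)) \<le> (cmod (f y))\<^sup>2 + (cmod (g y))\<^sup>2"
        using sum_squares_bound[of "cmod (f y)" "cmod (g y)"] by simp
      moreover have "0 \<le> cmod (f y) * cmod (g y)" by simp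
      moreover have "norm (f y * cnj (g y)) = cmod (f y) * cmod (g y)" by (simp add: norm_mult)
      moreover have "norm ((cmod (f y))\<^sup>2 + (cmod (g y))\<^sup>2) = (cmod (f y))\<^sup>2 + (cmod (g y))\<^sup>2"
        by simp
      ultimately show "norm (f y * cnj (g y)) \<le> norm ((cmod (f y))\<^sup>2 + (cmod (g y))\<^sup>2)"
        by linarith
    qed
  qed measurable
qed

quotient_type L2T = "real \<Rightarrow> complex" / partial: L2_rel
  morphisms rep_L2T abs_L2T
proof (rule part_equivpI)
  show "\<exists>f. L2_rel f f"
    using square_integrable_0 by (auto simp: L2_rel_def)
  show "symp L2_rel"
    by (auto simp: symp_def L2_rel_def)
  show "transp L2_rel"
    unfolding transp_def L2_rel_def by (auto elim: AE_mp)
qed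

lift_definition scaleC :: "complex \<Rightarrow> L2T \<Rightarrow> L2T" (infixr "*\<^sub>C" 75) is "\<lambda>c f y. c * f y"
  by (auto simp: L2_rel_def square_integrable_scale)

lift_definition cinner :: "L2T \<Rightarrow> L2T \<Rightarrow> complex" is "\<lambda>f g. (LINT y|circle. f y * cnj (g y))"
proof -
  fix f f' g g' assume a: "L2_rel f f'" "L2_rel g g'"
  have m: "(\<lambda>y. f y * cnj (g y)) \<in> borel_measurable circle"
    "(\<lambda>y. f' y * cnj (g' y)) \<in> borel_measurable circle"
    using a by (auto simp: L2_rel_def intro!: borel_measurable_integrable integrable_mult_cnj)
  show "(LINT y|circle. f y * cnj (g y)) = (LINT y|circle. f' y * cnj (g' y))"
    by (rule integral_cong_AE[OF m]) (use a in \<open>auto simp: L2_rel_def\<close>)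
qed

instantiation L2T :: real_inner
begin

lift_definition zero_L2T :: L2T is "\<lambda>y. 0"
  by (auto simp: L2_rel_def square_integrable_0)

lift_definition plus_L2T :: "L2T \<Rightarrow> L2T \<Rightarrow> L2T" is "\<lambda>f g y. f y + g y"
  by (auto simp: L2_rel_def square_integrable_add)

definition uminus_L2T :: "L2T \<Rightarrow> L2T" where "- f = (-1) *\<^sub>C f"

definition minus_L2T :: "L2T \<Rightarrow> L2T \<Rightarrow> L2T" where "f - g = f + - (g :: L2T)"

definition scaleR_L2T :: "real \<Rightarrow> L2T \<Rightarrow> L2T" where "r *\<^sub>R f = of_real r *\<^sub>C f"

definition inner_L2T :: "L2T \<Rightarrow> L2T \<Rightarrow> real" where "f \<bullet> g = Re (cinner f g)"

lift_definition norm_L2T :: "L2T \<Rightarrow> real" is "\<lambda>f. sqrt (LINT y|circle. (cmod (f y))\<^sup>2)"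
proof -
  fix f g assume a: "L2_rel f g"
  have m: "(\<lambda>y. (cmod (f y))\<^sup>2) \<in> borel_measurable circle"
    "(\<lambda>y. (cmod (g y))\<^sup>2) \<in> borel_measurable circle"
    using a by (auto simp: L2_rel_def square_integrable_def)
  have "(LINT y|circle. (cmod (f y))\<^sup>2) = (LINT y|circle. (cmod (g y))\<^sup>2)"
    by (rule integral_cong_AE[OF m]) (use a in \<open>auto simp: L2_rel_def\<close>)
  then show "sqrt (LINT y|circle. (cmod (f y))\<^sup>2) = sqrt (LINT y|circle. (cmod (g y))\<^sup>2)"
    by simp
qed

definition dist_L2T :: "L2T \<Rightarrow> L2T \<Rightarrow> real" where "dist f g = norm (f - g :: L2T)"

definition sgn_L2T :: "L2T \<Rightarrow> L2T" where "sgn (f :: L2T) = inverse (norm f) *\<^sub>R f"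

definition uniformity_L2T :: "(L2T \<times> L2T) filter" where
  "uniformity_L2T = (INF e\<in>{0 <..}. principal {(x, y). dist x y < e})"

definition open_L2T :: "L2T set \<Rightarrow> bool" where
  "open_L2T U = (\<forall>x\<in>U. \<forall>\<^sub>F (x', y) in uniformity. x' = x \<longrightarrow> y \<in> U)"

instance
proof
  fix f g h :: L2T and r s :: real
  show "f + g + h = f + (g + h)"
    by transfer (auto simp: L2_rel_def add.assoc intro!: square_integrable_add)
  show comm: "f + g = g + f"
    by transfer (auto simp: L2_rel_def add.commute intro!: square_integrable_add)
  show "0 + f = f"
    by transfer (auto simp: L2_rel_def)
  show "- f + f = 0"
    unfolding uminus_L2T_def
    by transfer (auto simp: L2_rel_def square_integrable_0)
  show "f - g = f + - g" by (simp add: minus_L2T_def)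
  show "r *\<^sub>R (f + g) = r *\<^sub>R f + r *\<^sub>R g"
    unfolding scaleR_L2T_def
    by transfer (auto simp: L2_rel_def distrib_left distrib_right
        intro!: square_integrable_add square_integrable_scale)
  show "(r + s) *\<^sub>R f = r *\<^sub>R f + s *\<^sub>R f"
    unfolding scaleR_L2T_def
    by transfer (auto simp: L2_rel_def distrib_left distrib_right
        intro!: square_integrable_add square_integrable_scale)
  show "r *\<^sub>R s *\<^sub>R f = (r * s) *\<^sub>R f"
    unfolding scaleR_L2T_def
    by transfer (auto simp: L2_rel_def mult.assoc intro!: square_integrable_scale)
  show "1 *\<^sub>R f = f"
    unfolding scaleR_L2T_def by transfer (auto simp: L2_rel_def)
  show "dist f g = norm (f - g)" by (rule dist_L2T_def)
  show "sgn f = inverse (norm f) *\<^sub>R f" by (rule sgn_L2T_def)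
  show "uniformity = (INF e\<in>{0 <..}. principal {(x :: L2T, y). dist x y < e})"
    by (rule uniformity_L2T_def)
  show "open U = (\<forall>x\<in>U. \<forall>\<^sub>F (x', y) in uniformity. x' = x \<longrightarrow> y \<in> U)" for U :: "L2T set"
    by (rule open_L2T_def)
  have Re_int: "Re (LINT y|circle. f y * cnj (g y)) = (LINT y|circle. Re (f y * cnj (g y)))"
    if "square_integrable f" "square_integrable g" for f g
    using integral_bounded_linear[OF bounded_linear_Re integrable_mult_cnj[OF that]] by simp
  have self: "f \<bullet> f = (norm f)\<^sup>2" for f :: L2T
    unfolding inner_L2T_def
  proof transfer
    fix f assume "L2_rel f f"
    then have "square_integrable f" by (simp add: L2_rel_def)
    moreover have "Re (f y * cnj (f y)) = (cmod (f y))\<^sup>2" for y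
      by (simp only: complex_norm_square[symmetric] Re_complex_of_real)
    ultimately show "Re (LINT y|circle. f y * cnj (f y)) = (sqrt (LINT y|circle. (cmod (f y))\<^sup>2))\<^sup>2"
      by (simp add: Re_int del: times_complex.sel)
  qed
  have nonneg: "0 \<le> norm f" for f :: L2T by transfer simp
  show "norm f = sqrt (f \<bullet> f)" using nonneg[of f] by (simp add: self)
  show "0 \<le> f \<bullet> f" by (simp add: self)
  show "f \<bullet> g = g \<bullet> f"
    unfolding inner_L2T_def
  proof transfer
    fix f g assume "L2_rel f f" "L2_rel g g"
    then have "square_integrable f" "square_integrable g" by (simp_all add: L2_rel_def)
    moreover have "Re (f y * cnj (g y)) = Re (g y * cnj (f y))" for y
      by (simp add: mult.commute)
    ultimately show "Re (LINT y|circle. f y * cnj (g y)) = Re (LINT y|circle. g y * cnj (f y))"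
      by (simp only: Re_int)
  qed
  show "(f + g) \<bullet> h = f \<bullet> h + g \<bullet> h"
    unfolding inner_L2T_def
  proof transfer
    fix f g h assume "L2_rel f f" "L2_rel g g" "L2_rel h h"
    then have "square_integrable f" "square_integrable g" "square_integrable h"
      by (simp_all add: L2_rel_def)
    then show "Re (LINT y|circle. (f y + g y) * cnj (h y))
        = Re (LINT y|circle. f y * cnj (h y)) + Re (LINT y|circle. g y * cnj (h y))"
      by (simp add: distrib_right integrable_mult_cnj)
  qed
  show "(r *\<^sub>R f) \<bullet> g = r * (f \<bullet> g)"
    unfolding inner_L2T_def scaleR_L2T_def
    by transfer (simp add: mult.assoc)
  show "f \<bullet> f = 0 \<longleftrightarrow> f = 0"
    unfolding self power2_eq_square mult_eq_0_iff
  proof transfer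
    fix f assume "L2_rel f f"
    then have "square_integrable f" by (simp add: L2_rel_def)
    then have "(LINT y|circle. (cmod (f y))\<^sup>2) = 0 \<longleftrightarrow> (AE y in circle. (cmod (f y))\<^sup>2 = 0)"
      by (intro integral_nonneg_eq_0_iff_AE) (auto simp: square_integrable_def)
    then show "(sqrt (LINT y|circle. (cmod (f y))\<^sup>2) = 0 \<or> sqrt (LINT y|circle. (cmod (f y))\<^sup>2) = 0)
        = L2_rel f (\<lambda>y. 0)"
      using \<open>square_integrable f\<close> by (simp add: L2_rel_def square_integrable_0)
  qed
qed

end

text \<open>
  Weak derivatives on the circle are tested against smooth \<open>2\<pi>\<close>-periodic functions, so that no
  boundary terms arise and periodicity is built into \<open>W\<^sup>2\<^sup>,\<^sup>2\<close>.
\<close>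

definition smooth_periodic :: "(real \<Rightarrow> complex) \<Rightarrow> bool" where
  "smooth_periodic \<phi> \<longleftrightarrow>
     (\<forall>y. \<phi> (y + 2 * pi) = \<phi> y) \<and>
     (\<exists>d. d 0 = \<phi> \<and> (\<forall>n y. (d n has_vector_derivative d (Suc n) y) (at y)))"

definition has_weak_deriv :: "L2T \<Rightarrow> L2T \<Rightarrow> bool" where
  "has_weak_deriv u v \<longleftrightarrow>
     (\<forall>\<phi>. smooth_periodic \<phi> \<longrightarrow>
        (LINT y|circle. rep_L2T u y * vector_derivative \<phi> (at y)) =
        - (LINT y|circle. rep_L2T v y * \<phi> y))"

definition weak_deriv :: "L2T \<Rightarrow> L2T" where
  "weak_deriv u = (THE v. has_weak_deriv u v)"

definition W22 :: "L2T set" where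
  "W22 = {u. \<exists>v w. has_weak_deriv u v \<and> has_weak_deriv v w}"

text \<open>
  An unbounded operator in a subspace \<open>Y\<close> with domain \<open>D \<subseteq> Y\<close> is a function \<open>T\<close> of which only
  the values on \<open>D\<close> matter.
\<close>

definition resolvent_set :: "L2T set \<Rightarrow> L2T set \<Rightarrow> (L2T \<Rightarrow> L2T) \<Rightarrow> complex set" where
  "resolvent_set Y D T =
     {\<zeta>. bij_betw (\<lambda>u. \<zeta> *\<^sub>C u - T u) D Y \<and>
         (\<exists>K. \<forall>f\<in>Y. norm (inv_into D (\<lambda>u. \<zeta> *\<^sub>C u - T u) f) \<le> K * norm f)}"

definition op_spectrum :: "L2T set \<Rightarrow> L2T set \<Rightarrow> (L2T \<Rightarrow> L2T) \<Rightarrow> complex set" where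
  "op_spectrum Y D T = - resolvent_set Y D T"

text \<open>The operator norm is extended-real valued, so it is \<open>\<infinity>\<close> for an unbounded operator.\<close>

definition op_norm :: "L2T set \<Rightarrow> (L2T \<Rightarrow> L2T) \<Rightarrow> ereal" where
  "op_norm Y R = (SUP f\<in>{f\<in>Y. norm f \<le> 1}. ereal (norm (R f)))"

definition orth_proj :: "L2T set \<Rightarrow> L2T \<Rightarrow> L2T" where
  "orth_proj Y f = (THE g. g \<in> Y \<and> (\<forall>h\<in>Y. cinner (f - g) h = 0))"

definition mult_op :: "(real \<Rightarrow> complex) \<Rightarrow> L2T \<Rightarrow> L2T" where
  "mult_op g f = abs_L2T (\<lambda>y. g y * rep_L2T f y)"

definition A_op :: "int \<Rightarrow> L2T \<Rightarrow> L2T" where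
  "A_op l u = weak_deriv (weak_deriv u) - (of_int l)\<^sup>2 *\<^sub>C u"

definition A_inv :: "int \<Rightarrow> L2T \<Rightarrow> L2T" where
  "A_inv l = inv_into W22 (A_op l)"

definition Lambda_op :: "int \<Rightarrow> L2T \<Rightarrow> L2T" where
  "Lambda_op l f = mult_op (\<lambda>y. of_real (sin y)) (f + A_inv l f)"

definition L_op :: "real \<Rightarrow> int \<Rightarrow> L2T \<Rightarrow> L2T" where
  "L_op \<alpha> l u = A_op l u - (\<i> * of_real \<alpha> * of_int l) *\<^sub>C Lambda_op l u"

definition Y_space :: "int \<Rightarrow> L2T set" where
  "Y_space l = (if \<bar>l\<bar> = 1 then {f. (LINT y|circle. rep_L2T f y) = 0} else UNIV)"

definition QL_op :: "real \<Rightarrow> int \<Rightarrow> L2T \<Rightarrow> L2T" where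
  "QL_op \<alpha> l u = orth_proj (Y_space l) (L_op \<alpha> l u)"

definition QL_dom :: "int \<Rightarrow> L2T set" where
  "QL_dom l = W22 \<inter> Y_space l"

end

theory Submission imports Defs begin

text \<open>
  Put \<open>\<beta> = \<alpha> l\<close>, \<open>\<mu> = \<lambda> / \<beta>\<close>, \<open>\<psi> = A\<^sub>l\<inverse> u\<close> and \<open>w = u + \<psi>\<close>. Since \<open>I + A\<^sub>l\<inverse>\<close> is bounded below by
  \<open>1/2\<close> on \<open>Y\<^sub>l\<close>, testing \<open>(i\<lambda> + Q\<^sub>l L) u = f\<close> with \<open>w\<close> bounds \<open>\<parallel>u'\<parallel>\<^sup>2 + l\<^sup>2 \<parallel>u\<parallel>\<^sup>2\<close> by \<open>2 \<parallel>f\<parallel> \<parallel>w\<parallel>\<close> and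
  controls \<open>\<integral> (\<bar>\<mu>\<bar> - S) \<bar>w\<bar>\<^sup>2\<close> with \<open>S = \<plusminus> sin\<close>; this settles \<open>\<bar>\<mu>\<bar> > 1\<close>, and together with an uncertainty
  principle near the critical point of \<open>S\<close> also \<open>\<bar>\<mu>\<bar>\<close> close to \<open>1\<close>. For \<open>\<delta> = 1 - \<bar>\<mu>\<bar> > 0\<close> the equation is
  tested with \<open>(v w)' + 9/10 w\<close>, where \<open>v = 8 \<delta> C / (4 \<delta> + 1 - S)\<close>, \<open>C = S'\<close>, is a vector field living at
  the scale \<open>\<surd>\<delta>\<close> of the critical layers. The resulting virial identity, including the nonlocal term, is
  bounded below by a multiple of \<open>\<integral> (1 - S + \<delta>) \<bar>w\<bar>\<^sup>2\<close>, and its right-hand side is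
  estimated by means of \<open>\<parallel>A\<^sub>l u\<parallel>\<close>, which comes from testing with \<open>A\<^sub>l u\<close>. The lower bounds so obtained
  on a half plane turn into invertibility by the method of continuity, starting from \<open>A\<^sub>l\<close>.
\<close>

section \<open>The Hilbert space structure\<close>

text \<open>For \<open>\<bar>\<mu>\<bar> < 1\<close> the obstacle is that the weight
  \<open>\<bar>\<mu>\<bar> - S\<close> is negative near the point where \<open>S = 1\<close>, so
  testing with \<open>w\<close> gives no control of \<open>norm w\<close>. The field
  \<open>v\<close> repairs this. Moving a derivative across the weight produces
  \<open>C * v / 2\<close>, positive at the layers \<open>S = \<bar>\<mu>\<bar>\<close>. At the
  critical point itself \<open>C\<close> vanishes, but there \<open>h\<close>, half the derivative
  of \<open>v\<close>, equals -1, so the coefficient \<open>9/10 + h\<close> is negative and meets a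
  negative weight. The constant 9/10 must therefore lie below 1. It must also exceed 2/3, an upper
  bound for \<open>h\<close>, because the nonlocal term brings \<open>9/10 - h\<close> in front of
  \<open>\<bar>\<psi>'\<bar>\<^sup>2\<close>. Derivatives and the inverse of \<open>A_op l\<close>
  act on Fourier coefficients as multipliers, so positivity of a nonlocal form is an inequality
  between symbols, checked frequency by frequency. For this the completeness of the exponentials in
  the concrete \<open>L2T\<close> is established first. The large constants are not structural:
  \<open>10^12\<close> is the inverse fourth power of the small parameter 1/1000 in the final
  absorption argument.\<close>

lemma square_integrable_rep: "square_integrable (rep_L2T f)"
  using Quotient3_rel_rep[OF Quotient3_L2T, of f f] by (simp add: L2_rel_def)

lemma abs_rep_L2T: "abs_L2T (rep_L2T f) = f"
  by (rule Quotient3_abs_rep[OF Quotient3_L2T])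

lemma rep_abs_L2T:
  assumes "square_integrable f" shows "AE y in circle. rep_L2T (abs_L2T f) y = f y"
  using Quotient3_rep_abs[OF Quotient3_L2T, of f] assms by (simp add: L2_rel_def)

lemma measurable_rep [measurable]: "rep_L2T f \<in> borel_measurable circle"
  using square_integrable_rep by (simp add: square_integrable_def)

lemma measurable_cnj_comp [measurable (raw)]:
  "f \<in> borel_measurable M \<Longrightarrow> (\<lambda>y. cnj (f y)) \<in> borel_measurable M"
  by (rule borel_measurable_continuous_on[of cnj]) (auto intro: continuous_intros)

lemma cinner_eq: "cinner f g = (LINT y|circle. rep_L2T f y * cnj (rep_L2T g y))"
  by (subst (1) abs_rep_L2T[of f, symmetric], subst (1) abs_rep_L2T[of g, symmetric])
     (rule cinner.abs_eq, auto simp: L2_rel_def square_integrable_rep)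

lemma cinner_abs_abs:
  assumes "square_integrable f" "square_integrable g"
  shows "cinner (abs_L2T f) (abs_L2T g) = (LINT y|circle. f y * cnj (g y))"
  by (rule cinner.abs_eq) (use assms in \<open>auto simp: L2_rel_def\<close>)

lemma cinner_abs_left:
  assumes "square_integrable f"
  shows "cinner (abs_L2T f) h = (LINT y|circle. f y * cnj (rep_L2T h y))"
  by (subst (1) abs_rep_L2T[of h, symmetric]) (simp add: cinner_abs_abs assms square_integrable_rep)

lemma cinner_abs_right:
  assumes "square_integrable f"
  shows "cinner h (abs_L2T f) = (LINT y|circle. rep_L2T h y * cnj (f y))"
  by (subst (1) abs_rep_L2T[of h, symmetric]) (simp add: cinner_abs_abs assms square_integrable_rep)

lemma cinner_add_left: "cinner (f + g) h = cinner f h + cinner g h"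
  by transfer (simp add: distrib_right integrable_mult_cnj L2_rel_def)

lemma cinner_scaleC_left [simp]: "cinner (c *\<^sub>C f) h = c * cinner f h"
  by transfer (simp add: mult.assoc)

lemma cinner_commute: "cinner g f = cnj (cinner f g)"
proof transfer
  fix f g :: "real \<Rightarrow> complex"
  have "cnj (LINT y|circle. f y * cnj (g y)) = (LINT y|circle. cnj (f y * cnj (g y)))"
    by (rule Bochner_Integration.integral_cnj[symmetric])
  also have "(\<lambda>y. cnj (f y * cnj (g y))) = (\<lambda>y. g y * cnj (f y))"
    by (simp add: mult.commute)
  finally show "(LINT y|circle. g y * cnj (f y)) = cnj (LINT y|circle. f y * cnj (g y))"
    by (rule sym)
qed

lemma cinner_scaleC_right [simp]: "cinner f (c *\<^sub>C h) = cnj c * cinner f h"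
  by (simp add: cinner_commute[of f])

lemma cinner_add_right: "cinner h (f + g) = cinner h f + cinner h g"
  by (simp add: cinner_commute[of h] cinner_add_left)

lemma cinner_minus_left [simp]: "cinner (- f) h = - cinner f h"
  unfolding uminus_L2T_def by simp

lemma cinner_minus_right [simp]: "cinner f (- h) = - cinner f h"
  unfolding uminus_L2T_def by simp

lemma cinner_diff_left: "cinner (f - g) h = cinner f h - cinner g h"
  unfolding minus_L2T_def cinner_add_left cinner_minus_left by simp

lemma cinner_diff_right: "cinner h (f - g) = cinner h f - cinner h g"
  unfolding minus_L2T_def cinner_add_right cinner_minus_right by simp

lemma cinner_zero_left [simp]: "cinner 0 h = 0"
  using cinner_diff_left[of 0 0 h] by simp

lemma cinner_zero_right [simp]: "cinner h 0 = 0"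
  using cinner_diff_right[of h 0 0] by simp

lemma cinner_scaleR_left [simp]: "cinner (r *\<^sub>R f) h = of_real r * cinner f h"
  by (simp add: scaleR_L2T_def)

lemma cinner_scaleR_right [simp]: "cinner h (r *\<^sub>R f) = of_real r * cinner h f"
  by (simp add: scaleR_L2T_def)

lemma Re_cinner_commute: "Re (cinner f g) = Re (cinner g f)"
  by (subst cinner_commute) simp

lemma Im_cinner_commute: "Im (cinner f g) = - Im (cinner g f)"
  by (subst cinner_commute) simp

lemma cinner_self: "cinner f f = of_real ((norm f)\<^sup>2)"
proof (rule complex_eqI)
  show "Re (cinner f f) = Re (of_real ((norm f)\<^sup>2))"
    using power2_norm_eq_inner[of f] by (simp add: inner_L2T_def)
  show "Im (cinner f f) = Im (of_real ((norm f)\<^sup>2))"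
    using Im_cinner_commute[of f f] by simp
qed

text \<open>Comparing vectors through their inner products avoids unfolding the quotient in each
  algebraic identity.\<close>

lemma L2T_eqI: "(\<And>h. cinner f h = cinner g h) \<Longrightarrow> f = g"
  using cinner_self[of "f - g"] by (simp add: cinner_diff_left)

lemma scaleC_scaleC [simp]: "a *\<^sub>C b *\<^sub>C f = (a * b) *\<^sub>C f"
  by (rule L2T_eqI) (simp add: mult.assoc)

lemma scaleC_add_right: "c *\<^sub>C (f + g) = c *\<^sub>C f + c *\<^sub>C g"
  by (rule L2T_eqI) (simp add: cinner_add_left algebra_simps)

lemma scaleC_diff_right: "c *\<^sub>C (f - g) = c *\<^sub>C f - c *\<^sub>C g"
  by (rule L2T_eqI) (simp add: cinner_diff_left algebra_simps)

lemma scaleC_one [simp]: "1 *\<^sub>C f = f"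
  by (rule L2T_eqI) simp

lemma scaleC_zero_left [simp]: "0 *\<^sub>C f = 0"
  by (rule L2T_eqI) simp

lemma scaleC_zero_right [simp]: "c *\<^sub>C 0 = (0::L2T)"
  by (rule L2T_eqI) simp

lemma scaleC_of_real: "of_real r *\<^sub>C f = r *\<^sub>R f"
  by (simp add: scaleR_L2T_def)

lemma norm_scaleC [simp]: "norm (c *\<^sub>C f) = cmod c * norm f"
proof -
  have "cinner (c *\<^sub>C f) (c *\<^sub>C f) = (c * cnj c) * cinner f f"
    unfolding cinner_scaleC_left cinner_scaleC_right by (simp only: mult_ac)
  then have "complex_of_real ((norm (c *\<^sub>C f))\<^sup>2) = of_real ((cmod c * norm f)\<^sup>2)"
    unfolding cinner_self complex_norm_square[symmetric] power_mult_distrib of_real_mult .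
  then have "(norm (c *\<^sub>C f))\<^sup>2 = (cmod c * norm f)\<^sup>2"
    unfolding of_real_eq_iff .
  then show ?thesis
    by (rule power2_eq_imp_eq) simp_all
qed

lemma norm_cinner_le: "cmod (cinner f g) \<le> norm f * norm g"
proof (cases "cinner f g = 0")
  case False
  define z where "z = cinner f g"
  \<comment> \<open>This phase rotates \<open>f\<close> until the inner product is real and
    nonnegative, so that the real Cauchy-Schwarz inequality applies.\<close>
  define c where "c = cnj z / of_real (cmod z)"
  have "cinner (c *\<^sub>C f) g = of_real (cmod z)"
    using False by (simp add: c_def z_def[symmetric] complex_norm_square[symmetric]
        power2_eq_square mult.commute)
  then have "cmod z = inner (c *\<^sub>C f) g" by (simp add: inner_L2T_def)
  also have "\<dots> \<le> norm (c *\<^sub>C f) * norm g" by (rule norm_cauchy_schwarz)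
  also have "\<dots> = norm f * norm g"
    using False by (simp add: c_def z_def norm_divide)
  finally show ?thesis by (simp add: z_def)
qed simp

lemma Re_cinner_le: "\<bar>Re (cinner f g)\<bar> \<le> norm f * norm g"
  using abs_Re_le_cmod norm_cinner_le order_trans by blast

lemma Im_cinner_le: "\<bar>Im (cinner f g)\<bar> \<le> norm f * norm g"
  using abs_Im_le_cmod norm_cinner_le order_trans by blast

lemma tendsto_cinner:
  assumes "(f \<longlongrightarrow> a) F" shows "((\<lambda>n. cinner (f n) h) \<longlongrightarrow> cinner a h) F"
proof (rule Lim_transform_bound[where g="\<lambda>n. norm (f n - a) * norm h", THEN LIM_zero_cancel])
  show "\<forall>\<^sub>F n in F. norm (cinner (f n) h - cinner a h) \<le> norm (norm (f n - a) * norm h)"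
    by (auto simp: cinner_diff_left[symmetric] norm_cinner_le)
  show "((\<lambda>n. norm (f n - a) * norm h) \<longlongrightarrow> 0) F"
    using tendsto_mult_left_zero[OF tendsto_norm_zero[OF LIM_zero[OF assms]]] .
qed

lemma norm_abs_L2T:
  assumes "square_integrable f" shows "(norm (abs_L2T f))\<^sup>2 = (LINT y|circle. (cmod (f y))\<^sup>2)"
  by (subst norm_L2T.abs_eq) (use assms in \<open>auto simp: L2_rel_def\<close>)

lemma abs_L2T_diff:
  "square_integrable f \<Longrightarrow> square_integrable g \<Longrightarrow> abs_L2T f - abs_L2T g = abs_L2T (\<lambda>y. f y - g y)"
  by (rule L2T_eqI)
     (auto simp: cinner_diff_left cinner_abs_left square_integrable_rep integrable_mult_cnj
        square_integrable_add[of f "\<lambda>y. (-1) * g y", OF _ square_integrable_scale, simplified]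
        left_diff_distrib)

lemma abs_L2T_eq_iff:
  assumes "square_integrable f" "square_integrable g"
  shows "abs_L2T f = abs_L2T g \<longleftrightarrow> (AE y in circle. f y = g y)"
  using Quotient3_rel[OF Quotient3_L2T, of f g] assms by (auto simp: L2_rel_def)

lemma finite_measure_circle: "finite_measure circle"
  by (rule finite_measureI) (simp add: emeasure_restrict_space)

section \<open>Completeness\<close>

lemma integrable_circle_bounded:
  fixes f :: "real \<Rightarrow> 'b::{banach,second_countable_topology}"
  assumes "f \<in> borel_measurable circle" "\<And>y. norm (f y) \<le> B"
  shows "integrable circle f"
  by (rule finite_measure.integrable_const_bound[OF finite_measure_circle, of _ B])
     (use assms in auto)

lemma measure_circle: "measure circle (space circle) = 2 * pi"
  by (simp add: measure_restrict_space)

lemma square_integrable_imp_integrable: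
  assumes "square_integrable f" shows "integrable circle f"
proof (rule Bochner_Integration.integrable_bound)
  show "integrable circle (\<lambda>y. 1 + (cmod (f y))\<^sup>2)"
    using assms integrable_circle_bounded[of "\<lambda>_. 1::real" 1]
    by (simp add: square_integrable_def)
  show "f \<in> borel_measurable circle" using assms by (simp add: square_integrable_def)
  have "x \<le> 1 + x\<^sup>2" for x :: real
    using sum_squares_bound[of x 1] by (simp add: power2_eq_square) (smt (verit) mult_le_0_iff zero_le_square)
  then show "AE y in circle. norm (f y) \<le> norm (1 + (cmod (f y))\<^sup>2)"
    by (auto simp: abs_of_nonneg)
qed

text \<open>Young's inequality with a free parameter: for \<open>t\<close> of the size of the norm
  both summands are linear in it, which makes the series of increments in the completeness proof
  summable.\<close>

lemma L1_le_L2: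
  assumes "square_integrable f" "0 < t"
  shows "(LINT y|circle. cmod (f y)) \<le> pi * t + (norm (abs_L2T f))\<^sup>2 / (2 * t)"
proof -
  have int: "integrable circle (\<lambda>y. cmod (f y))"
    using square_integrable_imp_integrable[OF assms(1)] by simp
  have sq: "integrable circle (\<lambda>y. (cmod (f y))\<^sup>2)" using assms by (simp add: square_integrable_def)
  have c: "integrable circle (\<lambda>y. t / 2)" by (rule integrable_circle_bounded[of _ "t/2"]) (use assms in auto)
  have "cmod (f y) \<le> t / 2 + (cmod (f y))\<^sup>2 / (2 * t)" for y
    using sum_squares_bound[of "cmod (f y)" t] assms
    by (simp add: field_simps power2_eq_square)
  then have "(LINT y|circle. cmod (f y)) \<le> (LINT y|circle. t / 2 + (cmod (f y))\<^sup>2 / (2 * t))"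
    using int sq c by (intro integral_mono) auto
  also have "\<dots> = (LINT y|circle. t / 2) + (LINT y|circle. (cmod (f y))\<^sup>2) / (2 * t)"
    using sq c by simp
  also have "\<dots> = pi * t + (norm (abs_L2T f))\<^sup>2 / (2 * t)"
    using norm_abs_L2T[OF assms(1)] measure_circle by simp
  finally show ?thesis .
qed

lemma fast_Cauchy_subseq:
  fixes X :: "nat \<Rightarrow> 'a::metric_space"
  assumes "Cauchy X"
  obtains r :: "nat \<Rightarrow> nat" where "strict_mono r"
    "\<And>k m n. m \<ge> r k \<Longrightarrow> n \<ge> r k \<Longrightarrow> dist (X m) (X n) < (1/2) ^ k"
proof -
  have "\<exists>N. \<forall>m\<ge>N. \<forall>n\<ge>N. dist (X m) (X n) < (1/2) ^ k" for k :: nat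
    using assms by (auto simp: Cauchy_def)
  then obtain N where N: "\<And>k m n. m \<ge> N k \<Longrightarrow> n \<ge> N k \<Longrightarrow> dist (X m) (X n) < (1/2) ^ k"
    by metis
  define r where "r k = k + (\<Sum>i\<le>k. N i)" for k
  have "strict_mono r" by (rule strict_mono_Suc_iff[THEN iffD2]) (simp add: r_def)
  moreover have "N k \<le> r k" for k
    using member_le_sum[of k "{..k}" N] by (simp add: r_def)
  ultimately show thesis using N that by (meson order_trans)
qed

lemma L2T_diff_rep:
  "norm (f - g) = norm (abs_L2T (\<lambda>y. rep_L2T f y - rep_L2T g y))"
  by (subst abs_L2T_diff[OF square_integrable_rep square_integrable_rep, symmetric])
     (simp add: abs_rep_L2T)

text \<open>Along a subsequence with geometric gaps the increments are summable almost everywhere,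
  so the representatives converge pointwise; Fatou's lemma then gives convergence in norm.\<close>

lemma L2T_Cauchy_convergent:
  fixes X :: "nat \<Rightarrow> L2T"
  assumes "Cauchy X"
  shows "convergent X"
proof -
  obtain r where r: "strict_mono r"
    and fast: "\<And>k m n. m \<ge> r k \<Longrightarrow> n \<ge> r k \<Longrightarrow> dist (X m) (X n) < (1/2) ^ k"
    by (rule fast_Cauchy_subseq[OF assms]) blast
  define f where "f k = rep_L2T (X (r k))" for k
  define g where "g k y = f (Suc k) y - f k y" for k y
  have sq: "square_integrable (f k)" for k by (simp add: f_def square_integrable_rep)
  have sqd: "square_integrable (\<lambda>y. f j y - f k y)" for j k
    using square_integrable_add[OF sq[of j] square_integrable_scale[OF sq[of k], of "-1"]] by simp
  have normd: "norm (abs_L2T (\<lambda>y. f j y - f k y)) < (1/2) ^ i" if "i \<le> j" "i \<le> k" for i j k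
    using fast[of i "r j" "r k"] that strict_mono_less_eq[OF r]
    by (simp add: f_def L2T_diff_rep[symmetric] dist_norm)
  have g_int: "integrable circle (\<lambda>y. cmod (g k y))" for k
    unfolding g_def using square_integrable_imp_integrable[OF sqd] by auto
  have g_L1: "(LINT y|circle. cmod (g k y)) \<le> (pi + 1) * (1/2) ^ k" for k
  proof -
    let ?t = "(1/2) ^ k :: real"
    have "(LINT y|circle. cmod (g k y)) \<le> pi * ?t + (norm (abs_L2T (g k)))\<^sup>2 / (2 * ?t)"
      unfolding g_def by (rule L1_le_L2[OF sqd]) simp
    also have "(norm (abs_L2T (g k)))\<^sup>2 \<le> ?t\<^sup>2"
      using normd[of k "Suc k" k] by (intro power_mono) (auto simp: g_def[abs_def])
    also have "?t\<^sup>2 / (2 * ?t) \<le> ?t" by (simp add: power2_eq_square)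
    finally show ?thesis by (simp add: divide_right_mono distrib_right)
  qed
  have f_meas [measurable]: "f k \<in> borel_measurable circle" for k by (simp add: f_def)
  have g_meas [measurable]: "g k \<in> borel_measurable circle" for k
    unfolding g_def[abs_def] by measurable
  have "(\<integral>\<^sup>+y. (\<Sum>k. ennreal (cmod (g k y))) \<partial>circle) = (\<Sum>k. \<integral>\<^sup>+y. ennreal (cmod (g k y)) \<partial>circle)"
    by (rule nn_integral_suminf) measurable
  also have "\<dots> = (\<Sum>k. ennreal (LINT y|circle. cmod (g k y)))"
    using g_int by (simp add: nn_integral_eq_integral)
  also have "\<dots> \<le> (\<Sum>k. ennreal ((pi + 1) * (1/2) ^ k))"
    by (intro suminf_le ennreal_leI g_L1) auto
  also have "\<dots> = ennreal (\<Sum>k. (pi + 1) * (1/2) ^ k)"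
    by (intro suminf_ennreal2) (auto intro!: summable_mult summable_geometric)
  also have "\<dots> < top" by simp
  finally have "(\<integral>\<^sup>+y. (\<Sum>k. ennreal (cmod (g k y))) \<partial>circle) \<noteq> \<infinity>"
    by simp
  then have "AE y in circle. (\<Sum>k. ennreal (cmod (g k y))) \<noteq> \<infinity>"
    by (intro nn_integral_PInf_AE) measurable
  then have conv: "AE y in circle. convergent (\<lambda>k. f k y)"
  proof eventually_elim
    case (elim y)
    then have "summable (\<lambda>k. cmod (g k y))"
      by (intro summable_suminf_not_top) auto
    then have "summable (\<lambda>k. g k y)" by (rule summable_norm_cancel)
    then have "convergent (\<lambda>n. \<Sum>k<n. g k y)" by (simp add: summable_iff_convergent)
    moreover have "(\<Sum>k<n. g k y) = f n y - f 0 y" for n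
      using sum_lessThan_telescope[of "\<lambda>k. f k y" n] by (simp add: g_def)
    ultimately have "convergent (\<lambda>n. f n y - f 0 y)" by simp
    from convergent_add[OF this convergent_const[of "f 0 y"]] show ?case by simp
  qed
  define L where "L y = lim (\<lambda>k. f k y)" for y
  have [measurable]: "L \<in> borel_measurable circle"
    unfolding L_def[abs_def] by measurable
  \<comment> \<open>Letting \<open>j\<close> tend to infinity in the Cauchy estimate for
    \<open>f j - f k\<close> both shows that the limit is square integrable and gives the rate of
    convergence.\<close>
  have Fatou: "(\<integral>\<^sup>+y. ennreal ((cmod (L y - f k y))\<^sup>2) \<partial>circle) \<le> ennreal (((1/2)^k)\<^sup>2)" for k
  proof -
    have "AE y in circle. ennreal ((cmod (L y - f k y))\<^sup>2)
        = liminf (\<lambda>j. ennreal ((cmod (f j y - f k y))\<^sup>2))"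
      using conv
    proof eventually_elim
      case (elim y)
      then have "(\<lambda>j. f j y) \<longlonglongrightarrow> L y" unfolding L_def by (simp add: convergent_LIMSEQ_iff)
      then have "(\<lambda>j. ennreal ((cmod (f j y - f k y))\<^sup>2)) \<longlonglongrightarrow> ennreal ((cmod (L y - f k y))\<^sup>2)"
        by (intro tendsto_ennrealI tendsto_intros)
      from lim_imp_Liminf[OF _ this] show ?case by simp
    qed
    then have "(\<integral>\<^sup>+y. ennreal ((cmod (L y - f k y))\<^sup>2) \<partial>circle)
       = (\<integral>\<^sup>+y. liminf (\<lambda>j. ennreal ((cmod (f j y - f k y))\<^sup>2)) \<partial>circle)"
      by (rule nn_integral_cong_AE)
    also have "\<dots> \<le> liminf (\<lambda>j. \<integral>\<^sup>+y. ennreal ((cmod (f j y - f k y))\<^sup>2) \<partial>circle)"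
      by (rule nn_integral_liminf) measurable
    also have "\<dots> \<le> ennreal (((1/2)^k)\<^sup>2)"
    proof (rule Liminf_le)
      show "\<forall>\<^sub>F j in sequentially. (\<integral>\<^sup>+y. ennreal ((cmod (f j y - f k y))\<^sup>2) \<partial>circle) \<le> ennreal (((1/2)^k)\<^sup>2)"
        using eventually_ge_at_top[of k]
      proof eventually_elim
        case (elim j)
        have "(\<integral>\<^sup>+y. ennreal ((cmod (f j y - f k y))\<^sup>2) \<partial>circle)
            = ennreal ((norm (abs_L2T (\<lambda>y. f j y - f k y)))\<^sup>2)"
          using sqd[of j k] norm_abs_L2T[OF sqd[of j k]]
          by (simp add: nn_integral_eq_integral square_integrable_def)
        also have "\<dots> \<le> ennreal (((1/2)^k)\<^sup>2)"
          using normd[OF elim order_refl] by (intro ennreal_leI power_mono) auto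
        finally show ?case .
      qed
    qed simp
    finally show ?thesis .
  qed
  have sqLf: "square_integrable (\<lambda>y. L y - f k y)" for k
    unfolding square_integrable_def
  proof
    show "integrable circle (\<lambda>y. (cmod (L y - f k y))\<^sup>2)"
      using Fatou[of k] by (intro integrableI_nonneg) (auto simp: top_unique less_top neq_top_trans intro: le_less_trans)
  qed measurable
  have sqL: "square_integrable L"
    using square_integrable_add[OF sqLf[of 0] sq[of 0]] by simp
  have close: "norm (abs_L2T L - X (r k)) \<le> (1/2)^k" for k
  proof -
    have "abs_L2T L - X (r k) = abs_L2T (\<lambda>y. L y - f k y)"
      using abs_L2T_diff[OF sqL sq[of k]] by (simp add: f_def abs_rep_L2T)
    moreover have "ennreal ((norm (abs_L2T (\<lambda>y. L y - f k y)))\<^sup>2) \<le> ennreal (((1/2)^k)\<^sup>2)"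
      using Fatou[of k] sqLf[of k]
      by (simp add: norm_abs_L2T nn_integral_eq_integral square_integrable_def)
    ultimately show ?thesis by (simp add: power2_le_iff_abs_le)
  qed
  have "(\<lambda>k. X (r k) - abs_L2T L) \<longlonglongrightarrow> 0"
  proof (rule Lim_null_comparison)
    show "\<forall>\<^sub>F k in sequentially. norm (X (r k) - abs_L2T L) \<le> (1/2) ^ k"
      using close by (simp add: norm_minus_commute)
    show "(\<lambda>k. (1/2) ^ k :: real) \<longlonglongrightarrow> 0" by (rule LIMSEQ_power_zero) simp
  qed
  then have "(X \<circ> r) \<longlonglongrightarrow> abs_L2T L" by (simp add: LIM_zero_iff o_def)
  with Cauchy_converges_subseq[OF assms r] show ?thesis by (auto simp: convergent_def)
qed

instance L2T :: complete_space
  by standard (rule L2T_Cauchy_convergent)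

section \<open>Fourier series\<close>

lemma circle_integral_eq:
  fixes f :: "real \<Rightarrow> 'b::euclidean_space"
  assumes "continuous_on UNIV f"
  shows "integrable circle f" "(LINT y|circle. f y) = integral {0..2*pi} f"
proof -
  show int: "integrable circle f"
    by (intro absolutely_integrable_imp_integrable absolutely_integrable_continuous_real)
      (use assms continuous_on_subset in auto)
  show "(LINT y|circle. f y) = integral {0..2*pi} f"
    by (rule lebesgue_integral_eq_integral[OF int]) auto
qed

lemma circle_FTC:
  fixes f :: "real \<Rightarrow> 'b::euclidean_space"
  assumes "\<And>y. (F has_vector_derivative f y) (at y)" "continuous_on UNIV f"
  shows "(LINT y|circle. f y) = F (2*pi) - F 0"
proof -
  have "(f has_integral F (2*pi) - F 0) {0..2*pi}"
    by (rule fundamental_theorem_of_calculus) (simp_all add: assms(1) has_vector_derivative_at_within)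
  then show ?thesis using circle_integral_eq(2)[OF assms(2)] by (simp add: integral_unique)
qed

lemma borel_measurable_circle_continuous:
  assumes "continuous_on UNIV f" shows "f \<in> borel_measurable circle"
  by (rule continuous_imp_measurable_on_sets_lebesgue) (use assms continuous_on_subset in auto)

lemma square_integrable_continuous:
  assumes "continuous_on UNIV f" shows "square_integrable f"
  unfolding square_integrable_def
proof
  show "f \<in> borel_measurable circle" by (rule borel_measurable_circle_continuous[OF assms])
  show "integrable circle (\<lambda>y. (cmod (f y))\<^sup>2)"
    by (rule circle_integral_eq) (intro continuous_intros assms)
qed

section \<open>Complex exponentials and Fourier coefficients\<close>

definition fexp :: "int \<Rightarrow> real \<Rightarrow> complex" where
  "fexp n y = cis (of_int n * y)"

lemma fexp_0 [simp]: "fexp 0 y = 1" by (simp add: fexp_def)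
lemma norm_fexp [simp]: "cmod (fexp n y) = 1" by (simp add: fexp_def)
lemma fexp_mult: "fexp m y * fexp n y = fexp (m + n) y"
  by (simp add: fexp_def cis_mult distrib_right)
lemma cnj_fexp: "cnj (fexp n y) = fexp (- n) y"
  by (simp add: fexp_def cis_cnj)
lemma fexp_2pi: "fexp n (y + 2 * pi) = fexp n y"
proof -
  have "fexp n (y + 2 * pi) = cis (of_int n * y) * cis (2 * pi * of_int n)"
    by (simp add: fexp_def cis_mult algebra_simps)
  also have "cis (2 * pi * of_int n) = 1"
    by (simp add: cis_conv_exp exp_eq_1 mult_ac)
  finally show ?thesis by (simp add: fexp_def)
qed
lemma fexp_deriv: "(fexp n has_vector_derivative \<i> * of_int n * fexp n y) (at y)"
proof -
  have "((\<lambda>z. exp (\<i> * (of_int n * z))) has_field_derivative \<i> * of_int n * exp (\<i> * (of_int n * of_real y)))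
      (at (of_real y))"
    by (auto intro!: derivative_eq_intros)
  from has_vector_derivative_real_field[OF this] show ?thesis
    by (simp add: fexp_def[abs_def] cis_conv_exp)
qed
lemma continuous_fexp: "continuous_on UNIV (fexp n)"
  unfolding fexp_def[abs_def] by (intro continuous_intros)

lemma smooth_periodic_fexp: "smooth_periodic (fexp n)"
  unfolding smooth_periodic_def
proof (intro conjI allI exI[of _ "\<lambda>k y. (\<i> * of_int n) ^ k * fexp n y"])
  fix k y
  show "((\<lambda>y. (\<i> * of_int n) ^ k * fexp n y) has_vector_derivative (\<i> * of_int n) ^ Suc k * fexp n y) (at y)"
    using has_vector_derivative_mult_right[OF fexp_deriv[of n y], of "(\<i> * of_int n) ^ k"]
    by (simp add: mult_ac)
qed (auto simp: fexp_2pi)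

lemma integral_fexp: "(LINT y|circle. fexp n y) = (if n = 0 then 2 * pi else 0)"
proof (cases "n = 0")
  case True
  then show ?thesis using measure_circle by (simp add: scaleR_conv_of_real)
next
  case False
  have "((\<lambda>y. fexp n y / (\<i> * of_int n)) has_vector_derivative fexp n y) (at y)" for y
    using has_vector_derivative_divide[OF fexp_deriv[of n y], of "\<i> * of_int n"] False by simp
  from circle_FTC[OF this continuous_fexp] show ?thesis
    using False fexp_2pi[of n 0] by simp
qed

text \<open>The exponentials are left unnormalised, with squared norm \<open>2 * pi\<close>; this is
  the origin of the factors \<open>2 * pi\<close> in the series.\<close>

definition e :: "int \<Rightarrow> L2T" where "e n = abs_L2T (fexp n)"

definition fcoeff :: "L2T \<Rightarrow> int \<Rightarrow> complex" where "fcoeff f n = cinner f (e n)"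

lemma square_integrable_fexp: "square_integrable (fexp n)"
  by (rule square_integrable_continuous[OF continuous_fexp])

lemma fcoeff_eq: "fcoeff f n = (LINT y|circle. rep_L2T f y * fexp (- n) y)"
  unfolding fcoeff_def e_def cinner_abs_right[OF square_integrable_fexp] cnj_fexp ..

lemma cinner_e_e: "cinner (e m) (e n) = (if m = n then 2 * pi else 0)"
  unfolding e_def by (simp add: cinner_abs_abs square_integrable_fexp cnj_fexp fexp_mult integral_fexp)

text \<open>A function on the circle that is continuous after pulling back along the parametrisation is
  itself continuous because closed sets of parameters have compact image.\<close>

lemma continuous_on_sphere_Arg2pi:
  fixes \<phi> :: "real \<Rightarrow> complex"
  assumes cont: "continuous_on {0..2*pi} \<phi>" and per: "\<phi> (2*pi) = \<phi> 0"
  shows "continuous_on (sphere 0 1) (\<phi> \<circ> Arg2pi)"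
    and "\<And>y. y \<in> {0..2*pi} \<Longrightarrow> \<phi> (Arg2pi (cis y)) = \<phi> y"
proof -
  show eq: "\<phi> (Arg2pi (cis y)) = \<phi> y" if "y \<in> {0..2*pi}" for y
  proof (cases "y = 2 * pi")
    case True
    have "Arg2pi 1 = 0" by (rule Arg2pi_unique[of 1]) auto
    then show ?thesis using True per by (simp add: cis_2pi)
  next
    case False
    have "Arg2pi (cis y) = y" by (rule Arg2pi_unique[of 1]) (use that False in \<open>auto simp: cis_conv_exp\<close>)
    then show ?thesis by simp
  qed
  show "continuous_on (sphere 0 1) (\<phi> \<circ> Arg2pi)"
    unfolding continuous_on_closed_vimage[OF closed_sphere]
  proof (intro allI impI)
    fix B :: "complex set" assume "closed B"
    have "(\<phi> \<circ> Arg2pi) -` B \<inter> sphere 0 1 = cis ` ({0..2*pi} \<inter> \<phi> -` B)"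
    proof safe
      fix z :: complex assume z: "z \<in> sphere 0 1" "(\<phi> \<circ> Arg2pi) z \<in> B"
      have "cis (Arg2pi z) = z" using z(1) complex_norm_eq_1_exp[of z] by (simp add: cis_conv_exp)
      moreover have "Arg2pi z \<in> {0..2*pi}" using Arg2pi_ge_0[of z] Arg2pi_lt_2pi[of z] by simp
      ultimately show "z \<in> cis ` ({0..2*pi} \<inter> \<phi> -` B)" using z by force
    qed (use eq in auto)
    moreover have "compact (cis ` ({0..2*pi} \<inter> \<phi> -` B))"
      using continuous_closed_preimage[OF cont _ \<open>closed B\<close>]
      by (intro compact_continuous_image continuous_intros)
        (metis compact_Icc closed_atLeastAtMost compact_Int_closed inf.left_idem)
    ultimately show "closed ((\<phi> \<circ> Arg2pi) -` B \<inter> sphere 0 1)" by (simp add: compact_imp_closed)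
  qed
qed

section \<open>Trigonometric polynomials and completeness of the exponentials\<close>

inductive trig_poly :: "(real \<Rightarrow> complex) \<Rightarrow> bool" where
  fexp: "trig_poly (fexp n)"
| scale: "trig_poly p \<Longrightarrow> trig_poly (\<lambda>y. c * p y)"
| add: "trig_poly p \<Longrightarrow> trig_poly q \<Longrightarrow> trig_poly (\<lambda>y. p y + q y)"

lemma trig_poly_mult:
  assumes "trig_poly p" "trig_poly q" shows "trig_poly (\<lambda>y. p y * q y)"
  using assms(1)
proof induction
  case (fexp n)
  from assms(2) show ?case
  proof induction
    case (fexp m)
    then show ?case using trig_poly.fexp[of "n + m"] by (simp add: fexp_mult[abs_def] fexp_mult)
  next
    case (scale p c)
    then show ?case using trig_poly.scale[of "\<lambda>y. fexp n y * p y" c] by (simp add: mult_ac)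
  next
    case (add p q)
    then show ?case using trig_poly.add by (simp add: distrib_left)
  qed
next
  case (scale p c)
  then show ?case using trig_poly.scale[of "\<lambda>y. p y * q y" c] by (simp add: mult_ac)
next
  case (add p q)
  then show ?case using trig_poly.add by (simp add: distrib_right)
qed

lemma trig_poly_const: "trig_poly (\<lambda>y. c)"
  using trig_poly.scale[OF trig_poly.fexp[of 0], of c] by simp

text \<open>On the circle the linear functions are combinations of cosine and sine, hence of the
  frequencies 1 and -1, and products only add frequencies.\<close>

lemma trig_poly_real_polynomial:
  assumes "real_polynomial_function p"
  shows "trig_poly (\<lambda>y. of_real (p (cis y)))"
  using assms
proof induction
  case (linear h)
  interpret h: bounded_linear h by fact
  have "of_real (h (cis y)) = (h 1 - \<i> * h \<i>) / 2 * fexp 1 y + (h 1 + \<i> * h \<i>) / 2 * fexp (-1) y" for y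
  proof -
    have "cis y = cos y *\<^sub>R 1 + sin y *\<^sub>R \<i>" by (simp add: complex_eq_iff)
    then have "h (cis y) = cos y * h 1 + sin y * h \<i>" by (simp only: h.add h.scaleR real_scaleR_def)
    then show ?thesis by (simp add: fexp_def complex_eq_iff field_simps)
  qed
  then show ?case
    by (simp only:) (intro trig_poly.intros)
next
  case (add f g)
  then show ?case using trig_poly.add by simp
next
  case (mult f g)
  then show ?case using trig_poly_mult by simp
qed (rule trig_poly_const)

lemma trig_poly_polynomial:
  assumes "polynomial_function (p :: complex \<Rightarrow> complex)"
  shows "trig_poly (\<lambda>y. p (cis y))"
proof -
  have "real_polynomial_function (\<lambda>z. Re (p z))" "real_polynomial_function (\<lambda>z. Im (p z))"
    using assms bounded_linear_Re bounded_linear_Im by (auto simp: polynomial_function_def o_def)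
  then have "trig_poly (\<lambda>y. of_real (Re (p (cis y))) + \<i> * of_real (Im (p (cis y))))"
    by (intro trig_poly.add trig_poly.scale trig_poly_real_polynomial)
  then show ?thesis by (simp add: complex_eq[symmetric])
qed

lemma trig_poly_orthogonal:
  assumes "\<And>n. fcoeff f n = 0" "trig_poly p"
  shows "integrable circle (\<lambda>y. rep_L2T f y * p y) \<and> (LINT y|circle. rep_L2T f y * p y) = 0"
  using assms(2)
proof induction
  case (fexp n)
  then show ?case
    using assms(1)[of "- n"] integrable_mult_cnj[OF square_integrable_rep square_integrable_fexp, of f "- n"]
    by (simp add: fcoeff_eq cnj_fexp)
next
  case (scale p c)
  then show ?case by (simp add: mult.left_commute)
next
  case (add p q)
  then show ?case by (simp add: distrib_left)
qed

text \<open>By Stone-Weierstrass on the circle, \<open>\<phi>\<close> is uniformly close to a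
  trigonometric polynomial, so the pairing is at most the \<open>L1\<close> norm of \<open>f\<close>
  times an arbitrary error.\<close>

lemma continuous_orthogonal:
  assumes coeff: "\<And>n. fcoeff f n = 0"
    and cont: "continuous_on UNIV \<phi>" and per: "\<phi> (2*pi) = \<phi> 0"
  shows "(LINT y|circle. rep_L2T f y * \<phi> y) = 0"
proof -
  have int_f: "integrable circle (rep_L2T f)"
    by (rule square_integrable_imp_integrable[OF square_integrable_rep])
  let ?K = "LINT y|circle. cmod (rep_L2T f y)"
  have int_phi: "integrable circle (\<lambda>y. rep_L2T f y * \<phi> y)"
    using integrable_mult_cnj[OF square_integrable_rep[of f], of "\<lambda>y. cnj (\<phi> y)"]
      square_integrable_continuous[of "\<lambda>y. cnj (\<phi> y)"] cont by (simp add: continuous_on_cnj)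
  note \<Phi> = continuous_on_sphere_Arg2pi[OF continuous_on_subset[OF cont] per]
  have bound: "cmod (LINT y|circle. rep_L2T f y * \<phi> y) \<le> ?K * \<epsilon>" if "\<epsilon> > 0" for \<epsilon>
  proof -
    obtain p where p: "polynomial_function p" "\<And>z. z \<in> sphere 0 1 \<Longrightarrow> norm ((\<phi> \<circ> Arg2pi) z - p z) < \<epsilon>"
      using Stone_Weierstrass_polynomial_function[OF compact_sphere \<Phi>(1) \<open>\<epsilon> > 0\<close>] by auto
    have tp: "integrable circle (\<lambda>y. rep_L2T f y * p (cis y))" "(LINT y|circle. rep_L2T f y * p (cis y)) = 0"
      using trig_poly_orthogonal[OF coeff trig_poly_polynomial[OF p(1)]] by auto
    have le: "cmod (\<phi> y - p (cis y)) \<le> \<epsilon>" if "y \<in> {0..2*pi}" for y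
      using p(2)[of "cis y"] \<Phi>(2)[OF _ that] by (simp add: less_imp_le)
    have "(LINT y|circle. rep_L2T f y * \<phi> y) = (LINT y|circle. rep_L2T f y * (\<phi> y - p (cis y)))"
      using int_phi tp by (simp add: right_diff_distrib)
    also have "cmod \<dots> \<le> (LINT y|circle. cmod (rep_L2T f y * (\<phi> y - p (cis y))))"
      by (rule integral_norm_bound)
    also have "\<dots> \<le> (LINT y|circle. cmod (rep_L2T f y) * \<epsilon>)"
    proof (rule integral_mono)
      show "integrable circle (\<lambda>y. cmod (rep_L2T f y * (\<phi> y - p (cis y))))"
        using int_phi tp by (intro integrable_norm) (simp add: right_diff_distrib)
      show "integrable circle (\<lambda>y. cmod (rep_L2T f y) * \<epsilon>)" using int_f by simp
      show "cmod (rep_L2T f y * (\<phi> y - p (cis y))) \<le> cmod (rep_L2T f y) * \<epsilon>" if "y \<in> space circle" for y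
        using le[of y] that by (simp add: norm_mult mult_left_mono)
    qed
    finally show ?thesis by simp
  qed
  have "cmod (LINT y|circle. rep_L2T f y * \<phi> y) \<le> 0"
  proof (rule field_le_epsilon)
    fix \<epsilon> :: real assume "\<epsilon> > 0"
    have K: "?K \<ge> 0" by simp
    have "cmod (LINT y|circle. rep_L2T f y * \<phi> y) \<le> ?K * (\<epsilon> / (?K + 1))"
      by (rule bound) (use \<open>\<epsilon> > 0\<close> K in \<open>simp add: add_nonneg_pos\<close>)
    also have "\<dots> \<le> \<epsilon>"
    proof -
      have "k * (\<epsilon> / (k + 1)) \<le> \<epsilon>" if "k \<ge> 0" for k :: real
        using that \<open>\<epsilon> > 0\<close> by (simp add: divide_le_eq distrib_left mult.commute)
      then show ?thesis using K .
    qed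
    finally show "cmod (LINT y|circle. rep_L2T f y * \<phi> y) \<le> 0 + \<epsilon>" by simp
  qed
  then show ?thesis by simp
qed

lemma mult_cnj_sgn: "z * cnj (sgn z) = complex_of_real (cmod z)"
proof (cases "z = 0")
  case False
  have "z * cnj (sgn z) = (z * cnj z) / of_real (cmod z)"
    by (simp add: sgn_div_norm scaleR_conv_of_real field_simps)
  also have "\<dots> = of_real (cmod z)"
    using False unfolding complex_norm_square[symmetric] by (simp add: power2_eq_square)
  finally show ?thesis .
qed simp

text \<open>Pairing \<open>f\<close> with the conjugate of its sign gives the integral of
  \<open>\<bar>f\<bar>\<close>. The sign is merely measurable, so it is replaced by bounded
  continuous periodic functions, which \<open>continuous_orthogonal\<close> covers, and dominated
  convergence passes to the limit.\<close>

theorem fcoeff_zero_imp_zero: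
  assumes coeff: "\<And>n. fcoeff f n = 0" shows "f = 0"
proof -
  let ?f = "rep_L2T f"
  define h where "h y = cnj (sgn (?f y))" for y
  have h_le: "cmod (h y) \<le> 1" for y by (simp add: h_def norm_sgn)
  have "(\<lambda>y. sgn (?f y)) \<in> borel_measurable circle"
    unfolding sgn_div_norm by measurable
  then have "h \<in> borel_measurable circle" unfolding h_def[abs_def] by measurable
  \<comment> \<open>In this form measurability supplies continuous functions converging to
    \<open>h\<close> off a negligible set.\<close>
  then have "h measurable_on {0..2*pi}" by (simp add: measurable_on_iff_borel_measurable)
  then obtain N g where N: "negligible N" and g: "\<And>n. continuous_on UNIV (g n)"
    and lim: "\<And>y. y \<notin> N \<Longrightarrow> (\<lambda>n. g n y) \<longlonglongrightarrow> (if y \<in> {0..2*pi} then h y else 0)"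
    unfolding measurable_on_def by blast
  \<comment> \<open>The first factor vanishes at both end points, which enforces periodicity, and
    tends to 1 in between. The second truncates the modulus at 1 and leaves the limit unchanged
    because \<open>cmod (h y)\<close> is at most 1.\<close>
  define \<phi> :: "nat \<Rightarrow> real \<Rightarrow> complex" where
    "\<phi> n y = of_real (min 1 (real n * (sin (y / 2))\<^sup>2)) * (g n y / of_real (max 1 (cmod (g n y))))" for n y
  have \<phi>_cont: "continuous_on UNIV (\<phi> n)" for n
    unfolding \<phi>_def[abs_def] by (intro continuous_intros g) (auto simp: max_def)
  have \<phi>_le: "cmod (\<phi> n y) \<le> 1" for n y
  proof -
    have "cmod (\<phi> n y) = min 1 (real n * (sin (y / 2))\<^sup>2) * (cmod (g n y) / max 1 (cmod (g n y)))"
      by (simp add: \<phi>_def norm_mult norm_divide)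
    also have "\<dots> \<le> 1 * 1" by (intro mult_mono) (auto simp: divide_le_eq)
    finally show ?thesis by simp
  qed
  have \<phi>_lim: "(\<lambda>n. \<phi> n y) \<longlonglongrightarrow> h y" if "y \<notin> N" "y \<in> {0<..<2*pi}" for y
  proof -
    have "sin (y / 2) > 0" using that by (intro sin_gt_zero) auto
    then have pos: "(sin (y / 2))\<^sup>2 > 0" by simp
    have "(\<lambda>n. min 1 (real n * (sin (y / 2))\<^sup>2)) \<longlonglongrightarrow> 1"
    proof (rule tendsto_eventually)
      obtain n0 :: nat where n0: "1 / (sin (y / 2))\<^sup>2 \<le> real n0" using real_arch_simple by blast
      show "\<forall>\<^sub>F n in sequentially. min 1 (real n * (sin (y / 2))\<^sup>2) = 1"
        using eventually_ge_at_top[of n0]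
      proof eventually_elim
        case (elim n)
        then have "1 / (sin (y / 2))\<^sup>2 \<le> real n" using n0 by linarith
        then show ?case using pos by (simp add: field_simps min_def)
      qed
    qed
    moreover have gl: "(\<lambda>n. g n y) \<longlonglongrightarrow> h y" using lim[OF that(1)] that(2) by simp
    ultimately have "(\<lambda>n. \<phi> n y) \<longlonglongrightarrow> of_real 1 * (h y / of_real (max 1 (cmod (h y))))"
      unfolding \<phi>_def by (intro tendsto_intros) auto
    moreover have "max 1 (cmod (h y)) = 1" using h_le[of y] by simp
    ultimately show ?thesis by simp
  qed
  have int_f: "integrable circle ?f" by (rule square_integrable_imp_integrable[OF square_integrable_rep])
  have "(\<lambda>n. LINT y|circle. ?f y * \<phi> n y) \<longlonglongrightarrow> (LINT y|circle. ?f y * h y)"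
  proof (rule integral_dominated_convergence[where w="\<lambda>y. cmod (?f y)"])
    show "(\<lambda>y. ?f y * h y) \<in> borel_measurable circle"
      using \<open>h \<in> borel_measurable circle\<close> by measurable
    show "(\<lambda>y. ?f y * \<phi> n y) \<in> borel_measurable circle" for n
      using borel_measurable_circle_continuous[OF \<phi>_cont] by measurable
    show "integrable circle (\<lambda>y. cmod (?f y))" using int_f by simp
    show "AE y in circle. norm (?f y * \<phi> n y) \<le> cmod (?f y)" for n
      using \<phi>_le[of n] by (auto simp: norm_mult mult_left_le)
    have "negligible (N \<union> {0, 2*pi})" using N by simp
    then have "AE y in lebesgue. y \<notin> N \<union> {0, 2*pi}"
      unfolding negligible_iff_null_sets by (rule AE_not_in)
    then have "AE y in lebesgue. y \<in> {0..2*pi} \<longrightarrow> (\<lambda>n. ?f y * \<phi> n y) \<longlonglongrightarrow> ?f y * h y"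
    proof eventually_elim
      case (elim y)
      then show ?case using \<phi>_lim[of y] by (auto intro!: tendsto_mult)
    qed
    then show "AE y in circle. (\<lambda>n. ?f y * \<phi> n y) \<longlonglongrightarrow> ?f y * h y"
      by (simp add: AE_restrict_space_iff)
  qed
  moreover have "(LINT y|circle. ?f y * \<phi> n y) = 0" for n
    by (rule continuous_orthogonal[OF coeff \<phi>_cont]) (simp add: \<phi>_def)
  ultimately have "(LINT y|circle. ?f y * h y) = 0" by (simp add: LIMSEQ_const_iff)
  moreover have "?f y * h y = of_real (cmod (?f y))" for y
    by (simp add: h_def mult_cnj_sgn)
  ultimately have "(LINT y|circle. cmod (?f y)) = 0"
    by simp
  then have "AE y in circle. ?f y = 0"
    using int_f by (simp add: integral_nonneg_eq_0_iff_AE)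
  then have "abs_L2T ?f = abs_L2T (\<lambda>y. 0)"
    by (subst abs_L2T_eq_iff) (auto simp: square_integrable_rep square_integrable_0)
  then show "f = 0" by (simp add: abs_rep_L2T zero_L2T.abs_eq)
qed

lemma fcoeff_add [simp]: "fcoeff (f + g) n = fcoeff f n + fcoeff g n"
  by (simp add: fcoeff_def cinner_add_left)
lemma fcoeff_diff [simp]: "fcoeff (f - g) n = fcoeff f n - fcoeff g n"
  by (simp add: fcoeff_def cinner_diff_left)
lemma fcoeff_scaleC [simp]: "fcoeff (c *\<^sub>C f) n = c * fcoeff f n"
  by (simp add: fcoeff_def)
lemma fcoeff_scaleR [simp]: "fcoeff (r *\<^sub>R f) n = of_real r * fcoeff f n"
  by (simp add: fcoeff_def)
lemma fcoeff_minus [simp]: "fcoeff (- f) n = - fcoeff f n"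
  by (simp add: fcoeff_def)
lemma fcoeff_zero [simp]: "fcoeff 0 n = 0"
  by (simp add: fcoeff_def)
lemma fcoeff_e: "fcoeff (e m) n = (if m = n then 2 * pi else 0)"
  by (simp add: fcoeff_def cinner_e_e)

lemma fcoeff_eqI: "(\<And>n. fcoeff f n = fcoeff g n) \<Longrightarrow> f = g"
  using fcoeff_zero_imp_zero[of "f - g"] by simp

section \<open>Bessel, Riesz-Fischer and Parseval\<close>

lemma cinner_sum_left: "cinner (\<Sum>i\<in>A. F i) h = (\<Sum>i\<in>A. cinner (F i) h)"
  by (induction A rule: infinite_finite_induct) (auto simp: cinner_add_left)

lemma cinner_sum_right: "cinner h (\<Sum>i\<in>A. F i) = (\<Sum>i\<in>A. cinner h (F i))"
  by (induction A rule: infinite_finite_induct) (auto simp: cinner_add_right)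

lemma cinner_e_left: "cinner (e n) f = cnj (fcoeff f n)"
  unfolding fcoeff_def by (rule cinner_commute)

lemma norm_sum_e:
  fixes c :: "int \<Rightarrow> complex"
  assumes "finite A"
  shows "(norm (\<Sum>n\<in>A. c n *\<^sub>C e n))\<^sup>2 = 2 * pi * (\<Sum>n\<in>A. (cmod (c n))\<^sup>2)"
proof -
  have "complex_of_real ((norm (\<Sum>n\<in>A. c n *\<^sub>C e n))\<^sup>2)
      = (\<Sum>m\<in>A. \<Sum>n\<in>A. c n * (cnj (c m) * (if n = m then 2 * pi else 0)))"
    unfolding cinner_self[symmetric] cinner_sum_left cinner_sum_right
    by (simp only: cinner_scaleC_left cinner_scaleC_right cinner_e_e) (simp add: mult_ac)
  also have "\<dots> = (\<Sum>n\<in>A. 2 * pi * (c n * cnj (c n)))"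
    using assms by (simp add: if_distrib sum.delta mult_ac cong: if_cong)
  also have "\<dots> = of_real (2 * pi * (\<Sum>n\<in>A. (cmod (c n))\<^sup>2))"
    unfolding complex_norm_square[symmetric] by (simp add: sum_distrib_left)
  finally show ?thesis by (simp only: of_real_eq_iff)
qed

lemma Bessel:
  assumes "finite A"
  shows "(\<Sum>n\<in>A. (cmod (fcoeff f n))\<^sup>2) \<le> 2 * pi * (norm f)\<^sup>2"
proof -
  let ?S = "\<Sum>n\<in>A. (fcoeff f n / (2 * pi)) *\<^sub>C e n"
  let ?s = "\<Sum>n\<in>A. (cmod (fcoeff f n))\<^sup>2"
  have fS: "cinner f ?S = of_real (?s / (2 * pi))"
    unfolding cinner_sum_right cinner_scaleC_right fcoeff_def[symmetric]
    by (simp add: sum_divide_distrib mult.commute[of "cnj _"]) (simp add: complex_norm_square[symmetric])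
  have SS: "cinner ?S ?S = of_real (?s / (2 * pi))"
    unfolding cinner_self norm_sum_e[OF assms]
    by (simp add: norm_divide power_divide sum_divide_distrib[symmetric] power2_eq_square field_simps)
  have Sf: "cinner ?S f = of_real (?s / (2 * pi))"
    using cinner_commute[of ?S f] fS by simp
  have "complex_of_real ((norm (f - ?S))\<^sup>2) = cinner f f - cinner ?S f - (cinner f ?S - cinner ?S ?S)"
    unfolding cinner_self[symmetric] cinner_diff_left cinner_diff_right by simp
  also have "\<dots> = of_real ((norm f)\<^sup>2 - ?s / (2 * pi))"
    unfolding fS SS Sf cinner_self[of f] by simp
  finally have "(norm (f - ?S))\<^sup>2 = (norm f)\<^sup>2 - ?s / (2 * pi)"
    unfolding of_real_eq_iff .
  then have "0 \<le> (norm f)\<^sup>2 - ?s / (2 * pi)" by (metis zero_le_power2)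
  then show ?thesis by (simp add: field_simps)
qed

text \<open>Squared distances between symmetric partial sums are differences of a bounded increasing
  sequence, so the sums are Cauchy and completeness provides the limit.\<close>

lemma Riesz_Fischer:
  fixes c :: "int \<Rightarrow> complex"
  assumes "\<And>N::nat. (\<Sum>n\<in>{-int N..int N}. (cmod (c n))\<^sup>2) \<le> K"
  shows "\<exists>f. (\<lambda>N. \<Sum>n\<in>{-int N..int N}. c n *\<^sub>C e n) \<longlonglongrightarrow> f \<and> (\<forall>n. fcoeff f n = 2 * pi * c n)"
proof -
  define S where "S N = (\<Sum>n\<in>{-int N..int N}. c n *\<^sub>C e n)" for N :: nat
  define s where "s N = (\<Sum>n\<in>{-int N..int N}. (cmod (c n))\<^sup>2)" for N :: nat
  have diff: "(norm (S M - S N))\<^sup>2 = 2 * pi * (s M - s N)" if "N \<le> M" for M N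
  proof -
    have sub: "{-int N..int N} \<subseteq> {-int M..int M}" using that by auto
    show ?thesis
      unfolding S_def s_def
      by (simp add: sum_diff[OF _ sub, symmetric] norm_sum_e)
  qed
  have "incseq s" unfolding s_def by (intro incseq_SucI sum_mono2) auto
  moreover have "\<And>N. s N \<le> K" using assms by (simp add: s_def)
  ultimately have "convergent s"
    by (metis incseq_convergent convergentI)
  then have "Cauchy s" by (rule convergent_Cauchy)
  have "Cauchy S"
  proof (rule metric_CauchyI)
    fix \<epsilon> :: real assume "\<epsilon> > 0"
    then have "\<epsilon>\<^sup>2 / (2 * pi) > 0" by simp
    then obtain N0 where N0: "\<And>m n. m \<ge> N0 \<Longrightarrow> n \<ge> N0 \<Longrightarrow> \<bar>s m - s n\<bar> < \<epsilon>\<^sup>2 / (2 * pi)"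
      using \<open>Cauchy s\<close> unfolding Cauchy_def dist_real_def by blast
    have *: "dist (S m) (S n) < \<epsilon>" if "m \<ge> N0" "n \<ge> N0" "n \<le> m" for m n
    proof -
      have "(norm (S m - S n))\<^sup>2 < \<epsilon>\<^sup>2"
        using diff[OF that(3)] N0[OF that(1,2)] by (simp add: field_simps abs_less_iff)
      then show ?thesis using \<open>\<epsilon> > 0\<close> by (simp add: dist_norm power2_less_imp_less)
    qed
    show "\<exists>M. \<forall>m\<ge>M. \<forall>n\<ge>M. dist (S m) (S n) < \<epsilon>"
      by (intro exI[of _ N0] allI impI) (metis * dist_commute nle_le)
  qed
  then obtain f where f: "S \<longlonglongrightarrow> f" using Cauchy_convergent convergent_def by blast
  have "fcoeff f n = 2 * pi * c n" for n
  proof (rule LIMSEQ_unique)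
    show "(\<lambda>N. fcoeff (S N) n) \<longlonglongrightarrow> fcoeff f n"
      unfolding fcoeff_def by (rule tendsto_cinner[OF f])
    have "\<forall>\<^sub>F N in sequentially. fcoeff (S N) n = 2 * pi * c n"
      using eventually_ge_at_top[of "nat \<bar>n\<bar>"]
    proof eventually_elim
      case (elim N)
      then have "n \<in> {-int N..int N}" by auto
      then show ?case
        by (simp add: S_def fcoeff_def cinner_sum_left cinner_e_e if_distrib sum.delta mult_ac cong: if_cong)
    qed
    then show "(\<lambda>N. fcoeff (S N) n) \<longlonglongrightarrow> 2 * pi * c n" by (rule tendsto_eventually)
  qed
  then show ?thesis using f unfolding S_def by blast
qed

lemma Bessel_multiplier:
  assumes "finite A" "\<And>n. cmod (m n) \<le> B"
  shows "(\<Sum>n\<in>A. (cmod (m n * fcoeff f n))\<^sup>2) \<le> B\<^sup>2 * (2 * pi * (norm f)\<^sup>2)"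
proof -
  have "(\<Sum>n\<in>A. (cmod (m n * fcoeff f n))\<^sup>2) \<le> (\<Sum>n\<in>A. B\<^sup>2 * (cmod (fcoeff f n))\<^sup>2)"
    by (intro sum_mono) (auto simp: norm_mult power_mult_distrib intro!: mult_right_mono power_mono assms)
  also have "\<dots> \<le> B\<^sup>2 * (2 * pi * (norm f)\<^sup>2)"
    unfolding sum_distrib_left[symmetric] by (intro mult_left_mono Bessel assms) auto
  finally show ?thesis .
qed

lemma fourier_multiplier:
  assumes "\<And>n. cmod (m n) \<le> B"
  shows "\<exists>g. \<forall>n. fcoeff g n = m n * fcoeff f n"
proof -
  have "(\<Sum>n\<in>{-int N..int N}. (cmod (m n / (2 * pi) * fcoeff f n))\<^sup>2)
      \<le> (B / (2 * pi))\<^sup>2 * (2 * pi * (norm f)\<^sup>2)" for N :: nat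
    by (intro Bessel_multiplier) (use assms in \<open>auto simp: norm_divide norm_mult divide_right_mono\<close>)
  from Riesz_Fischer[OF this] obtain g where "\<And>n. fcoeff g n = 2 * pi * (m n / (2 * pi) * fcoeff f n)"
    by blast
  then have "fcoeff g n = m n * fcoeff f n" for n by simp
  then show ?thesis by blast
qed

lemma fourier_series_tendsto:
  "(\<lambda>N. \<Sum>n\<in>{-int N..int N}. (fcoeff f n / (2 * pi)) *\<^sub>C e n) \<longlonglongrightarrow> f"
proof -
  have "(\<Sum>n\<in>{-int N..int N}. (cmod (fcoeff f n / (2 * pi)))\<^sup>2)
      \<le> (1 / (2 * pi))\<^sup>2 * (2 * pi * (norm f)\<^sup>2)" for N :: nat
    using Bessel_multiplier[of _ "\<lambda>_. 1 / (2 * pi)" "1 / (2 * pi)" f] by (simp add: norm_divide norm_mult)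
  from Riesz_Fischer[OF this] obtain g where g: "(\<lambda>N. \<Sum>n\<in>{-int N..int N}. (fcoeff f n / (2 * pi)) *\<^sub>C e n) \<longlonglongrightarrow> g"
      "\<And>n. fcoeff g n = 2 * pi * (fcoeff f n / (2 * pi))"
    by blast
  then have "g = f" by (intro fcoeff_eqI) simp
  with g(1) show ?thesis by simp
qed

lemma Parseval:
  "(\<lambda>N. \<Sum>n\<in>{-int N..int N}. fcoeff f n * cnj (fcoeff g n) / (2 * pi)) \<longlonglongrightarrow> cinner f g"
proof -
  have "(\<lambda>N. cinner (\<Sum>n\<in>{-int N..int N}. (fcoeff f n / (2 * pi)) *\<^sub>C e n) g) \<longlonglongrightarrow> cinner f g"
    by (rule tendsto_cinner[OF fourier_series_tendsto])
  then show ?thesis by (simp add: cinner_sum_left cinner_e_left)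
qed

text \<open>By Parseval, relations between inner products may be checked one frequency at a time;
  with the next lemmas this reduces comparisons of multipliers to comparisons of their
  symbols.\<close>

lemma cinner_eq_fcoeffI:
  assumes "\<And>n. fcoeff f n * cnj (fcoeff g n) = fcoeff f' n * cnj (fcoeff g' n)"
  shows "cinner f g = cinner f' g'"
  using LIMSEQ_unique[OF Parseval[of f g]] Parseval[of f' g'] assms by simp

lemma Re_cinner_le_fcoeffI:
  assumes "\<And>n. Re (fcoeff f n * cnj (fcoeff g n)) \<le> Re (fcoeff f' n * cnj (fcoeff g' n))"
  shows "Re (cinner f g) \<le> Re (cinner f' g')"
  by (rule LIMSEQ_le[OF tendsto_Re[OF Parseval] tendsto_Re[OF Parseval]])
     (use assms in \<open>auto intro!: exI[of _ 0] sum_mono divide_right_mono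
        simp del: times_complex.sel of_real_mult simp add: Re_divide_of_real\<close>)

lemma Im_cinner_zero_fcoeffI:
  assumes "\<And>n. Im (fcoeff f n * cnj (fcoeff g n)) = 0"
  shows "Im (cinner f g) = 0"
proof -
  have "(\<lambda>N. Im (\<Sum>n\<in>{-int N..int N}. fcoeff f n * cnj (fcoeff g n) / (2 * pi))) \<longlonglongrightarrow> Im (cinner f g)"
    by (rule tendsto_Im[OF Parseval])
  then have "(\<lambda>N. 0) \<longlonglongrightarrow> Im (cinner f g)"
    using assms by (simp del: times_complex.sel)
  then show ?thesis by (simp add: LIMSEQ_const_iff)
qed

lemma norm_le_fcoeffI:
  assumes "\<And>n. cmod (fcoeff f n) \<le> cmod (fcoeff g n)"
  shows "norm f \<le> norm g"
proof -
  have "Re (cinner f f) \<le> Re (cinner g g)"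
    by (rule Re_cinner_le_fcoeffI)
      (use assms in \<open>auto simp: complex_norm_square[symmetric] power_mono simp del: times_complex.sel of_real_power\<close>)
  then show ?thesis by (simp add: cinner_self)
qed

section \<open>Weak derivatives\<close>

lemma integration_by_parts_fcoeff:
  assumes "\<And>n. fcoeff v n = \<i> * of_int n * fcoeff u n" "\<And>n. fcoeff h' n = \<i> * of_int n * fcoeff h n"
  shows "cinner v h = - cinner u h'"
proof -
  have "cinner v h = cinner (- u) h'"
    by (rule cinner_eq_fcoeffI) (simp add: assms)
  then show ?thesis by simp
qed

lemma fcoeff_derivative:
  assumes g: "\<And>y. (g has_vector_derivative g' y) (at y)" and g': "continuous_on UNIV g'"
    and per: "g (2*pi) = g 0"
  shows "fcoeff (abs_L2T g') n = \<i> * of_int n * fcoeff (abs_L2T g) n"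
proof -
  have cg: "continuous_on UNIV g"
    using g by (meson continuous_at_imp_continuous_on has_vector_derivative_continuous)
  have cn: "fcoeff (abs_L2T f) n = (LINT y|circle. f y * fexp (- n) y)" if "continuous_on UNIV f" for f
    unfolding fcoeff_def e_def
    by (simp add: cinner_abs_abs square_integrable_continuous[OF that] square_integrable_fexp cnj_fexp)
  have "(LINT y|circle. g' y * fexp (- n) y - \<i> * of_int n * (g y * fexp (- n) y))
      = g (2*pi) * fexp (- n) (2*pi) - g 0 * fexp (- n) 0"
  proof (rule circle_FTC)
    fix y
    show "((\<lambda>y. g y * fexp (- n) y) has_vector_derivative
        g' y * fexp (- n) y - \<i> * of_int n * (g y * fexp (- n) y)) (at y)"
      using has_vector_derivative_mult[OF g[of y] fexp_deriv[of "- n" y]] by (simp add: algebra_simps)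
  qed (intro continuous_intros g' cg continuous_fexp)
  also have "\<dots> = 0" using per fexp_2pi[of "- n" 0] by simp
  also have "(LINT y|circle. g' y * fexp (- n) y - \<i> * of_int n * (g y * fexp (- n) y))
     = fcoeff (abs_L2T g') n - \<i> * of_int n * fcoeff (abs_L2T g) n"
    unfolding cn[OF cg] cn[OF g']
    by (subst Bochner_Integration.integral_diff)
      (auto intro!: circle_integral_eq(1) continuous_intros g' cg continuous_fexp)
  finally show ?thesis by simp
qed

text \<open>Exponentials as test functions give one direction. Conversely, the conjugate of a smooth
  test function is differentiated classically, and Parseval moves the factor
  \<open>\<i> * of_int n\<close> from one side to the other.\<close>

lemma has_weak_deriv_iff: "has_weak_deriv u v \<longleftrightarrow> (\<forall>n. fcoeff v n = \<i> * of_int n * fcoeff u n)"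
proof
  assume uv: "has_weak_deriv u v"
  show "\<forall>n. fcoeff v n = \<i> * of_int n * fcoeff u n"
  proof
    fix n
    have "(LINT y|circle. rep_L2T u y * vector_derivative (fexp (- n)) (at y)) = - fcoeff v n"
      using uv smooth_periodic_fexp[of "- n"] by (simp add: has_weak_deriv_def fcoeff_eq)
    moreover have "vector_derivative (fexp (- n)) (at y) = - \<i> * of_int n * fexp (- n) y" for y
      using vector_derivative_at[OF fexp_deriv[of "- n" y]] by simp
    moreover have "rep_L2T u y * (\<i> * of_int n * fexp (- n) y)
        = \<i> * of_int n * (rep_L2T u y * fexp (- n) y)" for y
      by (simp add: mult_ac)
    ultimately show "fcoeff v n = \<i> * of_int n * fcoeff u n"
      by (simp add: fcoeff_eq)
  qed
next
  assume uv: "\<forall>n. fcoeff v n = \<i> * of_int n * fcoeff u n"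
  show "has_weak_deriv u v"
    unfolding has_weak_deriv_def
  proof (intro allI impI)
    fix \<phi> assume "smooth_periodic \<phi>"
    then obtain d where per: "\<And>y. \<phi> (y + 2 * pi) = \<phi> y" and d: "d 0 = \<phi>"
      "\<And>n y. (d n has_vector_derivative d (Suc n) y) (at y)"
      unfolding smooth_periodic_def by blast
    have cont: "continuous_on UNIV (d n)" for n
      using d(2) by (meson continuous_at_imp_continuous_on has_vector_derivative_continuous)
    define g where "g y = cnj (\<phi> y)" for y
    define g' where "g' y = cnj (d 1 y)" for y
    have g: "(g has_vector_derivative g' y) (at y)" for y
      using has_vector_derivative_cnj[OF d(2)[of 0 y]] unfolding g_def[abs_def] g'_def d(1) by simp
    have cg: "continuous_on UNIV g" and cg': "continuous_on UNIV g'"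
      unfolding g_def[abs_def] g'_def[abs_def] using cont[of 0] cont[of 1] d(1)
      by (auto intro!: continuous_intros)
    have "g (2*pi) = g 0" using per[of 0] by (simp add: g_def)
    from integration_by_parts_fcoeff[OF uv[rule_format] fcoeff_derivative[OF g cg' this]]
    have "cinner v (abs_L2T g) = - cinner u (abs_L2T g')" .
    moreover have "vector_derivative \<phi> (at y) = d 1 y" for y
      using vector_derivative_at[OF d(2)[of 0 y]] d(1) by simp
    ultimately show "(LINT y|circle. rep_L2T u y * vector_derivative \<phi> (at y)) = - (LINT y|circle. rep_L2T v y * \<phi> y)"
      unfolding cinner_abs_right[OF square_integrable_continuous[OF cg]]
        cinner_abs_right[OF square_integrable_continuous[OF cg']] g_def g'_def
      by simp
  qed
qed

lemma weak_deriv_eqI: "has_weak_deriv u v \<Longrightarrow> weak_deriv u = v"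
  unfolding weak_deriv_def
  by (rule the_equality) (auto simp: has_weak_deriv_iff intro: fcoeff_eqI)

lemma integration_by_parts:
  assumes "has_weak_deriv u u'" "has_weak_deriv v v'"
  shows "cinner u' v = - cinner u v'"
  using integration_by_parts_fcoeff assms unfolding has_weak_deriv_iff by blast

lemma has_weak_deriv_add:
  "has_weak_deriv u u' \<Longrightarrow> has_weak_deriv v v' \<Longrightarrow> has_weak_deriv (u + v) (u' + v')"
  by (simp add: has_weak_deriv_iff distrib_left)

section \<open>Multiplication by real functions\<close>

text \<open>Restricting to real multipliers makes multiplication self-adjoint and its quadratic form
  real.\<close>

definition rmult :: "(real \<Rightarrow> real) \<Rightarrow> L2T \<Rightarrow> L2T" where
  "rmult g = mult_op (\<lambda>y. complex_of_real (g y))"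

lemma square_integrable_mult:
  fixes g :: "real \<Rightarrow> complex"
  assumes "continuous_on UNIV g" "square_integrable f"
  shows "square_integrable (\<lambda>y. g y * f y)"
proof -
  have "compact (g ` {0..2*pi})"
    by (intro compact_continuous_image continuous_on_subset[OF assms(1)]) auto
  then have "bounded (g ` {0..2*pi})" by (rule compact_imp_bounded)
  then obtain B where B: "B > 0" "\<And>x. x \<in> g ` {0..2*pi} \<Longrightarrow> norm x \<le> B"
    unfolding bounded_pos by blast
  have [measurable]: "g \<in> borel_measurable circle" "f \<in> borel_measurable circle"
    using borel_measurable_circle_continuous[OF assms(1)] assms(2) by (auto simp: square_integrable_def)
  have "integrable circle (\<lambda>y. (cmod (g y * f y))\<^sup>2)"
  proof (rule Bochner_Integration.integrable_bound)
    show "integrable circle (\<lambda>y. B\<^sup>2 * (cmod (f y))\<^sup>2)"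
      using assms(2) by (simp add: square_integrable_def)
    show "AE y in circle. norm ((cmod (g y * f y))\<^sup>2) \<le> norm (B\<^sup>2 * (cmod (f y))\<^sup>2)"
    proof (rule AE_I2)
      fix y assume "y \<in> space circle"
      then have "cmod (g y) \<le> B" using B by auto
      then show "norm ((cmod (g y * f y))\<^sup>2) \<le> norm (B\<^sup>2 * (cmod (f y))\<^sup>2)"
        by (simp add: norm_mult power_mult_distrib mult_right_mono power_mono)
    qed
  qed measurable
  then show ?thesis by (simp add: square_integrable_def)
qed

lemma square_integrable_rmult:
  fixes g :: "real \<Rightarrow> real"
  assumes "continuous_on UNIV g"
  shows "square_integrable (\<lambda>y. of_real (g y) * rep_L2T f y)"
  by (intro square_integrable_mult square_integrable_rep continuous_on_of_real assms)

lemma cinner_rmult_rmult: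
  assumes "continuous_on UNIV g" "continuous_on UNIV h"
  shows "cinner (rmult g f) (rmult h k) = (LINT y|circle. of_real (g y * h y) * (rep_L2T f y * cnj (rep_L2T k y)))"
  unfolding rmult_def mult_op_def
  by (simp add: cinner_abs_abs square_integrable_rmult assms) (simp add: mult_ac)

lemma cinner_rmult:
  assumes "continuous_on UNIV g"
  shows "cinner (rmult g f) k = (LINT y|circle. of_real (g y) * (rep_L2T f y * cnj (rep_L2T k y)))"
  unfolding rmult_def mult_op_def
  by (simp add: cinner_abs_left square_integrable_rmult assms) (simp add: mult_ac)

lemma rmult_adjoint:
  assumes "continuous_on UNIV g"
  shows "cinner (rmult g f) k = cinner f (rmult g k)"
  unfolding rmult_def mult_op_def
  by (simp add: cinner_abs_left cinner_abs_right square_integrable_rmult assms) (simp add: mult_ac)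

lemma rmult_diff:
  assumes "continuous_on UNIV g" shows "rmult g (f - k) = rmult g f - rmult g k"
  by (rule L2T_eqI) (simp add: rmult_adjoint[OF assms] cinner_diff_left)

lemma rmult_rmult:
  assumes "continuous_on UNIV g" "continuous_on UNIV h"
  shows "rmult g (rmult h f) = rmult (\<lambda>y. g y * h y) f"
proof (rule L2T_eqI)
  fix k
  have "cinner (rmult g (rmult h f)) k = cinner (rmult h f) (rmult g k)"
    by (rule rmult_adjoint[OF assms(1)])
  also have "\<dots> = cinner (rmult (\<lambda>y. g y * h y) f) k"
    by (subst cinner_rmult_rmult[OF assms(2,1)], subst cinner_rmult[OF continuous_on_mult[OF assms]])
      (simp add: mult.commute)
  finally show "cinner (rmult g (rmult h f)) k = cinner (rmult (\<lambda>y. g y * h y) f) k" .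
qed

lemma rmult_const: "rmult (\<lambda>y. c) f = c *\<^sub>R f"
  by (rule L2T_eqI) (simp add: cinner_rmult cinner_eq[of f])

lemma integrable_rmult:
  assumes "continuous_on UNIV g"
  shows "integrable circle (\<lambda>y. of_real (g y) * (rep_L2T f y * cnj (rep_L2T k y)))"
  using integrable_mult_cnj[OF square_integrable_rmult[OF assms, of f] square_integrable_rep[of k]]
  by (simp add: mult.assoc)

lemma rmult_plus:
  assumes "continuous_on UNIV g" "continuous_on UNIV h"
  shows "rmult (\<lambda>y. g y + h y) f = rmult g f + rmult h f"
  by (rule L2T_eqI)
     (simp add: cinner_rmult cinner_add_left assms continuous_on_add distrib_right integrable_rmult)

lemma rmult_cmult:
  assumes "continuous_on UNIV g"
  shows "rmult (\<lambda>y. c * g y) f = c *\<^sub>R rmult g f"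
  using rmult_rmult[of "\<lambda>y. c" g f] assms by (simp add: rmult_const)

text \<open>This is the integral of \<open>g * \<bar>f\<bar>\<^sup>2\<close> in operator form; the
  integral itself is used only for monotonicity in \<open>g\<close>.\<close>

definition qform :: "(real \<Rightarrow> real) \<Rightarrow> L2T \<Rightarrow> real" where
  "qform g f = Re (cinner (rmult g f) f)"

lemma cinner_rmult_self:
  assumes "continuous_on UNIV g"
  shows "cinner (rmult g f) f = of_real (qform g f)"
proof -
  have "Im (cinner (rmult g f) f) = Im (cinner f (rmult g f))"
    by (simp add: rmult_adjoint[OF assms])
  then have "Im (cinner (rmult g f) f) = 0"
    using Im_cinner_commute[of f "rmult g f"] by simp
  then show ?thesis by (simp add: complex_eq_iff qform_def)
qed

lemma qform_add:
  "continuous_on UNIV g \<Longrightarrow> continuous_on UNIV h \<Longrightarrow> qform (\<lambda>y. g y + h y) f = qform g f + qform h f"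
  by (simp add: qform_def rmult_plus cinner_add_left)

lemma qform_cmult:
  "continuous_on UNIV g \<Longrightarrow> qform (\<lambda>y. c * g y) f = c * qform g f"
  by (simp add: qform_def rmult_cmult)

lemma qform_const: "qform (\<lambda>y. c) f = c * (norm f)\<^sup>2"
  by (simp add: qform_def rmult_const cinner_self)

lemma qform_diff:
  "continuous_on UNIV g \<Longrightarrow> continuous_on UNIV h \<Longrightarrow> qform (\<lambda>y. g y - h y) f = qform g f - qform h f"
  using qform_add[of g "\<lambda>y. -1 * h y" f] qform_cmult[of h "-1" f] by (simp add: continuous_on_minus)

lemma qform_mono:
  assumes "continuous_on UNIV g" "continuous_on UNIV h" "\<And>y. g y \<le> h y"
  shows "qform g f \<le> qform h f"
proof -
  have eq: "qform g f = (LINT y|circle. g y * (cmod (rep_L2T f y))\<^sup>2)"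
    and int: "integrable circle (\<lambda>y. g y * (cmod (rep_L2T f y))\<^sup>2)"
    if g: "continuous_on UNIV g" for g
  proof -
    have *: "of_real (g y) * (rep_L2T f y * cnj (rep_L2T f y)) = of_real (g y * (cmod (rep_L2T f y))\<^sup>2)" for y
      unfolding complex_norm_square[symmetric] by simp
    have "cinner (rmult g f) f = (LINT y|circle. of_real (g y * (cmod (rep_L2T f y))\<^sup>2))"
      unfolding cinner_rmult[OF g] * ..
    then have "cinner (rmult g f) f = of_real (LINT y|circle. g y * (cmod (rep_L2T f y))\<^sup>2)"
      by (simp only: integral_complex_of_real)
    then show "qform g f = (LINT y|circle. g y * (cmod (rep_L2T f y))\<^sup>2)" by (simp add: qform_def)
    show "integrable circle (\<lambda>y. g y * (cmod (rep_L2T f y))\<^sup>2)"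
      using integrable_rmult[OF g, of f f] unfolding * by (simp only: complex_of_real_integrable_eq)
  qed
  show ?thesis
    unfolding eq[OF assms(1)] eq[OF assms(2)]
    by (rule integral_mono) (auto simp: int assms intro: mult_right_mono)
qed

lemma norm_rmult:
  assumes "continuous_on UNIV g"
  shows "(norm (rmult g f))\<^sup>2 = qform (\<lambda>y. (g y)\<^sup>2) f"
proof -
  have "complex_of_real ((norm (rmult g f))\<^sup>2) = cinner (rmult g (rmult g f)) f"
    unfolding cinner_self[symmetric] by (simp add: rmult_adjoint[OF assms])
  then show ?thesis
    unfolding qform_def rmult_rmult[OF assms assms] power2_eq_square by (simp add: complex_eq_iff)
qed

lemma norm_rmult_le_qform:
  assumes "continuous_on UNIV g" "continuous_on UNIV h" "\<And>y. (g y)\<^sup>2 \<le> h y"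
  shows "norm (rmult g f) \<le> sqrt (qform h f)"
  using norm_rmult[OF assms(1), of f] qform_mono[of "\<lambda>y. (g y)\<^sup>2" h f] assms
  by (intro real_le_rsqrt) (auto intro: continuous_intros)

lemma norm_rmult_le:
  assumes "continuous_on UNIV g" "\<And>y. \<bar>g y\<bar> \<le> B"
  shows "norm (rmult g f) \<le> B * norm f"
proof -
  have "0 \<le> B" using assms(2)[of 0] by linarith
  have "norm (rmult g f) \<le> sqrt (qform (\<lambda>y. B\<^sup>2) f)"
    by (rule norm_rmult_le_qform[OF assms(1)]) (use assms(2) \<open>0 \<le> B\<close> in \<open>auto simp: abs_le_square_iff[symmetric]\<close>)
  then show ?thesis using \<open>0 \<le> B\<close> by (simp add: qform_const real_sqrt_mult)
qed

section \<open>The product rule for weak derivatives\<close>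

definition C1_periodic :: "(real \<Rightarrow> real) \<Rightarrow> (real \<Rightarrow> real) \<Rightarrow> bool" where
  "C1_periodic g g' \<longleftrightarrow> (\<forall>y. (g has_real_derivative g' y) (at y)) \<and> continuous_on UNIV g' \<and> g (2*pi) = g 0"

lemma C1_periodic_continuous:
  assumes "C1_periodic g g'" shows "continuous_on UNIV g" "continuous_on UNIV g'"
  using assms DERIV_continuous_on[of UNIV g g'] unfolding C1_periodic_def
  by (auto intro: has_field_derivative_at_within)

lemma rmult_e:
  assumes "continuous_on UNIV g"
  shows "rmult g (e n) = abs_L2T (\<lambda>y. of_real (g y) * fexp n y)"
proof -
  have "AE y in circle. rep_L2T (e n) y = fexp n y"
    unfolding e_def by (rule rep_abs_L2T[OF square_integrable_fexp])
  then show ?thesis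
    unfolding rmult_def mult_op_def
    by (subst abs_L2T_eq_iff)
      (auto simp: square_integrable_rmult square_integrable_mult square_integrable_fexp continuous_on_of_real assms)
qed

lemma has_weak_deriv_rmult_e:
  assumes g: "C1_periodic g g'"
  shows "has_weak_deriv (rmult g (e n)) (rmult g' (e n) + (\<i> * of_int n) *\<^sub>C rmult g (e n))"
proof -
  note cont = C1_periodic_continuous[OF g]
  let ?G' = "\<lambda>y. of_real (g' y) * fexp n y + of_real (g y) * (\<i> * of_int n * fexp n y)"
  have "rmult g' (e n) + (\<i> * of_int n) *\<^sub>C rmult g (e n) = abs_L2T ?G'"
  proof (rule L2T_eqI)
    fix h
    have int: "integrable circle (\<lambda>y. (of_real (k y) * fexp n y) * cnj (rep_L2T h y))"
      if "continuous_on UNIV k" for k :: "real \<Rightarrow> real"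
      using that by (intro integrable_mult_cnj square_integrable_mult square_integrable_fexp square_integrable_rep
          continuous_on_of_real)
    have "square_integrable ?G'"
      by (intro square_integrable_continuous continuous_intros continuous_on_of_real cont continuous_fexp)
    then have "cinner (abs_L2T ?G') h = (LINT y|circle. (of_real (g' y) * fexp n y) * cnj (rep_L2T h y)
        + (\<i> * of_int n) * ((of_real (g y) * fexp n y) * cnj (rep_L2T h y)))"
      by (subst cinner_abs_left) (auto simp: algebra_simps)
    also have "\<dots> = (LINT y|circle. (of_real (g' y) * fexp n y) * cnj (rep_L2T h y))
        + (\<i> * of_int n) * (LINT y|circle. (of_real (g y) * fexp n y) * cnj (rep_L2T h y))"
      using int[OF cont(1)] int[OF cont(2)] by simp
    finally show "cinner (rmult g' (e n) + (\<i> * of_int n) *\<^sub>C rmult g (e n)) h = cinner (abs_L2T ?G') h"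
      by (simp add: cinner_add_left rmult_e cont cinner_abs_left square_integrable_mult square_integrable_fexp
          continuous_on_of_real)
  qed
  moreover have "has_weak_deriv (abs_L2T (\<lambda>y. of_real (g y) * fexp n y)) (abs_L2T ?G')"
    unfolding has_weak_deriv_iff
  proof (intro allI fcoeff_derivative)
    fix y
    have "((\<lambda>y. complex_of_real (g y)) has_vector_derivative of_real (g' y)) (at y)"
      using g by (intro has_vector_derivative_of_real)
        (auto simp: C1_periodic_def has_real_derivative_iff_has_vector_derivative)
    from has_vector_derivative_mult[OF this fexp_deriv[of n y]]
    show "((\<lambda>y. of_real (g y) * fexp n y) has_vector_derivative ?G' y) (at y)"
      by (simp add: add.commute)
    show "continuous_on UNIV ?G'"
      by (intro continuous_intros continuous_on_of_real cont continuous_fexp)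
    show "of_real (g (2*pi)) * fexp n (2*pi) = of_real (g 0) * fexp n 0"
      using g fexp_2pi[of n 0] by (simp add: C1_periodic_def)
  qed
  ultimately show ?thesis by (simp add: rmult_e cont)
qed

text \<open>The rule is classical for \<open>g\<close> times an exponential. Self-adjointness of
  multiplication transfers it to general \<open>u\<close>, since only pairings with exponentials
  have to be computed.\<close>

lemma has_weak_deriv_rmult:
  assumes g: "C1_periodic g g'" and u: "has_weak_deriv u u'"
  shows "has_weak_deriv (rmult g u) (rmult g u' + rmult g' u)"
  unfolding has_weak_deriv_iff
proof
  fix n
  note cont = C1_periodic_continuous[OF g]
  have "cinner u' (rmult g (e n)) = - cinner u (rmult g' (e n) + (\<i> * of_int n) *\<^sub>C rmult g (e n))"
    by (rule integration_by_parts[OF u has_weak_deriv_rmult_e[OF g]])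
  then show "fcoeff (rmult g u' + rmult g' u) n = \<i> * of_int n * fcoeff (rmult g u) n"
    by (simp add: fcoeff_def cinner_add_left cinner_add_right rmult_adjoint cont)
qed

text \<open>The real part of \<open>u * cnj u'\<close> is half the derivative of
  \<open>\<bar>u\<bar>\<^sup>2\<close>.\<close>

lemma Re_rmult_deriv:
  assumes g: "C1_periodic g g'" and u: "has_weak_deriv u u'"
  shows "Re (cinner (rmult g u) u') = - (1/2) * qform g' u"
proof -
  have "cinner (rmult g u' + rmult g' u) u = - cinner (rmult g u) u'"
    by (rule integration_by_parts[OF has_weak_deriv_rmult[OF g u] u])
  moreover have "Re (cinner (rmult g u') u) = Re (cinner (rmult g u) u')"
    using Re_cinner_commute[of u' "rmult g u"] by (simp add: rmult_adjoint C1_periodic_continuous[OF g])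
  ultimately show ?thesis by (simp add: cinner_add_left qform_def complex_eq_iff)
qed

section \<open>The operators of the linearised problem\<close>

lemma W22_D:
  assumes "u \<in> W22"
  shows "has_weak_deriv u (weak_deriv u)" "has_weak_deriv (weak_deriv u) (weak_deriv (weak_deriv u))"
  using assms unfolding W22_def by (auto simp: weak_deriv_eqI)

lemma W22_I: "has_weak_deriv u v \<Longrightarrow> has_weak_deriv v w \<Longrightarrow> u \<in> W22"
  unfolding W22_def by blast

lemma W22_subspace:
  shows "u \<in> W22 \<Longrightarrow> v \<in> W22 \<Longrightarrow> u + v \<in> W22" "u \<in> W22 \<Longrightarrow> c *\<^sub>C u \<in> W22"
proof -
  show "u + v \<in> W22" if "u \<in> W22" "v \<in> W22"
    using that by (auto simp: W22_def intro: has_weak_deriv_add)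
  show "c *\<^sub>C u \<in> W22" if u: "u \<in> W22"
    by (rule W22_I[of _ "c *\<^sub>C weak_deriv u" "c *\<^sub>C weak_deriv (weak_deriv u)"])
      (use W22_D[OF u] in \<open>auto simp: has_weak_deriv_iff\<close>)
qed

lemma fcoeff_A_op:
  assumes "u \<in> W22"
  shows "fcoeff (A_op l u) n = - of_real ((real_of_int n)\<^sup>2 + (real_of_int l)\<^sup>2) * fcoeff u n"
  using W22_D[OF assms] unfolding A_op_def has_weak_deriv_iff
  by (simp add: power2_eq_square algebra_simps)

text \<open>The solution and its first two derivatives have the symbols \<open>- 1 / N n\<close>,
  \<open>- \<i> * n / N n\<close> and \<open>n^2 / N n\<close>, all of modulus at most 1.\<close>

lemma A_op_onto:
  assumes "l \<noteq> 0"
  shows "\<exists>u\<in>W22. A_op l u = f"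
proof -
  define N :: "int \<Rightarrow> real" where "N n = (real_of_int n)\<^sup>2 + (real_of_int l)\<^sup>2" for n
  have l1: "1 \<le> (real_of_int l)\<^sup>2"
    using assms by (metis of_int_1_le_iff of_int_power power2_eq_square zero_less_power2 int_one_le_iff_zero_less)
  then have N1: "N n \<ge> 1" for n by (simp add: N_def add_increasing)
  have "cmod (complex_of_real (- 1 / N n)) \<le> 1" for n
    using N1[of n] by (simp only: norm_of_real) (simp add: divide_le_eq)
  from fourier_multiplier[of "\<lambda>n. complex_of_real (- 1 / N n)" 1 f, OF this] obtain u where u: "\<And>n. fcoeff u n = of_real (- 1 / N n) * fcoeff f n"
    by blast
  have "cmod (\<i> * of_int n * complex_of_real (- 1 / N n)) \<le> 1" for n
  proof -
    have "\<bar>real_of_int n\<bar> \<le> N n"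
    proof (cases "n = 0")
      case False
      then have "1 \<le> \<bar>real_of_int n\<bar>" by linarith
      then have "\<bar>real_of_int n\<bar> * 1 \<le> \<bar>real_of_int n\<bar> * \<bar>real_of_int n\<bar>" by (intro mult_left_mono) auto
      also have "\<dots> = (real_of_int n)\<^sup>2" by (simp add: power2_eq_square)
      also have "\<dots> \<le> N n" by (simp add: N_def)
      finally show ?thesis by simp
    qed (use N1[of n] in simp)
    moreover have "cmod (\<i> * of_int n * complex_of_real (- 1 / N n)) = \<bar>real_of_int n\<bar> * (1 / N n)"
      using N1[of n] by (simp only: norm_mult norm_of_real norm_ii norm_of_int) simp
    ultimately show ?thesis using N1[of n] by (simp add: divide_le_eq)
  qed
  from fourier_multiplier[of "\<lambda>n. \<i> * of_int n * complex_of_real (- 1 / N n)" 1 f, OF this] obtain v where v: "\<And>n. fcoeff v n = (\<i> * of_int n * complex_of_real (- 1 / N n)) * fcoeff f n"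
    by blast
  have "cmod (complex_of_real ((real_of_int n)\<^sup>2 / N n)) \<le> 1" for n
    using N1[of n] by (simp only: norm_of_real) (simp add: divide_le_eq N_def)
  from fourier_multiplier[of "\<lambda>n. complex_of_real ((real_of_int n)\<^sup>2 / N n)" 1 f, OF this] obtain w where w: "\<And>n. fcoeff w n = of_real ((real_of_int n)\<^sup>2 / N n) * fcoeff f n"
    by blast
  have "has_weak_deriv u v" "has_weak_deriv v w"
    unfolding has_weak_deriv_iff
    by (auto simp: u v w power2_eq_square) (simp add: mult_ac)
  then have "u \<in> W22" by (rule W22_I)
  moreover have "A_op l u = f"
  proof (rule fcoeff_eqI)
    fix n
    have "complex_of_real (- N n) * of_real (- 1 / N n) = of_real (- N n * (- 1 / N n))"
      by (simp only: of_real_mult)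
    also have "- N n * (- 1 / N n) = 1" using N1[of n] by simp
    finally show "fcoeff (A_op l u) n = fcoeff f n"
      using fcoeff_A_op[OF \<open>u \<in> W22\<close>, of l n] unfolding u N_def[symmetric]
      by (simp only: mult.assoc[symmetric] of_real_minus[symmetric]) simp
  qed
  ultimately show ?thesis by blast
qed

lemma A_inv:
  assumes "l \<noteq> 0"
  shows "A_inv l f \<in> W22" "A_op l (A_inv l f) = f"
proof -
  have "f \<in> A_op l ` W22" using A_op_onto[OF assms, of f] by auto
  then show "A_inv l f \<in> W22" "A_op l (A_inv l f) = f"
    unfolding A_inv_def by (auto intro: inv_into_into f_inv_into_f)
qed

lemma fcoeff_A_inv:
  assumes "l \<noteq> 0"
  shows "fcoeff f n = - of_real ((real_of_int n)\<^sup>2 + (real_of_int l)\<^sup>2) * fcoeff (A_inv l f) n"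
  using fcoeff_A_op[OF A_inv(1)[OF assms]] A_inv(2)[OF assms] by metis

section \<open>The spaces \<open>Y_space l\<close> and their projections\<close>

lemma Y_space_eq: "Y_space l = {f. \<bar>l\<bar> = 1 \<longrightarrow> fcoeff f 0 = 0}"
  by (auto simp: Y_space_def fcoeff_eq)

lemma Y_space_subspace:
  shows "f \<in> Y_space l \<Longrightarrow> g \<in> Y_space l \<Longrightarrow> f + g \<in> Y_space l"
    and "f \<in> Y_space l \<Longrightarrow> g \<in> Y_space l \<Longrightarrow> f - g \<in> Y_space l"
    and "f \<in> Y_space l \<Longrightarrow> c *\<^sub>C f \<in> Y_space l"
    and "f \<in> Y_space l \<Longrightarrow> r *\<^sub>R f \<in> Y_space l"
    and "0 \<in> Y_space l"
  by (auto simp: Y_space_eq)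

lemma has_weak_deriv_in_Y: "has_weak_deriv u v \<Longrightarrow> v \<in> Y_space l"
  by (simp add: Y_space_eq has_weak_deriv_iff)

lemma closed_Y_space: "closed (Y_space l)"
proof (cases "\<bar>l\<bar> = 1")
  case True
  have "x \<in> Y_space l" if f: "\<forall>n. f n \<in> Y_space l" and lim: "f \<longlonglongrightarrow> x" for f x
  proof -
    have "(\<lambda>n. fcoeff (f n) 0) \<longlonglongrightarrow> fcoeff x 0"
      unfolding fcoeff_def by (rule tendsto_cinner[OF lim])
    then show ?thesis using f True by (simp add: Y_space_eq LIMSEQ_const_iff)
  qed
  then show ?thesis by (auto simp: closed_sequential_limits)
qed (simp add: Y_space_eq)

lemma orth_proj_Y:
  shows "orth_proj (Y_space l) f \<in> Y_space l"
    and "h \<in> Y_space l \<Longrightarrow> cinner (orth_proj (Y_space l) f) h = cinner f h"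
proof -
  define g where "g = (if \<bar>l\<bar> = 1 then f - (fcoeff f 0 / (2 * pi)) *\<^sub>C e 0 else f)"
  have g: "g \<in> Y_space l \<and> (\<forall>h\<in>Y_space l. cinner (f - g) h = 0)"
    by (auto simp: g_def Y_space_eq fcoeff_e cinner_e_left)
  have "orth_proj (Y_space l) f = g"
    unfolding orth_proj_def
  proof (rule the_equality)
    show "g \<in> Y_space l \<and> (\<forall>h\<in>Y_space l. cinner (f - g) h = 0)" by (rule g)
    fix g' assume g': "g' \<in> Y_space l \<and> (\<forall>h\<in>Y_space l. cinner (f - g') h = 0)"
    have d: "g - g' \<in> Y_space l" using g g' by (auto intro: Y_space_subspace)
    then have "cinner (f - g') (g - g') - cinner (f - g) (g - g') = 0" using g g' by auto
    then have "cinner (g - g') (g - g') = 0" by (simp add: cinner_diff_left)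
    then show "g' = g" by (simp add: cinner_self)
  qed
  then show "orth_proj (Y_space l) f \<in> Y_space l"
    "h \<in> Y_space l \<Longrightarrow> cinner (orth_proj (Y_space l) f) h = cinner f h"
    using g by (auto simp: cinner_diff_left)
qed

lemma orth_proj_Y_eqI:
  assumes "g \<in> Y_space l" "\<And>h. h \<in> Y_space l \<Longrightarrow> cinner g h = cinner f h"
  shows "orth_proj (Y_space l) f = g"
proof -
  let ?d = "orth_proj (Y_space l) f - g"
  have d: "?d \<in> Y_space l" using assms orth_proj_Y(1) by (auto intro: Y_space_subspace)
  have "cinner ?d ?d = 0"
    using orth_proj_Y(2)[OF d, of f] assms(2)[OF d] by (simp only: cinner_diff_left[of _ g]) simp
  then show ?thesis by (simp add: cinner_self)
qed

lemma A_op_in_Y: "u \<in> W22 \<Longrightarrow> u \<in> Y_space l \<Longrightarrow> A_op l u \<in> Y_space l"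
  by (simp add: Y_space_eq fcoeff_A_op)

lemma A_inv_in_Y: "l \<noteq> 0 \<Longrightarrow> f \<in> Y_space l \<Longrightarrow> A_inv l f \<in> Y_space l"
  using fcoeff_A_inv[of l f 0] by (auto simp: Y_space_eq)

lemma Lambda_op_eq: "Lambda_op l f = rmult sin (f + A_inv l f)"
  by (simp add: Lambda_op_def rmult_def)

lemma l_square_ge_1: "l \<noteq> 0 \<Longrightarrow> 1 \<le> (real_of_int l)\<^sup>2"
  by (metis of_int_1_le_iff of_int_power power2_eq_square zero_less_power2 int_one_le_iff_zero_less)

section \<open>The stream function, its derivatives and their symbols\<close>

locale stream_function =
  fixes l :: int and u :: L2T
  assumes l: "l \<noteq> 0" and u_W22: "u \<in> W22" and u_Y: "u \<in> Y_space l"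
begin

definition "\<psi> = A_inv l u"
definition "w = u + \<psi>"
definition "Au = A_op l u"
definition "u1 = weak_deriv u"
definition "u2 = weak_deriv u1"
definition "\<psi>1 = weak_deriv \<psi>"
definition "\<psi>2 = weak_deriv \<psi>1"
definition "w1 = u1 + \<psi>1"
definition "w2 = u2 + \<psi>2"
text \<open>This is the coefficient in \<open>w = \<psi>2 - k *\<^sub>R \<psi>\<close>; it vanishes
  for \<open>\<bar>l\<bar> = 1\<close>.\<close>

definition k :: real where "k = (real_of_int l)\<^sup>2 - 1"
definition D :: real where "D = sqrt ((norm u1)\<^sup>2 + (real_of_int l)\<^sup>2 * (norm u)\<^sup>2)"
text \<open>Minus the symbol of \<open>A_op l\<close>. Relative to \<open>\<psi>\<close>, the
  symbols of \<open>u\<close>, \<open>w\<close> and \<open>Au\<close> are \<open>- N n\<close>,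
  \<open>1 - N n\<close> and \<open>(N n)\<^sup>2\<close>.\<close>

definition N :: "int \<Rightarrow> real" where "N n = (real_of_int n)\<^sup>2 + (real_of_int l)\<^sup>2"

lemma \<psi>_W22: "\<psi> \<in> W22" using A_inv(1)[OF l] by (simp add: \<psi>_def)
lemma derivs: "has_weak_deriv u u1" "has_weak_deriv u1 u2" "has_weak_deriv \<psi> \<psi>1" "has_weak_deriv \<psi>1 \<psi>2"
  "has_weak_deriv w w1" "has_weak_deriv w1 w2"
  using W22_D[OF u_W22] W22_D[OF \<psi>_W22]
  by (auto simp: u1_def u2_def \<psi>1_def \<psi>2_def w_def w1_def w2_def intro: has_weak_deriv_add)

lemma k_nonneg: "0 \<le> k" using l_square_ge_1[OF l] by (simp add: k_def)
lemma N_ge: "1 \<le> N n" using l_square_ge_1[OF l] by (simp add: N_def add_increasing)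
lemma N_ge_k: "k \<le> N n - 1" by (simp add: N_def k_def)

text \<open>Either \<open>\<bar>l\<bar>\<close> is at least 2, or the mean-zero condition removes
  the only frequency with \<open>N n = 1\<close>.\<close>

lemma N_ge_2: "fcoeff u n \<noteq> 0 \<Longrightarrow> 2 \<le> N n"
proof -
  assume "fcoeff u n \<noteq> 0"
  then have "\<bar>l\<bar> \<noteq> 1 \<or> n \<noteq> 0" using u_Y by (auto simp: Y_space_eq)
  then show "2 \<le> N n"
  proof
    assume "n \<noteq> 0"
    then show ?thesis using l_square_ge_1[of n] l_square_ge_1[OF l] by (simp add: N_def)
  next
    assume "\<bar>l\<bar> \<noteq> 1"
    then have "2 \<le> \<bar>real_of_int l\<bar>" using l by linarith
    then have "2\<^sup>2 \<le> \<bar>real_of_int l\<bar>\<^sup>2" by (intro power_mono) auto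
    then show ?thesis by (simp add: N_def add_increasing)
  qed
qed

lemma coeff_u: "fcoeff u n = - of_real (N n) * fcoeff \<psi> n"
  using fcoeff_A_inv[OF l, of u n] by (simp add: \<psi>_def N_def)
lemma coeff_w: "fcoeff w n = - of_real (N n - 1) * fcoeff \<psi> n"
  by (simp add: w_def coeff_u algebra_simps)
lemma coeff_Au: "fcoeff Au n = of_real ((N n)\<^sup>2) * fcoeff \<psi> n"
proof -
  have "fcoeff Au n = - of_real (N n) * (- of_real (N n) * fcoeff \<psi> n)"
    using fcoeff_A_op[OF u_W22, of l n] unfolding Au_def N_def[symmetric] coeff_u .
  then show ?thesis by (simp add: power2_eq_square)
qed
lemma coeff_\<psi>_eq_0: "N n < 2 \<Longrightarrow> fcoeff \<psi> n = 0"
  using N_ge_2[of n] N_ge[of n] by (auto simp: coeff_u)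

lemma u_eq: "u = w - \<psi>" by (simp add: w_def)
lemma A_op_eq: "A_op l v = weak_deriv (weak_deriv v) - (real_of_int l)\<^sup>2 *\<^sub>R v"
proof -
  have "(of_int l)\<^sup>2 *\<^sub>C v = of_real ((real_of_int l)\<^sup>2) *\<^sub>C v" by simp
  then show ?thesis unfolding A_op_def scaleC_of_real by simp
qed

lemma u_eq_\<psi>: "u = \<psi>2 - (real_of_int l)\<^sup>2 *\<^sub>R \<psi>"
  using A_inv(2)[OF l, of u] unfolding A_op_eq \<psi>_def[symmetric] \<psi>1_def[symmetric] \<psi>2_def[symmetric] by simp

lemma Au_eq_u: "Au = u2 - (real_of_int l)\<^sup>2 *\<^sub>R u"
  unfolding Au_def A_op_eq u1_def u2_def ..

lemma w_eq: "w = \<psi>2 - k *\<^sub>R \<psi>"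
proof -
  have "w = (\<psi>2 - (real_of_int l)\<^sup>2 *\<^sub>R \<psi>) + \<psi>" unfolding w_def using u_eq_\<psi> by metis
  then show ?thesis by (simp add: k_def scaleR_diff_left)
qed

lemma Au_eq: "Au = w2 - (real_of_int l)\<^sup>2 *\<^sub>R w - u"
proof -
  have "w2 - (real_of_int l)\<^sup>2 *\<^sub>R w - u = u2 - (real_of_int l)\<^sup>2 *\<^sub>R u
      + ((\<psi>2 - (real_of_int l)\<^sup>2 *\<^sub>R \<psi>) - u)"
    by (simp add: w2_def w_def scaleR_add_right)
  also have "\<dots> = Au" using u_eq_\<psi> by (simp add: Au_eq_u)
  finally show ?thesis ..
qed

lemma w_Y: "w \<in> Y_space l" using u_Y A_inv_in_Y[OF l] by (auto simp: w_def \<psi>_def intro: Y_space_subspace)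
lemma Au_Y: "Au \<in> Y_space l" using A_op_in_Y[OF u_W22 u_Y] by (simp add: Au_def)

lemma mult_cnj_real: "(of_real a * z) * cnj (of_real b * z) = of_real (a * b * (cmod z)\<^sup>2)"
proof -
  have "(of_real a * z) * cnj (of_real b * z) = of_real (a * b) * (z * cnj z)" by (simp add: mult_ac)
  then show ?thesis unfolding complex_norm_square[symmetric] by simp
qed

lemma coeffs: "fcoeff u n = of_real (- N n) * fcoeff \<psi> n" "fcoeff w n = of_real (1 - N n) * fcoeff \<psi> n"
  "fcoeff Au n = of_real ((N n)\<^sup>2) * fcoeff \<psi> n" "fcoeff \<psi> n = of_real 1 * fcoeff \<psi> n"
  by (simp_all add: coeff_u coeff_w coeff_Au)

text \<open>Since \<open>u\<close>, \<open>w\<close>, \<open>Au\<close> and \<open>\<psi>\<close>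
  arise from \<open>\<psi>\<close> by real multipliers, their mutual inner products are real. The
  instances in \<open>reals\<close> remove these pairings from the imaginary parts.\<close>

lemma Im_cinner_real_coeffs:
  assumes "\<And>n. fcoeff f n = of_real (a n) * fcoeff \<psi> n" "\<And>n. fcoeff g n = of_real (b n) * fcoeff \<psi> n"
  shows "Im (cinner f g) = 0"
  by (rule Im_cinner_zero_fcoeffI) (simp only: assms mult_cnj_real Im_complex_of_real)

lemmas reals = Im_cinner_real_coeffs[OF coeffs(1,2)] Im_cinner_real_coeffs[OF coeffs(2,4)]
  Im_cinner_real_coeffs[OF coeffs(4,2)] Im_cinner_real_coeffs[OF coeffs(4,3)]
  Im_cinner_real_coeffs[OF coeffs(1,3)] Im_cinner_real_coeffs[OF coeffs(3,2)]

lemma norm_w_le_u: "norm w \<le> norm u"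
proof (rule norm_le_fcoeffI)
  fix n
  have "\<bar>1 - N n\<bar> * cmod (fcoeff \<psi> n) \<le> \<bar>- N n\<bar> * cmod (fcoeff \<psi> n)"
    by (rule mult_right_mono) (use N_ge[of n] in auto)
  then show "cmod (fcoeff w n) \<le> cmod (fcoeff u n)"
    by (simp only: coeffs(1-3) norm_mult norm_of_real)
qed

text \<open>On the frequencies that occur, \<open>N n \<le> 2 * (N n - 1)\<close>. This factor 2 is
  the price of returning from \<open>w\<close> to \<open>u\<close> in the resolvent bound.\<close>

lemma norm_u_le_w: "norm u \<le> 2 * norm w"
proof -
  have "norm u \<le> norm (2 *\<^sub>R w)"
  proof (rule norm_le_fcoeffI)
    fix n
    show "cmod (fcoeff u n) \<le> cmod (fcoeff (2 *\<^sub>R w) n)"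
    proof (cases "N n < 2")
      case True then show ?thesis by (simp add: coeff_u coeff_\<psi>_eq_0)
    next
      case False
      then have "\<bar>- N n\<bar> \<le> \<bar>2 * (1 - N n)\<bar>" by (simp add: abs_if)
      then have "\<bar>- N n\<bar> * cmod (fcoeff \<psi> n) \<le> \<bar>2 * (1 - N n)\<bar> * cmod (fcoeff \<psi> n)"
        by (rule mult_right_mono) simp
      then show ?thesis
        by (simp only: coeffs(1-3) fcoeff_scaleR norm_mult norm_of_real abs_mult mult.assoc)
    qed
  qed
  then show ?thesis by simp
qed

lemma norm_\<psi>_le_u: "norm \<psi> \<le> norm u"
proof (rule norm_le_fcoeffI)
  fix n
  have "1 * cmod (fcoeff \<psi> n) \<le> \<bar>- N n\<bar> * cmod (fcoeff \<psi> n)"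
    by (rule mult_right_mono) (use N_ge[of n] in auto)
  then show "cmod (fcoeff \<psi> n) \<le> cmod (fcoeff u n)"
    by (simp only: coeffs(1-3) norm_mult norm_of_real)
qed

text \<open>For large \<open>k\<close> the stream function is small compared with \<open>w\<close>;
  this settles the case in which the nonlocal virial term may be negative.\<close>

lemma k_norm_\<psi>_le_w: "k * norm \<psi> \<le> norm w"
proof -
  have "norm (k *\<^sub>R \<psi>) \<le> norm w"
  proof (rule norm_le_fcoeffI)
    fix n
    have "\<bar>k\<bar> * cmod (fcoeff \<psi> n) \<le> \<bar>1 - N n\<bar> * cmod (fcoeff \<psi> n)"
      by (rule mult_right_mono) (use N_ge_k[of n] k_nonneg in auto)
    then show "cmod (fcoeff (k *\<^sub>R \<psi>) n) \<le> cmod (fcoeff w n)"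
      by (simp only: coeffs(1-3) fcoeff_scaleR norm_mult norm_of_real)
  qed
  then show ?thesis using k_nonneg by simp
qed

lemma norm_w1_le_u1: "norm w1 \<le> norm u1"
proof (rule norm_le_fcoeffI)
  fix n
  have "\<bar>1 - N n\<bar> * cmod (fcoeff \<psi> n) \<le> \<bar>- N n\<bar> * cmod (fcoeff \<psi> n)"
    by (rule mult_right_mono) (use N_ge[of n] in auto)
  then have "cmod (fcoeff w n) \<le> cmod (fcoeff u n)"
    by (simp only: coeffs(1-3) norm_mult norm_of_real)
  then show "cmod (fcoeff w1 n) \<le> cmod (fcoeff u1 n)"
    using derivs(1,5) by (simp add: has_weak_deriv_iff norm_mult mult_left_mono)
qed

lemma D_sq: "D\<^sup>2 = (norm u1)\<^sup>2 + (real_of_int l)\<^sup>2 * (norm u)\<^sup>2"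
  by (simp add: D_def)

lemma norm_u1_le_D: "norm u1 \<le> D"
  unfolding D_def by (rule real_le_rsqrt) simp

lemma norm_u_le_D: "norm u \<le> D"
  unfolding D_def
  by (rule real_le_rsqrt) (use mult_right_mono[OF l_square_ge_1[OF l], of "(norm u)\<^sup>2"] in \<open>simp add: add_increasing\<close>)

lemma D_bounds: "norm w \<le> D" "norm w1 \<le> D" "norm \<psi> \<le> D"
  using norm_u_le_D norm_u1_le_D norm_w_le_u norm_w1_le_u1 norm_\<psi>_le_u by linarith+

lemma Au_u: "Re (cinner Au u) = - D\<^sup>2"
proof -
  have "cinner Au u = - cinner u1 u1 - of_real ((real_of_int l)\<^sup>2) * cinner u u"
    unfolding Au_eq_u cinner_diff_left cinner_scaleR_left integration_by_parts[OF derivs(2,1)] ..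
  then show ?thesis unfolding D_sq cinner_self by simp
qed

text \<open>This is where the exclusion of the mean for \<open>\<bar>l\<bar> = 1\<close> enters: \<open>I + A\<^sub>l\<inverse>\<close> is bounded
  below by \<open>1/2\<close> on \<open>Y\<^sub>l\<close>.\<close>

lemma coercive: "D\<^sup>2 \<le> - 2 * Re (cinner Au w)"
proof -
  have "Re (cinner (2 *\<^sub>R Au) w) \<le> Re (cinner Au u)"
  proof (rule Re_cinner_le_fcoeffI)
    fix n
    have "2 * (N n)\<^sup>2 * (1 - N n) * (cmod (fcoeff \<psi> n))\<^sup>2 \<le> (N n)\<^sup>2 * (- N n) * (cmod (fcoeff \<psi> n))\<^sup>2"
    proof (cases "N n < 2")
      case True then show ?thesis by (simp add: coeff_\<psi>_eq_0)
    next
      case False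
      then have "(N n)\<^sup>2 * (2 * (1 - N n)) \<le> (N n)\<^sup>2 * (- N n)" by (intro mult_left_mono) auto
      then have "(N n)\<^sup>2 * (2 * (1 - N n)) * (cmod (fcoeff \<psi> n))\<^sup>2 \<le> (N n)\<^sup>2 * (- N n) * (cmod (fcoeff \<psi> n))\<^sup>2"
        by (rule mult_right_mono) simp
      then show ?thesis by (simp only: mult_ac)
    qed
    moreover have "fcoeff (2 *\<^sub>R Au) n = of_real (2 * (N n)\<^sup>2) * fcoeff \<psi> n"
      unfolding fcoeff_scaleR coeffs(1-3) by simp
    ultimately show "Re (fcoeff (2 *\<^sub>R Au) n * cnj (fcoeff w n)) \<le> Re (fcoeff Au n * cnj (fcoeff u n))"
      by (simp only: coeffs(1-3) mult_cnj_real Re_complex_of_real)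
  qed
  then show ?thesis using Au_u by simp
qed

text \<open>The sign is what matters: it makes the nonlocal contribution to the transport identity
  favourable.\<close>

lemma \<psi>_w: "Re (cinner \<psi> w) = - (norm \<psi>1)\<^sup>2 - k * (norm \<psi>)\<^sup>2"
proof -
  have "cinner \<psi> w = cinner \<psi> \<psi>2 - of_real k * cinner \<psi> \<psi>"
    by (subst w_eq) (simp only: cinner_diff_right cinner_scaleR_right)
  also have "cinner \<psi> \<psi>2 = - cinner \<psi>1 \<psi>1"
    using integration_by_parts[OF derivs(3,4)] by simp
  finally show ?thesis unfolding cinner_self by simp
qed

end

section \<open>Real inequalities\<close>

text \<open>Everything is expressed through \<open>r = \<rho> / (\<rho> + s)\<close>, which equals 1
  at the critical point and decreases away from it, using \<open>s * r = \<rho> * (1 - r)\<close>;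
  \<open>h\<close> is half the derivative of \<open>v\<close>. The conclusions serve, in order, the
  local part of the virial form, the coefficient of \<open>\<psi>1\<close>, the sizes of
  \<open>v\<close> and \<open>h\<close>, and the completion of a square in the nonlocal
  part.\<close>

lemma vector_field_bounds:
  fixes S C \<delta> k :: real
  defines "s \<equiv> 1 - S" and "\<rho> \<equiv> 4 * \<delta>"
  defines "v \<equiv> 2 * \<rho> * C / (\<rho> + s)" and "h \<equiv> \<rho> * (C\<^sup>2 - S * (\<rho> + s)) / (\<rho> + s)\<^sup>2"
  assumes SC: "S\<^sup>2 + C\<^sup>2 = 1" and \<delta>: "0 < \<delta>" "\<delta> \<le> 1"
  shows "3/20 * s + \<delta> / 10 \<le> C * v / 2 + (1 - \<delta> - S) * (9/10 + h)"
    and "7/30 \<le> 9/10 - h" and "v\<^sup>2 \<le> 8 * \<delta>" and "\<bar>h\<bar> \<le> 1"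
    and "0 \<le> k \<Longrightarrow> k * \<delta> \<le> 2 \<Longrightarrow> 30/7 * (k / 20 * v)\<^sup>2 \<le> - k / 10 * h + k * (9/10 + h)"
proof -
  have "\<bar>S\<bar> \<le> 1" using SC by (metis abs_square_le_1 le_add_same_cancel1 zero_le_power2)
  then have s: "0 \<le> s" "s \<le> 2" by (auto simp: s_def)
  have \<rho>: "0 < \<rho>" "\<rho> \<le> 4" using \<delta> by (auto simp: \<rho>_def)
  have C2: "C\<^sup>2 = s * (2 - s)" using SC by (simp add: s_def power2_eq_square algebra_simps)
  define r where "r = \<rho> / (\<rho> + s)"
  have r: "0 < r" "r \<le> 1" using s \<rho> by (auto simp: r_def)
  have rs: "s * r = \<rho> * (1 - r)" using s \<rho> by (simp add: r_def field_simps)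
  have v: "v = 2 * r * C" by (simp add: v_def r_def)
  have h: "h = r * (1 - 2 * r) + s * r\<^sup>2"
  proof -
    have "h = \<rho> * (s - \<rho> + \<rho> * s) / (\<rho> + s)\<^sup>2"
      unfolding h_def C2 by (simp add: s_def algebra_simps power2_eq_square)
    also have "\<dots> = r * (1 - 2 * r) + s * r\<^sup>2"
      using s \<rho> by (simp add: r_def divide_simps) (simp add: power2_eq_square algebra_simps)
    finally show ?thesis .
  qed
  have sr2: "s * r\<^sup>2 = \<rho> * (1 - r) * r" using rs by (simp add: power2_eq_square mult.assoc[symmetric])
  have h': "h = r - 2 * r\<^sup>2 + s * r\<^sup>2" unfolding h by (simp add: power2_eq_square algebra_simps)
  have "s * r\<^sup>2 \<le> 2 * r\<^sup>2" using s by (intro mult_right_mono) auto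
  moreover have "r\<^sup>2 \<le> r" using r by (simp add: power2_eq_square mult_left_le)
  moreover have "0 \<le> s * r\<^sup>2" using s by simp
  ultimately show "\<bar>h\<bar> \<le> 1" using r unfolding h' abs_le_iff by linarith
  have rr: "0 \<le> r * (1 - r)" using r by simp
  have hq: "(1 - r) * (1 + 2 * r) \<le> 1 + h"
    using \<open>0 \<le> s * r\<^sup>2\<close> unfolding h by (simp add: power2_eq_square algebra_simps)
  \<comment> \<open>The bound is \<open>h \<le> 2/3\<close>, and \<open>9/10 - 2/3 = 7/30\<close>.
    For small \<open>r\<close> it follows from \<open>s \<le> 2\<close>, for large \<open>r\<close>
    from \<open>\<rho> \<le> 4\<close>.\<close>
  show "7/30 \<le> 9/10 - h"
  proof (cases "r \<le> 2/3")
    case True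
    then show ?thesis using \<open>s * r\<^sup>2 \<le> 2 * r\<^sup>2\<close> unfolding h' by linarith
  next
    case False
    have "s * r\<^sup>2 \<le> 4 * (1 - r) * r" unfolding sr2 using \<rho> r by (intro mult_right_mono) auto
    moreover have "0 \<le> (r - 2/3) * (6 * r - 1)" using False by simp
    then have "5 * r - 6 * r\<^sup>2 \<le> 2/3" by (simp add: power2_eq_square algebra_simps)
    moreover have "4 * (1 - r) * r = 4 * r - 4 * r\<^sup>2" by (simp add: power2_eq_square algebra_simps)
    ultimately show ?thesis unfolding h' by linarith
  qed
  have v2: "v\<^sup>2 \<le> 32 * \<delta> * (r * (1 - r))"
  proof -
    have "v\<^sup>2 = 4 * r * (\<rho> * (1 - r)) * (2 - s)"
      unfolding v power_mult_distrib C2 rs[symmetric] by (simp add: power2_eq_square)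
    also have "\<dots> \<le> 4 * r * (\<rho> * (1 - r)) * 2" using s r \<rho> by (intro mult_left_mono) auto
    finally show ?thesis by (simp add: \<rho>_def algebra_simps)
  qed
  have "r * (1 - r) \<le> 1/4" using zero_le_power2[of "r - 1/2"] by (simp add: power2_eq_square algebra_simps)
  then have "32 * \<delta> * (r * (1 - r)) \<le> 32 * \<delta> * (1/4)" using \<delta> by (intro mult_left_mono) auto
  then show "v\<^sup>2 \<le> 8 * \<delta>" using v2 by simp
  \<comment> \<open>The bound for \<open>v^2\<close> and the quantity \<open>1 + h\<close> both
    carry the factor \<open>1 - r\<close>, so the two sides degenerate together at the critical
    point; \<open>k * \<delta> \<le> 2\<close> controls their ratio.\<close>
  show "30/7 * (k / 20 * v)\<^sup>2 \<le> - k / 10 * h + k * (9/10 + h)" if k: "0 \<le> k" "k * \<delta> \<le> 2"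
  proof -
    have "30/7 * (k / 20 * v)\<^sup>2 = 30/2800 * k * (k * v\<^sup>2)" by (simp add: power2_eq_square)
    also have "\<dots> \<le> 30/2800 * k * (k * (32 * \<delta> * (r * (1 - r))))"
      using v2 k by (intro mult_left_mono) auto
    also have "\<dots> = 960/2800 * k * ((k * \<delta>) * (r * (1 - r)))" by simp
    also have "\<dots> \<le> 960/2800 * k * (2 * (r * (1 - r)))" using k rr by (intro mult_left_mono mult_right_mono) auto
    also have "\<dots> = k * (1920/2800 * (r * (1 - r)))" by simp
    also have "\<dots> \<le> k * (9/10 * (1 + h))"
    proof (rule mult_left_mono[OF _ k(1)])
      have "1920/2800 * (r * (1 - r)) \<le> 9/10 * ((1 - r) * (1 + 2 * r))"
      proof -
        have "0 \<le> (1 - r) * (9/10 + (9/5 - 1920/2800) * r)" using r by (intro mult_nonneg_nonneg) auto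
        also have "\<dots> = 9/10 * ((1 - r) * (1 + 2 * r)) - 1920/2800 * (r * (1 - r))" by (simp add: field_simps)
        finally show ?thesis by linarith
      qed
      then show "1920/2800 * (r * (1 - r)) \<le> 9/10 * (1 + h)"
        using mult_left_mono[OF hq, of "9/10"] by simp
    qed
    also have "\<dots> = - k / 10 * h + k * (9/10 + h)" by (simp add: algebra_simps)
    finally show ?thesis .
  qed
  \<comment> \<open>With 1 in place of 9/10 the form dominates \<open>s / 4\<close> but vanishes at
    the critical point. The remaining \<open>- (s - \<delta>) / 10\<close> supplies
    \<open>\<delta> / 10\<close> there and leaves \<open>1/4 - 1/10 = 3/20\<close> of
    \<open>s\<close>.\<close>
  have key: "s / 4 \<le> r * C\<^sup>2 + (s - \<delta>) * (1 + h)"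
  proof -
    \<comment> \<open>After multiplication by \<open>r\<close> both sides of \<open>key\<close>
      contain \<open>\<rho> * (1 - r)\<close>, and this inequality is the other factor. For small
      \<open>r\<close> the bound \<open>s \<le> 2\<close> gives \<open>\<rho> \<le> 6 * r\<close>,
      which eliminates \<open>\<rho>\<close>; for large \<open>r\<close> the bound
      \<open>\<rho> \<le> 4\<close> is enough.\<close>
    have poly: "1/4 \<le> 2 * r - \<rho> * (1 - r) + (1 - 5/4 * r) * (1 + 2 * r + r * \<rho>)"
    proof (cases "r \<le> 2/3")
      case True
      have b1: "\<rho> * (1 - r) \<le> 2 * r" unfolding rs[symmetric] using s r by (intro mult_right_mono) auto
      have "\<rho> * (1/3) \<le> \<rho> * (1 - r)" using True \<rho> by (intro mult_left_mono) auto
      then have b2: "\<rho> \<le> 6 * r" using b1 by linarith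
      have "\<rho> * (1 - r) * (1 - r) \<le> 2 * r * (1 - r)" using b1 r by (intro mult_right_mono) auto
      then have f1: "\<rho> * (1 - 2 * r) + \<rho> * r\<^sup>2 \<le> 2 * r - 2 * r\<^sup>2"
        by (simp add: power2_eq_square algebra_simps)
      have f2: "\<rho> * r\<^sup>2 \<le> 6 * (r * r\<^sup>2)"
        using mult_right_mono[OF b2, of "r\<^sup>2"] by (simp only: mult.assoc zero_le_power2)
      have f3: "r * r\<^sup>2 \<le> r\<^sup>2" using mult_right_mono[OF r(2), of "r\<^sup>2"] by simp
      have f4: "r\<^sup>2 \<le> 2/3 * r" unfolding power2_eq_square using True r by (intro mult_right_mono) auto
      have "2 * r - \<rho> * (1 - r) + (1 - 5/4 * r) * (1 + 2 * r + r * \<rho>)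
          = 1 + 11/4 * r - 5/2 * r\<^sup>2 - \<rho> * (1 - 2 * r) - 5/4 * (\<rho> * r\<^sup>2)"
        by (simp add: power2_eq_square field_simps)
      moreover have "1/4 \<le> E" if "A + B \<le> 2 * r - 2 * x" "B \<le> 6 * y" "y \<le> x" "x \<le> 2/3 * r"
        "E = 1 + 11/4 * r - 5/2 * x - A - 5/4 * B" for A B E x y
        using that r True by linarith
      ultimately show ?thesis using f1 f2 f3 f4 by blast
    next
      case False
      have "(1 - r)\<^sup>2 = 1 - 2 * r + r\<^sup>2" by (simp add: power2_eq_square algebra_simps)
      then have "0 \<le> 1 - 2 * r + 5/4 * r\<^sup>2" using zero_le_power2[of "1 - r"] zero_le_power2[of r] by linarith
      then have "\<rho> * (1 - 2 * r + 5/4 * r\<^sup>2) \<le> 4 * (1 - 2 * r + 5/4 * r\<^sup>2)" using \<rho> by (intro mult_right_mono)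
      moreover have "0 \<le> (r - 2/3) * (1 - r)" using False r by simp
      then have "r\<^sup>2 \<le> 5/3 * r - 2/3" by (simp add: power2_eq_square field_simps)
      moreover have "2 * r - \<rho> * (1 - r) + (1 - 5/4 * r) * (1 + 2 * r + r * \<rho>)
          = 1 + 11/4 * r - 5/2 * r\<^sup>2 - \<rho> * (1 - 2 * r + 5/4 * r\<^sup>2)"
        by (simp add: power2_eq_square field_simps)
      moreover have "1/4 \<le> E"
        if "A \<le> 4 * (1 - 2 * r + 5/4 * x)" "x \<le> 5/3 * r - 2/3" "E = 1 + 11/4 * r - 5/2 * x - A" for A E x
        using that r(2) by (simp add: algebra_simps)
      ultimately show ?thesis by blast
    qed
    have "\<rho> * (1 - r) * (1/4) \<le> \<rho> * (1 - r) * (2 * r - \<rho> * (1 - r) + (1 - 5/4 * r) * (1 + 2 * r + r * \<rho>))"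
      using poly r \<rho> by (intro mult_left_mono) auto
    also have "\<dots> = r * (r * C\<^sup>2 + (s - \<delta>) * (1 + h))"
    proof -
      have e1: "r * (r * C\<^sup>2) = (s * r) * (2 * r - s * r)" by (simp add: C2 algebra_simps)
      have e2: "r * ((s - \<delta>) * (1 + h)) = (s * r - \<rho> / 4 * r) * (1 + h)" by (simp add: \<rho>_def algebra_simps)
      have e3: "1 + h = (1 - r) * (1 + 2 * r + r * \<rho>)"
        unfolding h sr2 by (simp add: power2_eq_square algebra_simps)
      have "r * (r * C\<^sup>2 + (s - \<delta>) * (1 + h)) = r * (r * C\<^sup>2) + r * ((s - \<delta>) * (1 + h))"
        by (rule distrib_left)
      also have "\<dots> = (\<rho> * (1 - r)) * (2 * r - \<rho> * (1 - r))
          + (\<rho> * (1 - r) - \<rho> / 4 * r) * ((1 - r) * (1 + 2 * r + r * \<rho>))"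
        unfolding e1 e2 unfolding e3 rs ..
      finally show ?thesis by (simp add: field_simps)
    qed
    finally have "r * (s / 4) \<le> r * (r * C\<^sup>2 + (s - \<delta>) * (1 + h))"
      using rs by (simp add: mult.commute)
    then show ?thesis using r by simp
  qed
  have e1: "C * v / 2 = r * C\<^sup>2" by (simp add: v power2_eq_square)
  have e2: "1 - \<delta> - S = s - \<delta>" by (simp add: s_def)
  have e3: "(s - \<delta>) * (9/10 + h) = (s - \<delta>) * (1 + h) - (s - \<delta>) / 10" by (simp add: field_simps)
  have "3/20 * s + \<delta> / 10 \<le> A + (B - (s - \<delta>) / 10)" if "s / 4 \<le> A + B" for A B
    using that by (simp add: field_simps)
  then show "3/20 * s + \<delta> / 10 \<le> C * v / 2 + (1 - \<delta> - S) * (9/10 + h)"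
    unfolding e1 e2 e3 using key by blast
qed

text \<open>Since \<open>P \<le> sqrt (2 * P) * D\<close>, the uncertainty principle becomes
  \<open>X^2 \<le> 3 * sqrt (2 * P) * D\<close>. Squaring and inserting the bounds for
  \<open>D\<close> and \<open>P\<close> leaves
  \<open>X^2 \<le> 36 * F * b * X + 36 * (F * b)^2\<close>. The constant 37 works because
  \<open>37^2 = 1369\<close> just exceeds \<open>36 * 37 + 36 = 1368\<close>.\<close>

lemma edge_absorption:
  fixes X P D F N b :: real
  assumes "0 \<le> X" "0 \<le> P" "0 \<le> F" "0 \<le> D" "0 < N" "0 < b" "N * b\<^sup>2 = 1" "X \<le> D"
    and P: "P \<le> b * X\<^sup>2 + F * X / N" "P \<le> 2 * X\<^sup>2"
    and X: "X\<^sup>2 \<le> P + 2 * sqrt (2 * P) * D" and D: "D\<^sup>2 \<le> 2 * F * X"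
  shows "X \<le> 37 * F * b"
proof (cases "X = 0")
  case True then show ?thesis using assms by simp
next
  case False
  then have "X > 0" using assms by simp
  let ?p = "sqrt (2 * P)"
  have p: "?p\<^sup>2 = 2 * P" "0 \<le> ?p" using assms by simp_all
  have "?p\<^sup>2 \<le> (2 * X)\<^sup>2" using P(2) p by (simp add: power2_eq_square)
  then have "?p \<le> 2 * X" by (rule power2_le_imp_le) (use assms in simp)
  then have "?p * ?p \<le> ?p * (2 * D)" using p assms by (intro mult_left_mono) linarith+
  then have "P \<le> ?p * D" using p by (simp add: power2_eq_square)
  then have "X\<^sup>2 \<le> 3 * ?p * D" using X by simp
  then have "(X\<^sup>2)\<^sup>2 \<le> (3 * ?p * D)\<^sup>2" using assms by (intro power_mono) auto
  also have "\<dots> = 18 * P * D\<^sup>2" by (simp add: power_mult_distrib assms)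
  also have "\<dots> \<le> 18 * P * (2 * F * X)" using D assms by (intro mult_left_mono) auto
  also have "\<dots> \<le> 18 * (b * X\<^sup>2 + F * X / N) * (2 * F * X)" using P assms by (intro mult_right_mono) auto
  also have "F * X / N = F * X * b\<^sup>2" using assms by (simp add: field_simps)
  finally have "X\<^sup>2 * X\<^sup>2 \<le> X\<^sup>2 * (36 * F * b * X + 36 * (F * b)\<^sup>2)"
    by (simp add: power2_eq_square algebra_simps)
  then have *: "X\<^sup>2 \<le> 36 * F * b * X + 36 * (F * b)\<^sup>2"
    by (rule mult_left_le_imp_le) (use \<open>X > 0\<close> in simp)
  show ?thesis
  proof (rule ccontr)
    assume "\<not> X \<le> 37 * F * b"
    then have gt: "37 * (F * b) < X" by simp
    have Fb: "0 \<le> F * b" using assms by simp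
    have "(37 * (F * b)) * X \<le> X * X" using gt \<open>X > 0\<close> by (intro mult_right_mono) auto
    moreover have "36 * (F * b) * (F * b) \<le> 36/37 * (F * b) * X"
      using mult_left_mono[of "37 * (F * b)" X "36/37 * (F * b)"] gt Fb by simp
    moreover have "X * X > (37 * (F * b)) * X" using gt \<open>X > 0\<close> by simp
    ultimately have "(37 * (F * b)) * X < 36 * (F * b) * X + 36/37 * (F * b) * X"
      using * by (simp add: power2_eq_square algebra_simps)
    moreover have "0 \<le> (F * b) * X" using Fb \<open>X > 0\<close> by simp
    ultimately show False by linarith
  qed
qed

text \<open>By contradiction, in units that make all terms homogeneous: \<open>n\<close> and
  \<open>q\<close> remove the fractional powers, \<open>R\<close> is the left-hand side of the
  claim, and \<open>t\<^sup>2\<close>, at least 1, measures \<open>P + \<delta> * X\<^sup>2\<close>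
  against \<open>\<delta> * X\<^sup>2\<close>. If \<open>F\<close> is tiny compared with
  \<open>R\<close>, then \<open>D\<close> and \<open>G\<close> are small multiples of
  \<open>n * q * X\<close> and \<open>t * R\<close>, and \<open>T\<close> bounds \<open>t^2\<close>
  by a small multiple of \<open>t\<close>.\<close>

lemma bulk_absorption:
  fixes X P D F G N \<delta> :: real
  assumes nn: "0 \<le> X" "0 \<le> P" "0 \<le> F" "0 \<le> D" "0 \<le> G" and N: "0 < N" and \<delta>: "0 < \<delta>" "1 \<le> N * \<delta>\<^sup>2"
    and D: "D\<^sup>2 \<le> 2 * F * X"
    and G: "G\<^sup>2 \<le> F * G + 3 * N * sqrt P * D"
    and T: "N * (P + \<delta> * X\<^sup>2) \<le> 60 * (F + G) * (sqrt \<delta> * D + X)"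
  shows "N powr (2/3) * \<delta> powr (1/3) * X \<le> 2 * 10^12 * F"
proof (rule ccontr)
  assume neg: "\<not> N powr (2/3) * \<delta> powr (1/3) * X \<le> 2 * 10^12 * F"
  define n where "n = N powr (1/3)"
  define q where "q = \<delta> powr (1/6)"
  \<comment> \<open>The small parameter: the negated claim becomes \<open>F < z^4 / 2 * R\<close>,
    which explains \<open>2 * 10^12\<close>, and the final contradiction rests on
    \<open>360 * z < 1\<close>.\<close>
  define z :: real where "z = 1/1000"
  have n: "n > 0" "n^3 = N" using N by (simp_all add: n_def powr_power)
  have q: "q > 0" "q^6 = \<delta>" using \<delta> by (simp_all add: q_def powr_power)
  have M: "N powr (2/3) = n\<^sup>2" "\<delta> powr (1/3) = q\<^sup>2" using N \<delta> by (simp_all add: n_def q_def powr_power)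
  have sq: "sqrt \<delta> = q^3" using q by (intro real_sqrt_unique) auto
  define R where "R = n\<^sup>2 * q\<^sup>2 * X"
  have FR: "F < z^4 / 2 * R" using neg unfolding M R_def[symmetric] by (simp add: z_def power_divide)
  have "X \<noteq> 0" using FR nn by (auto simp: R_def)
  then have X: "X > 0" using nn by simp
  then have R: "R > 0" using n q by (simp add: R_def)
  have D_le: "D \<le> z\<^sup>2 * n * q * X"
  proof (rule power2_le_imp_le)
    have "D\<^sup>2 \<le> 2 * (z^4 / 2 * R) * X" using D FR X by (smt (verit) mult_right_mono)
    also have "\<dots> = (z\<^sup>2 * n * q * X)\<^sup>2" by (simp add: R_def power2_eq_square power4_eq_xxxx)
    finally show "D\<^sup>2 \<le> (z\<^sup>2 * n * q * X)\<^sup>2" .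
  qed (use n q X in \<open>simp add: z_def\<close>)
  define t where "t = sqrt ((P + \<delta> * X\<^sup>2) / (\<delta> * X\<^sup>2))"
  have dX: "\<delta> * X\<^sup>2 > 0" using \<delta> X by simp
  have "t\<^sup>2 = (P + \<delta> * X\<^sup>2) / (\<delta> * X\<^sup>2)"
    unfolding t_def by (rule real_sqrt_pow2) (use dX nn in \<open>auto intro!: divide_nonneg_pos add_nonneg_nonneg\<close>)
  then have t2: "t\<^sup>2 * (q^6 * X\<^sup>2) = P + \<delta> * X\<^sup>2" unfolding q(2) using dX by auto
  have t1: "1 \<le> t" unfolding t_def using dX nn by (simp add: real_le_rsqrt)
  have sP: "sqrt P \<le> t * q^3 * X"
  proof (rule real_le_lsqrt)
    have "(t * q^3 * X)\<^sup>2 = t\<^sup>2 * (q^6 * X\<^sup>2)" by (simp add: power_mult_distrib flip: power_mult)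
    then show "P \<le> (t * q^3 * X)\<^sup>2" using t2 dX by simp
  qed (use t1 q X nn in auto)
  have "sqrt P * D \<le> (t * q^3 * X) * (z\<^sup>2 * n * q * X)"
    using sP D_le nn t1 q X by (intro mult_mono) auto
  then have "3 * N * (sqrt P * D) \<le> 3 * N * ((t * q^3 * X) * (z\<^sup>2 * n * q * X))"
    using N by (intro mult_left_mono) auto
  also have "\<dots> = 3 * t * z\<^sup>2 * R\<^sup>2"
    unfolding n(2)[symmetric] R_def by (simp add: power2_eq_square power3_eq_cube)
  finally have G': "G\<^sup>2 \<le> F * G + 3 * t * z\<^sup>2 * R\<^sup>2" using G by simp
  \<comment> \<open>This solves the quadratic inequality for \<open>G\<close>: the source term costs
    \<open>z^4 / 2 * R\<close>, and the square root of the other term is at most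
    \<open>2 * z * t * R\<close> because \<open>t\<close> is at least 1.\<close>
  have G_le: "G \<le> (z^4/2 + 2 * z * t) * R"
  proof (rule ccontr)
    assume "\<not> ?thesis"
    then have g: "(z^4/2 + 2 * z * t) * R < G" by simp
    have "0 \<le> z^4 / 2 * R" using R by (simp add: z_def)
    then have g2: "2 * z * t * R \<le> G" "2 * z * t * R < G - F" using g FR by (auto simp: algebra_simps)
    have "(2 * z * t * R) * (2 * z * t * R) < G * (G - F)"
      by (rule mult_le_less_imp_less) (use g2 t1 R in \<open>auto simp: z_def\<close>)
    moreover have "3 * t * z\<^sup>2 * R\<^sup>2 \<le> (2 * z * t * R) * (2 * z * t * R)"
    proof -
      have "3 * t \<le> 4 * t * t" using mult_right_mono[OF t1, of t] t1 by linarith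
      then have "3 * t * (z\<^sup>2 * R\<^sup>2) \<le> 4 * t * t * (z\<^sup>2 * R\<^sup>2)" by (rule mult_right_mono) simp
      then show ?thesis by (simp add: power2_eq_square mult_ac)
    qed
    ultimately show False using G' by (simp add: power2_eq_square algebra_simps)
  qed
  have zt: "z^4 \<le> z * t" using t1 by (simp add: z_def power_divide)
  have FG: "F + G \<le> 3 * z * t * R"
  proof -
    have "F + G \<le> (z^4 + 2 * z * t) * R" using FR G_le by (simp add: algebra_simps)
    also have "\<dots> \<le> (3 * z * t) * R" by (rule mult_right_mono) (use zt R in linarith)+
    finally show ?thesis .
  qed
  \<comment> \<open>The cube root of \<open>1 \<le> N * \<delta>\<^sup>2\<close>. This is where the
    distance from the edge regime enters: it lets \<open>n * q^4 * X\<close> dominate the bare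
    \<open>X\<close> in \<open>T\<close>.\<close>
  have nq: "1 \<le> n * q^4"
  proof -
    have "1 ^ 3 \<le> (n * q^4)^3" using \<delta>(2) unfolding n(2)[symmetric] q(2)[symmetric]
      by (simp add: power_mult_distrib flip: power_mult)
    then show ?thesis using n q by (subst (asm) power_mono_iff) auto
  qed
  have E: "sqrt \<delta> * D + X \<le> 2 * n * q^4 * X"
  proof -
    have "sqrt \<delta> * D \<le> q^3 * (z\<^sup>2 * n * q * X)" unfolding sq using D_le q by (intro mult_left_mono) auto
    also have "\<dots> = z\<^sup>2 * (n * q^4 * X)" by (simp add: eval_nat_numeral)
    also have "\<dots> \<le> 1 * (n * q^4 * X)" using n q X by (intro mult_right_mono) (auto simp: z_def power_divide)
    finally have "sqrt \<delta> * D \<le> n * q^4 * X" by simp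
    moreover have "1 * X \<le> (n * q^4) * X" using nq X by (intro mult_right_mono) auto
    ultimately show ?thesis by simp
  qed
  have "n^3 * (t\<^sup>2 * (q^6 * X\<^sup>2)) \<le> 60 * (F + G) * (sqrt \<delta> * D + X)" using T unfolding t2 n(2) .
  also have "\<dots> \<le> 60 * (3 * z * t * R) * (2 * n * q^4 * X)"
    using FG E nn t1 R n q X \<delta> by (intro mult_mono) (auto simp: z_def)
  also have "\<dots> = 360 * z * (t * (n^3 * q^6 * X\<^sup>2))"
    unfolding R_def by (simp add: eval_nat_numeral)
  finally have "t * (t * (n^3 * q^6 * X\<^sup>2)) \<le> 360 * z * (t * (n^3 * q^6 * X\<^sup>2))"
    by (simp add: power2_eq_square mult_ac)
  moreover have "0 < t * (n^3 * q^6 * X\<^sup>2)" using t1 n(1) q(1) X by (intro mult_pos_pos) auto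
  ultimately have "t \<le> 360 * z" by (simp only: mult_le_cancel_right_pos)
  then show False using t1 by (simp add: z_def)
qed

section \<open>A priori estimates\<close>

text \<open>The equation is kept in weak form against \<open>Y_space l\<close>, so the orthogonal
  projection does not appear in the estimates.\<close>

locale resolvent_equation = stream_function +
  fixes f :: L2T and \<beta> \<mu> :: real
  assumes \<beta>: "\<beta> \<noteq> 0"
    and weak: "\<And>z. z \<in> Y_space l \<Longrightarrow>
      cinner f z = cinner Au z - \<i> * of_real \<beta> * cinner (rmult sin w) z + \<i> * of_real (\<beta> * \<mu>) * cinner u z"
begin

text \<open>Moving the sign of \<open>\<mu>\<close> into \<open>S\<close> treats both signs at once
  and puts the critical point always at \<open>S = 1\<close>.\<close>

definition \<sigma> :: real where "\<sigma> = (if \<mu> < 0 then - 1 else 1)"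
definition S :: "real \<Rightarrow> real" where "S y = \<sigma> * sin y"
definition C :: "real \<Rightarrow> real" where "C y = \<sigma> * cos y"
definition P :: real where "P = qform (\<lambda>y. 1 - S y) w"
text \<open>This is \<open>\<bar>\<mu>\<bar> *\<^sub>R u - rmult S w\<close> after inserting
  \<open>u = w - \<psi>\<close>: a local weight acting on \<open>w\<close> and a single nonlocal
  term.\<close>

definition H :: L2T where "H = rmult (\<lambda>y. \<bar>\<mu>\<bar> - S y) w - \<bar>\<mu>\<bar> *\<^sub>R \<psi>"

lemma D_nonneg: "0 \<le> D"
  using norm_u_le_D norm_ge_zero order_trans by blast

lemma \<sigma>: "\<sigma> * \<sigma> = 1" "\<bar>\<sigma>\<bar> = 1" "\<sigma> * \<bar>\<mu>\<bar> = \<mu>" by (auto simp: \<sigma>_def)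

lemma S_deriv: "(S has_real_derivative C y) (at y)"
  unfolding S_def[abs_def] C_def by (auto intro!: derivative_eq_intros)
lemma C_deriv: "(C has_real_derivative - S y) (at y)"
  unfolding C_def[abs_def] S_def by (auto intro!: derivative_eq_intros)
lemma S_cont [continuous_intros]: "continuous_on UNIV S"
  unfolding S_def[abs_def] by (intro continuous_intros)
lemma C_cont [continuous_intros]: "continuous_on UNIV C"
  unfolding C_def[abs_def] by (intro continuous_intros)
lemma SC: "(S y)\<^sup>2 + (C y)\<^sup>2 = 1"
proof -
  have "(S y)\<^sup>2 + (C y)\<^sup>2 = (\<sigma> * \<sigma>) * ((sin y)\<^sup>2 + (cos y)\<^sup>2)"
    by (simp only: S_def C_def power_mult_distrib power2_eq_square[of \<sigma>] distrib_left)
  then show ?thesis by (simp add: \<sigma>)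
qed
lemma S_le: "S y \<le> 1" "- 1 \<le> S y"
  using SC[of y] abs_square_le_1[of "S y"] by (auto simp: abs_le_iff) (metis le_add_same_cancel1 zero_le_power2)+
lemma C_sq_le: "(C y)\<^sup>2 \<le> 2 * (1 - S y)"
proof -
  have "(C y)\<^sup>2 = (1 + S y) * (1 - S y)" using SC[of y] by (simp add: power2_eq_square algebra_simps)
  also have "\<dots> \<le> 2 * (1 - S y)" using S_le[of y] by (intro mult_right_mono) auto
  finally show ?thesis .
qed
lemma S_periodic: "C1_periodic S C" "C1_periodic C (\<lambda>y. - S y)"
  unfolding C1_periodic_def using S_deriv C_deriv
  by (auto intro!: continuous_intros simp: S_def C_def)

lemma P_bounds: "0 \<le> P" "P \<le> 2 * (norm w)\<^sup>2"
proof -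
  have c: "continuous_on UNIV (\<lambda>y. 1 - S y)" by (intro continuous_intros)
  have "qform (\<lambda>y. 0) w \<le> P" "P \<le> qform (\<lambda>y. 2) w"
    unfolding P_def using S_le by (auto intro!: qform_mono c)
  then show "0 \<le> P" "P \<le> 2 * (norm w)\<^sup>2" by (simp_all add: qform_const)
qed

lemma test_eq: "z \<in> Y_space l \<Longrightarrow> cinner f z = cinner Au z + \<i> * of_real (\<beta> * \<sigma>) * cinner H z"
proof -
  assume z: "z \<in> Y_space l"
  have S': "rmult S w = \<sigma> *\<^sub>R rmult sin w"
    unfolding S_def[abs_def] by (rule rmult_cmult) (intro continuous_intros)
  have "rmult (\<lambda>y. - S y) w = - rmult S w" using rmult_cmult[OF S_cont, of "-1" w] by simp
  then have "rmult (\<lambda>y. \<bar>\<mu>\<bar> + - S y) w = \<bar>\<mu>\<bar> *\<^sub>R w - rmult S w"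
    by (subst rmult_plus) (auto intro!: continuous_intros simp: rmult_const)
  then have "rmult (\<lambda>y. \<bar>\<mu>\<bar> - S y) w = \<bar>\<mu>\<bar> *\<^sub>R w - \<sigma> *\<^sub>R rmult sin w" by (simp add: S')
  then have "H = \<bar>\<mu>\<bar> *\<^sub>R u - \<sigma> *\<^sub>R rmult sin w" by (simp add: H_def w_def scaleR_add_right)
  then have "\<sigma> *\<^sub>R H = \<mu> *\<^sub>R u - rmult sin w" using \<sigma> by (simp add: scaleR_diff_right)
  then have e: "of_real \<sigma> * cinner H z = of_real \<mu> * cinner u z - cinner (rmult sin w) z"
    by (metis cinner_scaleR_left cinner_diff_left)
  have "\<i> * of_real (\<beta> * \<sigma>) * cinner H z = \<i> * of_real \<beta> * (of_real \<sigma> * cinner H z)" by simp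
  then show ?thesis unfolding weak[OF z] e by (simp add: algebra_simps)
qed

lemma H_w: "cinner H w = of_real (qform (\<lambda>y. \<bar>\<mu>\<bar> - S y) w - \<bar>\<mu>\<bar> * Re (cinner \<psi> w))"
proof -
  have "cinner \<psi> w = of_real (Re (cinner \<psi> w))" using reals by (simp add: complex_eq_iff)
  then show ?thesis unfolding H_def
    by (simp add: cinner_diff_left cinner_rmult_self continuous_intros)
qed

text \<open>As \<open>cinner H w\<close> is real, the transport part drops out of the real part of
  the test with \<open>w\<close>, and coercivity remains.\<close>

lemma energy: "D\<^sup>2 \<le> 2 * norm f * norm w"
proof -
  have "Re (cinner f w) = Re (cinner Au w)"
    unfolding test_eq[OF w_Y] H_w by simp
  then show ?thesis using coercive Re_cinner_le[of f w] by linarith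
qed

text \<open>This is the imaginary part of the same test, from which \<open>cinner Au w\<close> drops
  out because it is real.\<close>

lemma transport: "\<bar>\<beta>\<bar> * \<bar>qform (\<lambda>y. \<bar>\<mu>\<bar> - S y) w - \<bar>\<mu>\<bar> * Re (cinner \<psi> w)\<bar> \<le> norm f * norm w"
proof -
  have "Im (cinner f w) = \<beta> * \<sigma> * (qform (\<lambda>y. \<bar>\<mu>\<bar> - S y) w - \<bar>\<mu>\<bar> * Re (cinner \<psi> w))"
    unfolding test_eq[OF w_Y] H_w using reals by simp
  then have "\<bar>Im (cinner f w)\<bar> = \<bar>\<beta>\<bar> * \<bar>qform (\<lambda>y. \<bar>\<mu>\<bar> - S y) w - \<bar>\<mu>\<bar> * Re (cinner \<psi> w)\<bar>"
    using \<sigma> by (simp add: abs_mult)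
  then show ?thesis using Im_cinner_le[of f w] by simp
qed

lemma qform_a: "qform (\<lambda>y. \<bar>\<mu>\<bar> - S y) w = P - (1 - \<bar>\<mu>\<bar>) * (norm w)\<^sup>2"
proof -
  have "qform (\<lambda>y. (1 - S y) - (1 - \<bar>\<mu>\<bar>)) w = P - (1 - \<bar>\<mu>\<bar>) * (norm w)\<^sup>2"
    by (subst qform_diff) (auto intro!: continuous_intros simp: P_def qform_const)
  then show ?thesis by (simp add: algebra_simps)
qed

lemma \<psi>_w_nonpos: "Re (cinner \<psi> w) \<le> 0"
  using \<psi>_w mult_nonneg_nonneg[OF k_nonneg zero_le_power2[of "norm \<psi>"]] zero_le_power2[of "norm \<psi>1"]
  by linarith

lemma transport_le: "P - (1 - \<bar>\<mu>\<bar>) * (norm w)\<^sup>2 \<le> norm f * norm w / \<bar>\<beta>\<bar>"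
proof -
  have "P - (1 - \<bar>\<mu>\<bar>) * (norm w)\<^sup>2 \<le> qform (\<lambda>y. \<bar>\<mu>\<bar> - S y) w - \<bar>\<mu>\<bar> * Re (cinner \<psi> w)"
    using \<psi>_w_nonpos by (simp add: qform_a mult_nonneg_nonpos)
  also have "\<dots> \<le> norm f * norm w / \<bar>\<beta>\<bar>"
    using transport \<beta> by (simp add: pos_le_divide_eq mult.commute) (smt (verit) mult_left_mono)
  finally show ?thesis .
qed

theorem estimate_outside:
  assumes "\<bar>\<mu>\<bar> > 1"
  shows "\<bar>\<beta>\<bar> * (\<bar>\<mu>\<bar> - 1) * norm w \<le> norm f"
proof (cases "norm w = 0")
  case False
  then have w: "norm w > 0" by simp
  have "(\<bar>\<mu>\<bar> - 1) * (norm w)\<^sup>2 \<le> norm f * norm w / \<bar>\<beta>\<bar>"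
    using transport_le P_bounds by (simp add: algebra_simps)
  then have "\<bar>\<beta>\<bar> * ((\<bar>\<mu>\<bar> - 1) * (norm w)\<^sup>2) \<le> norm f * norm w"
    using \<beta> by (simp add: pos_le_divide_eq mult.commute)
  then have "(\<bar>\<beta>\<bar> * (\<bar>\<mu>\<bar> - 1) * norm w) * norm w \<le> norm f * norm w"
    by (simp add: power2_eq_square mult_ac)
  then show ?thesis using w by (simp only: mult_le_cancel_right_pos)
qed simp

lemma norm_Cw: "norm (rmult C w) \<le> sqrt (2 * P)"
proof -
  have "qform (\<lambda>y. 2 * (1 - S y)) w = 2 * P"
    unfolding P_def by (rule qform_cmult) (intro continuous_intros)
  moreover have "norm (rmult C w) \<le> sqrt (qform (\<lambda>y. 2 * (1 - S y)) w)"
    by (rule norm_rmult_le_qform) (intro continuous_intros C_sq_le)+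
  ultimately show ?thesis by simp
qed

text \<open>An uncertainty principle: \<open>\<integral> S \<bar>w\<bar>\<^sup>2 = 2 Re \<integral> C w w'\<close>.\<close>

lemma uncertainty: "(norm w)\<^sup>2 \<le> P + 2 * sqrt (2 * P) * D"
proof -
  have "P = (norm w)\<^sup>2 - qform S w"
    unfolding P_def by (subst qform_diff) (auto intro!: continuous_intros simp: qform_const)
  moreover have "qform (\<lambda>y. - S y) w = - qform S w"
    using qform_cmult[OF S_cont, of "-1" w] by simp
  then have "qform S w = 2 * Re (cinner (rmult C w) w1)"
    using Re_rmult_deriv[OF S_periodic(2) derivs(5)] by simp
  moreover have "Re (cinner (rmult C w) w1) \<le> sqrt (2 * P) * D"
  proof -
    have "Re (cinner (rmult C w) w1) \<le> norm (rmult C w) * norm w1"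
      using Re_cinner_le[of "rmult C w" w1] by linarith
    also have "\<dots> \<le> sqrt (2 * P) * D"
      using norm_Cw D_bounds P_bounds by (intro mult_mono) auto
    finally show ?thesis .
  qed
  ultimately show ?thesis by linarith
qed

theorem estimate_edge:
  assumes "\<bar>\<bar>\<mu>\<bar> - 1\<bar> \<le> b" "0 < b" "\<bar>\<beta>\<bar> * b\<^sup>2 = 1"
  shows "norm w \<le> 37 * norm f * b"
proof (rule edge_absorption[where P=P and N="\<bar>\<beta>\<bar>" and D=D])
  have "(1 - \<bar>\<mu>\<bar>) * (norm w)\<^sup>2 \<le> b * (norm w)\<^sup>2"
    using assms by (intro mult_right_mono) auto
  then show "P \<le> b * (norm w)\<^sup>2 + norm f * norm w / \<bar>\<beta>\<bar>" using transport_le by linarith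
qed (use assms D_nonneg \<beta> P_bounds uncertainty energy D_bounds in auto)

text \<open>Only the imaginary part of \<open>cinner H Au\<close> enters. Integration by parts
  leaves \<open>C * w\<close> against \<open>w1\<close>, and the constant part of the weight drops
  out against \<open>\<psi>\<close>. The remaining factors \<open>C\<close> and \<open>1 - S\<close>
  vanish at the critical point, hence \<open>sqrt P\<close>; the constant 3 bounds
  \<open>2 * sqrt 2\<close>.\<close>

lemma Au_estimate: "(norm Au)\<^sup>2 \<le> norm f * norm Au + 3 * \<bar>\<beta>\<bar> * sqrt P * D"
proof -
  let ?a = "\<lambda>y. \<bar>\<mu>\<bar> - S y"
  have a_cont: "continuous_on UNIV ?a" by (intro continuous_intros)
  have aP: "C1_periodic ?a (\<lambda>y. - C y)"
    using S_periodic(1) unfolding C1_periodic_def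
    by (auto intro!: derivative_eq_intros S_deriv continuous_intros)
  have "rmult (\<lambda>y. - C y) w = - rmult C w"
    using rmult_cmult[OF C_cont, of "-1" w] by simp
  then have "cinner (rmult ?a w1 - rmult C w) w1 = - cinner (rmult ?a w) w2"
    using integration_by_parts[OF has_weak_deriv_rmult[OF aP derivs(5)] derivs(6)] by simp
  moreover have "Im (cinner (rmult ?a w1) w1) = 0"
    unfolding cinner_rmult_self[OF a_cont] by simp
  ultimately have I1: "Im (cinner (rmult ?a w) w2) = Im (cinner (rmult C w) w1)"
    by (simp add: cinner_diff_left complex_eq_iff)
  have b1: "\<bar>Im (cinner (rmult C w) w1)\<bar> \<le> sqrt (2 * P) * D"
    by (rule order_trans[OF Im_cinner_le mult_mono]) (use norm_Cw D_bounds P_bounds in auto)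
  have "rmult ?a w = rmult (\<lambda>y. 1 - S y) w + (\<bar>\<mu>\<bar> - 1) *\<^sub>R w"
    using rmult_plus[of "\<lambda>y. 1 - S y" "\<lambda>y. \<bar>\<mu>\<bar> - 1" w] by (simp add: rmult_const continuous_intros)
  then have I2: "Im (cinner (rmult ?a w) \<psi>) = Im (cinner (rmult (\<lambda>y. 1 - S y) w) \<psi>)"
    using reals by (simp add: cinner_add_left)
  have "norm (rmult (\<lambda>y. 1 - S y) w) \<le> sqrt (2 * P)"
  proof -
    have "(1 - S y)\<^sup>2 \<le> 2 * (1 - S y)" for y
      unfolding power2_eq_square using S_le[of y] by (intro mult_right_mono) auto
    then have "norm (rmult (\<lambda>y. 1 - S y) w) \<le> sqrt (qform (\<lambda>y. 2 * (1 - S y)) w)"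
      by (intro norm_rmult_le_qform continuous_intros)
    moreover have "qform (\<lambda>y. 2 * (1 - S y)) w = 2 * P"
      unfolding P_def by (rule qform_cmult) (intro continuous_intros)
    ultimately show ?thesis by simp
  qed
  then have b2: "\<bar>Im (cinner (rmult (\<lambda>y. 1 - S y) w) \<psi>)\<bar> \<le> sqrt (2 * P) * D"
    by (intro order_trans[OF Im_cinner_le mult_mono]) (use D_bounds P_bounds in auto)
  have "cinner (rmult ?a w) Au = cinner (rmult ?a w) w2
      - of_real ((real_of_int l)\<^sup>2) * cinner (rmult ?a w) w - cinner (rmult ?a w) (w - \<psi>)"
    by (subst Au_eq) (simp only: cinner_diff_right cinner_scaleR_right u_eq[symmetric])
  then have "Im (cinner (rmult ?a w) Au) = Im (cinner (rmult C w) w1) + Im (cinner (rmult (\<lambda>y. 1 - S y) w) \<psi>)"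
    unfolding cinner_diff_right cinner_rmult_self[OF a_cont] by (simp add: I1 I2)
  moreover have "Im (cinner H Au) = Im (cinner (rmult ?a w) Au)"
    using reals by (simp add: H_def cinner_diff_left)
  ultimately have "\<bar>Im (cinner H Au)\<bar> \<le> 2 * sqrt (2 * P) * D" using b1 b2 by linarith
  also have "\<dots> \<le> 3 * sqrt P * D"
  proof -
    have "sqrt 2 \<le> (3/2::real)" by (rule real_le_lsqrt) (simp_all add: power2_eq_square)
    then have "2 * sqrt 2 * (sqrt P * D) \<le> 3 * (sqrt P * D)"
      using P_bounds D_nonneg by (intro mult_right_mono mult_nonneg_nonneg) auto
    then show ?thesis by (simp add: real_sqrt_mult mult_ac)
  qed
  finally have HA: "\<bar>\<beta>\<bar> * \<bar>Im (cinner H Au)\<bar> \<le> \<bar>\<beta>\<bar> * (3 * sqrt P * D)" by (intro mult_left_mono) auto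
  have "Re (cinner f Au) = (norm Au)\<^sup>2 - \<beta> * \<sigma> * Im (cinner H Au)"
    unfolding test_eq[OF Au_Y] cinner_self by simp
  moreover have "\<bar>\<beta> * \<sigma> * Im (cinner H Au)\<bar> = \<bar>\<beta>\<bar> * \<bar>Im (cinner H Au)\<bar>"
    using \<sigma> by (simp add: abs_mult)
  ultimately show ?thesis using HA Re_cinner_le[of f Au] by (simp add: mult.assoc)
qed

text \<open>The test function \<open>(vw)' + \<kappa> w\<close> has mean zero, so that it is admissible also for
  \<open>\<bar>l\<bar> = 1\<close>; the choice \<open>\<kappa> + v'/2\<close> of the zeroth order coefficient removes all second and third
  derivatives of \<open>v\<close> from the quadratic form in \<open>\<psi>\<close>.\<close>

lemma virial:
  fixes \<kappa> :: real
  assumes v: "C1_periodic v (\<lambda>y. 2 * h y)"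
  defines "Z \<equiv> rmult v w1 + rmult (\<lambda>y. 2 * h y) w + \<kappa> *\<^sub>R w"
  shows "Re (cinner H Z) = qform (\<lambda>y. C y * v y / 2 + (\<bar>\<mu>\<bar> - S y) * (\<kappa> + h y)) w
    + \<bar>\<mu>\<bar> * (qform (\<lambda>y. \<kappa> - h y) \<psi>1 + k * qform (\<lambda>y. \<kappa> + h y) \<psi>)"
proof -
  let ?a = "\<lambda>y. \<bar>\<mu>\<bar> - S y"
  note vc = C1_periodic_continuous[OF v]
  have hc: "continuous_on UNIV h"
    using continuous_on_mult[OF continuous_on_const[of UNIV "1/2"] vc(2)] by simp
  have a_cont: "continuous_on UNIV ?a" by (intro continuous_intros)
  have va: "C1_periodic (\<lambda>y. v y * ?a y) (\<lambda>y. 2 * h y * ?a y - v y * C y)"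
    using v vc S_periodic(1) unfolding C1_periodic_def
    by (auto intro!: derivative_eq_intros S_deriv continuous_intros hc)
  have "cinner (rmult ?a w) (rmult v w1) = cinner (rmult (\<lambda>y. v y * ?a y) w) w1"
    by (simp add: rmult_adjoint[OF vc(1), symmetric] rmult_rmult vc a_cont)
  then have t1: "Re (cinner (rmult ?a w) (rmult v w1)) = - (1/2) * qform (\<lambda>y. 2 * h y * ?a y - v y * C y) w"
    using Re_rmult_deriv[OF va derivs(5)] by simp
  have "cinner (rmult ?a w) (rmult (\<lambda>y. 2 * h y) w) = cinner (rmult (\<lambda>y. 2 * h y * ?a y) w) w"
    by (simp add: rmult_adjoint[OF vc(2), symmetric] rmult_rmult[OF vc(2) a_cont])
  then have t2: "Re (cinner (rmult ?a w) (rmult (\<lambda>y. 2 * h y) w)) = qform (\<lambda>y. 2 * h y * ?a y) w"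
    by (simp add: qform_def)
  have t3: "Re (cinner (rmult ?a w) (\<kappa> *\<^sub>R w)) = qform (\<lambda>y. \<kappa> * ?a y) w"
    using qform_cmult[OF a_cont, of \<kappa> w] by (simp add: qform_def)
  have "(\<lambda>y. C y * v y / 2 + ?a y * (\<kappa> + h y)) =
      (\<lambda>y. ((- (1/2)) * (2 * h y * ?a y - v y * C y) + 2 * h y * ?a y) + \<kappa> * ?a y)"
    by (auto simp: algebra_simps)
  then have "qform (\<lambda>y. C y * v y / 2 + ?a y * (\<kappa> + h y)) w =
      - (1/2) * qform (\<lambda>y. 2 * h y * ?a y - v y * C y) w + qform (\<lambda>y. 2 * h y * ?a y) w + qform (\<lambda>y. \<kappa> * ?a y) w"
    by (simp only: qform_add qform_cmult continuous_intros continuous_on_mult continuous_on_add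
        continuous_on_diff continuous_on_const hc vc a_cont)
  then have W: "Re (cinner (rmult ?a w) Z) = qform (\<lambda>y. C y * v y / 2 + ?a y * (\<kappa> + h y)) w"
    unfolding Z_def cinner_add_right plus_complex.sel t1 t2 t3 by simp
  have "cinner (rmult v w1 + rmult (\<lambda>y. 2 * h y) w) \<psi> = - cinner (rmult v w) \<psi>1"
    by (rule integration_by_parts[OF has_weak_deriv_rmult[OF v derivs(5)] derivs(3)])
  then have p1: "Re (cinner \<psi> Z) = \<kappa> * Re (cinner \<psi> w) - Re (cinner w (rmult v \<psi>1))"
    unfolding Z_def cinner_add_right
    using Re_cinner_commute[of \<psi> "rmult v w1 + rmult (\<lambda>y. 2 * h y) w"]
    by (simp add: cinner_add_right cinner_add_left rmult_adjoint vc complex_eq_iff)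
  have "Re (cinner \<psi>2 (rmult v \<psi>1)) = Re (cinner (rmult v \<psi>1) \<psi>2)" by (rule Re_cinner_commute)
  then have p2: "Re (cinner \<psi>2 (rmult v \<psi>1)) = - qform h \<psi>1"
    using Re_rmult_deriv[OF v derivs(4)] by (simp add: qform_cmult[OF hc])
  have p3: "Re (cinner \<psi> (rmult v \<psi>1)) = - qform h \<psi>"
    using Re_rmult_deriv[OF v derivs(3)] by (simp add: rmult_adjoint vc qform_cmult[OF hc])
  \<comment> \<open>Substituting \<open>w = \<psi>2 - k *\<^sub>R \<psi>\<close> makes the nonlocal
    term a local quadratic form in \<open>\<psi>1\<close> and \<open>\<psi>\<close>.\<close>
  have p4: "Re (cinner w (rmult v \<psi>1)) = - qform h \<psi>1 + k * qform h \<psi>"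
    by (subst w_eq) (simp add: cinner_diff_left p2 p3)
  have "- \<bar>\<mu>\<bar> * Re (cinner \<psi> Z) = \<bar>\<mu>\<bar> * (qform (\<lambda>y. \<kappa> - h y) \<psi>1 + k * qform (\<lambda>y. \<kappa> + h y) \<psi>)"
    unfolding p1 p4 \<psi>_w by (simp add: qform_add qform_diff qform_const hc algebra_simps)
  then show ?thesis
    by (simp add: H_def cinner_diff_left W)
qed

end

section \<open>The interior regime: the virial estimate\<close>

context resolvent_equation
begin

text \<open>The virial form splits into a local part, at least
  \<open>3/20 * P + \<delta> / 10 * ?X\<^sup>2\<close>, and the nonlocal part
  \<open>\<bar>\<mu>\<bar> * Q\<close>. Half of the \<open>\<delta>\<close> term is kept in reserve
  against a negative \<open>Q\<close>; what remains is the input of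
  \<open>bulk_absorption\<close>.\<close>

theorem estimate_inside:
  assumes "\<bar>\<mu>\<bar> < 1" "1 \<le> \<bar>\<beta>\<bar> * (1 - \<bar>\<mu>\<bar>)\<^sup>2"
  shows "\<bar>\<beta>\<bar> powr (2/3) * (1 - \<bar>\<mu>\<bar>) powr (1/3) * norm w \<le> 2 * 10^12 * norm f"
proof -
  define \<delta> where "\<delta> = 1 - \<bar>\<mu>\<bar>"
  have \<delta>: "0 < \<delta>" "\<delta> \<le> 1" "\<bar>\<mu>\<bar> = 1 - \<delta>" using assms by (auto simp: \<delta>_def)
  define v where "v y = 2 * (4 * \<delta>) * C y / (4 * \<delta> + (1 - S y))" for y
  define h where "h y = 4 * \<delta> * ((C y)\<^sup>2 - S y * (4 * \<delta> + (1 - S y))) / (4 * \<delta> + (1 - S y))\<^sup>2" for y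
  note bounds = vector_field_bounds[OF SC \<delta>(1,2), folded v_def h_def]
  have pos: "4 * \<delta> + (1 - S y) > 0" for y using S_le[of y] \<delta> by linarith
  then have nz: "4 * \<delta> + (1 - S y) \<noteq> 0" for y by (metis less_irrefl)
  have vd: "(v has_real_derivative 2 * h y) (at y)" for y
    unfolding v_def[abs_def] h_def
    by (rule derivative_eq_intros S_deriv C_deriv refl nz)+
      (use nz[of y] in \<open>simp add: divide_simps, simp add: power2_eq_square algebra_simps\<close>)
  have hc: "continuous_on UNIV h"
    unfolding h_def[abs_def] by (intro continuous_intros) (use nz in auto)
  have v: "C1_periodic v (\<lambda>y. 2 * h y)"
    unfolding C1_periodic_def
  proof (intro conjI allI vd)
    show "v (2 * pi) = v 0" by (simp add: v_def S_def C_def)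
  qed (intro continuous_intros hc)
  note vc = C1_periodic_continuous[OF v]
  define Z0 where "Z0 = rmult v w1 + rmult (\<lambda>y. 2 * h y) w"
  define Z where "Z = Z0 + (9/10) *\<^sub>R w"
  let ?F = "norm f" and ?G = "norm Au" and ?X = "norm w"
  have "Z0 \<in> Y_space l"
    unfolding Z0_def by (rule has_weak_deriv_in_Y[OF has_weak_deriv_rmult[OF v derivs(5)]])
  then have Z_Y: "Z \<in> Y_space l" unfolding Z_def using w_Y by (auto intro: Y_space_subspace)
  define T where "T = Re (cinner H Z)"
  define Q where "Q = qform (\<lambda>y. 9/10 - h y) \<psi>1 + k * qform (\<lambda>y. 9/10 + h y) \<psi>"
  have T_eq: "T = qform (\<lambda>y. C y * v y / 2 + (\<bar>\<mu>\<bar> - S y) * (9/10 + h y)) w + \<bar>\<mu>\<bar> * Q"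
    unfolding T_def Z_def Z0_def Q_def by (rule virial[OF v])
  have "qform (\<lambda>y. 3/20 * (1 - S y) + \<delta> / 10) w \<le> qform (\<lambda>y. C y * v y / 2 + (\<bar>\<mu>\<bar> - S y) * (9/10 + h y)) w"
    unfolding \<delta>(3) by (intro qform_mono continuous_intros vc hc bounds(1)) auto
  moreover have "qform (\<lambda>y. 3/20 * (1 - S y) + \<delta> / 10) w = 3/20 * P + \<delta> / 10 * ?X\<^sup>2"
    unfolding P_def qform_const[symmetric]
    by (subst qform_add, (intro continuous_intros)+, subst qform_cmult, (intro continuous_intros)+, rule refl)
  ultimately have T_ge1: "3/20 * P + \<delta> / 10 * ?X\<^sup>2 + \<bar>\<mu>\<bar> * Q \<le> T" by (simp add: T_eq)
  have qh: "qform (\<lambda>y. 7/30) \<psi>1 \<le> qform (\<lambda>y. 9/10 - h y) \<psi>1"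
    by (intro qform_mono continuous_intros hc bounds(2))
  have "- (\<delta> / 20) * ?X\<^sup>2 \<le> \<bar>\<mu>\<bar> * Q"
  \<comment> \<open>For \<open>k * \<delta> \<le> 2\<close> the form \<open>Q\<close> is
    nonnegative. Otherwise \<open>k * norm \<psi> \<le> norm w\<close> bounds its negative part by
    the reserve \<open>\<delta> / 20 * ?X\<^sup>2\<close>.\<close>
  proof (cases "k * \<delta> \<le> 2")
    case True
    have "qform (\<lambda>y. 30/7 * (k / 20 * v y)\<^sup>2) \<psi> \<le> qform (\<lambda>y. - k / 10 * h y + k * (9/10 + h y)) \<psi>"
      by (intro qform_mono continuous_intros vc hc bounds(5)[OF k_nonneg True])
    also have "\<dots> = - k / 10 * qform h \<psi> + k * qform (\<lambda>y. 9/10 + h y) \<psi>"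
      by (subst qform_add, (intro continuous_intros hc)+, subst (1 2) qform_cmult, (intro continuous_intros hc)+, rule refl)
    finally have q1: "qform (\<lambda>y. 30/7 * (k / 20 * v y)\<^sup>2) \<psi> + k / 10 * qform h \<psi> \<le> k * qform (\<lambda>y. 9/10 + h y) \<psi>"
      by simp
    have "(\<lambda>y. 30/7 * (k / 20 * v y)\<^sup>2) = (\<lambda>y. (30/7 * (k / 20)\<^sup>2) * (v y)\<^sup>2)"
      by (simp only: power_mult_distrib mult.assoc)
    then have q2: "qform (\<lambda>y. 30/7 * (k / 20 * v y)\<^sup>2) \<psi> = (30/7 * (k / 20)\<^sup>2) * (norm (rmult v \<psi>))\<^sup>2"
      by (simp only: qform_cmult continuous_on_power vc norm_rmult)
    \<comment> \<open>A perfect square whose cross term is a multiple of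
      \<open>qform h \<psi>\<close>, since \<open>2 * h\<close> is the derivative of
      \<open>v\<close>. Through it \<open>\<psi>1\<close> pays for the region near the critical
      point where \<open>9/10 + h\<close> is negative.\<close>
    let ?x = "(7/30) *\<^sub>R \<psi>1 + (- k / 20) *\<^sub>R rmult v \<psi>"
    have cr: "Re (cinner (rmult v \<psi>) \<psi>1) = - qform h \<psi>" "Re (cinner \<psi>1 (rmult v \<psi>)) = - qform h \<psi>"
      using Re_rmult_deriv[OF v derivs(3)] Re_cinner_commute[of \<psi>1 "rmult v \<psi>"] by (simp_all add: qform_cmult[OF hc])
    have "(norm ?x)\<^sup>2 = Re (cinner ?x ?x)" unfolding cinner_self by simp
    also have "\<dots> = (7/30)\<^sup>2 * (norm \<psi>1)\<^sup>2 + 2 * (7/30) * (k / 20) * qform h \<psi> + (k / 20)\<^sup>2 * (norm (rmult v \<psi>))\<^sup>2"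
      unfolding cinner_add_left cinner_add_right cinner_scaleR_left cinner_scaleR_right
      by (simp add: cinner_self cr power2_eq_square) (simp add: field_simps)
    finally have "0 \<le> (7/30)\<^sup>2 * (norm \<psi>1)\<^sup>2 + 2 * (7/30) * (k / 20) * qform h \<psi> + (k / 20)\<^sup>2 * (norm (rmult v \<psi>))\<^sup>2"
      by (metis zero_le_power2)
    then have "0 \<le> 7/30 * (norm \<psi>1)\<^sup>2 + k / 10 * qform h \<psi> + (30/7 * (k / 20)\<^sup>2) * (norm (rmult v \<psi>))\<^sup>2"
      by (simp add: power2_eq_square field_simps)
    then have "0 \<le> Q" using qh q1 unfolding q2 Q_def qform_const by linarith
    then have "0 \<le> \<bar>\<mu>\<bar> * Q" by simp
    moreover have "0 \<le> \<delta> / 20 * ?X\<^sup>2" using \<delta> by simp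
    ultimately show ?thesis by linarith
  next
    case False
    have "qform (\<lambda>y. - 1/10) \<psi> \<le> qform (\<lambda>y. 9/10 + h y) \<psi>"
    proof (intro qform_mono continuous_intros hc)
      show "- 1/10 \<le> 9/10 + h y" for y using bounds(4)[of y] by linarith
    qed
    then have "k * (- 1/10 * (norm \<psi>)\<^sup>2) \<le> k * qform (\<lambda>y. 9/10 + h y) \<psi>"
      unfolding qform_const by (rule mult_left_mono[OF _ k_nonneg])
    moreover have "0 \<le> qform (\<lambda>y. 9/10 - h y) \<psi>1"
      using qh zero_le_power2[of "norm \<psi>1"] unfolding qform_const by linarith
    ultimately have Q1: "- (k / 10 * (norm \<psi>)\<^sup>2) \<le> Q" unfolding Q_def by linarith
    have nn: "0 \<le> k / 10 * (norm \<psi>)\<^sup>2" using k_nonneg by simp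
    have "- (k / 10 * (norm \<psi>)\<^sup>2) \<le> \<bar>\<mu>\<bar> * Q"
    proof (cases "0 \<le> Q")
      case True
      then have "0 \<le> \<bar>\<mu>\<bar> * Q" by simp
      then show ?thesis using nn by linarith
    next
      case False
      then have "1 * Q \<le> \<bar>\<mu>\<bar> * Q" using assms by (intro mult_right_mono_neg) auto
      then show ?thesis using Q1 by linarith
    qed
    moreover have "k / 10 * (norm \<psi>)\<^sup>2 \<le> \<delta> / 20 * ?X\<^sup>2"
    proof -
      have "2 * (k * (norm \<psi>)\<^sup>2) \<le> (k * \<delta>) * (k * (norm \<psi>)\<^sup>2)" using False k_nonneg by (intro mult_right_mono) auto
      also have "\<dots> = \<delta> * (k * norm \<psi>)\<^sup>2" by (simp add: power2_eq_square)
      also have "\<dots> \<le> \<delta> * ?X\<^sup>2" using k_norm_\<psi>_le_w k_nonneg \<delta> by (intro mult_left_mono power_mono) auto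
      finally show ?thesis by simp
    qed
    ultimately show ?thesis by linarith
  qed
  then have T_ge: "(P + \<delta> * ?X\<^sup>2) / 20 \<le> T" using T_ge1 P_bounds by (simp add: field_simps)
  have nv: "norm (rmult v w1) \<le> 3 * (sqrt \<delta> * D)"
  proof -
    have "\<bar>v y\<bar> \<le> 3 * sqrt \<delta>" for y
    proof (rule power2_le_imp_le)
      show "\<bar>v y\<bar>\<^sup>2 \<le> (3 * sqrt \<delta>)\<^sup>2" using bounds(3)[of y] \<delta> by (simp add: power_mult_distrib)
    qed (use \<delta> in simp)
    then have "norm (rmult v w1) \<le> (3 * sqrt \<delta>) * norm w1" by (rule norm_rmult_le[OF vc(1)])
    also have "\<dots> \<le> (3 * sqrt \<delta>) * D" using D_bounds \<delta> by (intro mult_left_mono) auto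
    finally show ?thesis by simp
  qed
  have "norm (rmult (\<lambda>y. 2 * h y) w) \<le> 2 * ?X"
    by (rule norm_rmult_le[OF vc(2)]) (use bounds(4) in \<open>simp add: abs_mult\<close>)
  then have Z0: "norm Z0 \<le> 3 * (sqrt \<delta> * D) + 2 * ?X"
    unfolding Z0_def using norm_triangle_ineq[of "rmult v w1" "rmult (\<lambda>y. 2 * h y) w"] nv by linarith
  have "norm Z \<le> norm Z0 + norm ((9/10) *\<^sub>R w)" unfolding Z_def by (rule norm_triangle_ineq)
  moreover have "norm ((9/10) *\<^sub>R w) \<le> norm w" by simp
  ultimately have Z: "norm Z \<le> 3 * (sqrt \<delta> * D) + 3 * ?X" using Z0 by linarith
  have "Im (cinner f Z) = Im (cinner Au Z) + \<beta> * \<sigma> * T"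
    unfolding test_eq[OF Z_Y] T_def by simp
  \<comment> \<open>The multiple of \<open>w\<close> contained in \<open>Z\<close> pairs with
    \<open>Au\<close> to a real number.\<close>
  moreover have "Im (cinner Au Z) = Im (cinner Au Z0)"
    using reals(6) by (simp add: Z_def cinner_add_right)
  ultimately have "\<bar>\<beta> * \<sigma> * T\<bar> \<le> \<bar>Im (cinner f Z)\<bar> + \<bar>Im (cinner Au Z0)\<bar>" by linarith
  also have "\<dots> \<le> ?F * norm Z + ?G * norm Z0" using Im_cinner_le add_mono by blast
  also have "\<dots> \<le> ?F * (3 * (sqrt \<delta> * D) + 3 * ?X) + ?G * (3 * (sqrt \<delta> * D) + 3 * ?X)"
  proof -
    have "norm Z0 \<le> 3 * (sqrt \<delta> * D) + 3 * ?X" using Z0 norm_ge_zero[of w] by linarith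
    then show ?thesis using Z by (intro add_mono mult_left_mono) auto
  qed
  also have "\<dots> = 3 * ((?F + ?G) * (sqrt \<delta> * D + ?X))" by (simp add: algebra_simps)
  finally have "\<bar>\<beta>\<bar> * \<bar>T\<bar> \<le> 3 * ((?F + ?G) * (sqrt \<delta> * D + ?X))" using \<sigma> by (simp add: abs_mult)
  moreover have "\<bar>\<beta>\<bar> * ((P + \<delta> * ?X\<^sup>2) / 20) \<le> \<bar>\<beta>\<bar> * \<bar>T\<bar>" using T_ge by (intro mult_left_mono) auto
  ultimately have "\<bar>\<beta>\<bar> * ((P + \<delta> * ?X\<^sup>2) / 20) \<le> 3 * ((?F + ?G) * (sqrt \<delta> * D + ?X))" by linarith
  then have "\<bar>\<beta>\<bar> * (P + \<delta> * ?X\<^sup>2) \<le> 60 * (?F + ?G) * (sqrt \<delta> * D + ?X)"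
    unfolding times_divide_eq_right mult.assoc[of 60] by linarith
  from bulk_absorption[OF _ P_bounds(1) _ D_nonneg _ _ \<delta>(1) _ energy Au_estimate this]
  show ?thesis using \<beta> assms(2) by (simp add: \<delta>_def)
qed

end

section \<open>Invertibility\<close>

text \<open>The fixed point is sought for \<open>g = T u\<close> in \<open>Y\<close>, where
  completeness is available, rather than for \<open>u\<close> in the domain. The lower bound makes
  \<open>R\<close> an inverse of norm at most \<open>1 / m\<close>, so \<open>K\<close> after
  \<open>R\<close> contracts by 1/2.\<close>

lemma continuity_step:
  fixes T K :: "L2T \<Rightarrow> L2T"
  assumes Y: "closed Y" "\<And>f g. f \<in> Y \<Longrightarrow> g \<in> Y \<Longrightarrow> f - g \<in> Y"
    and domQ: "\<And>u v. u \<in> domQ \<Longrightarrow> v \<in> domQ \<Longrightarrow> u - v \<in> domQ"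
    and T: "\<And>u v. u \<in> domQ \<Longrightarrow> v \<in> domQ \<Longrightarrow> T (u - v) = T u - T v"
    and K: "\<And>u v. u \<in> domQ \<Longrightarrow> v \<in> domQ \<Longrightarrow> K (u - v) = K u - K v"
    and K_Y: "\<And>u. u \<in> domQ \<Longrightarrow> K u \<in> Y" and K_le: "\<And>u. u \<in> domQ \<Longrightarrow> norm (K u) \<le> m / 2 * norm u"
    and m: "0 < m" "\<And>u. u \<in> domQ \<Longrightarrow> m * norm u \<le> norm (T u)"
    and onto: "T ` domQ = Y"
  shows "Y \<subseteq> (\<lambda>u. T u + K u) ` domQ"
proof
  fix f assume f: "f \<in> Y"
  have "\<forall>g\<in>Y. \<exists>u\<in>domQ. T u = g" using onto by auto
  then obtain R where R: "\<And>g. g \<in> Y \<Longrightarrow> R g \<in> domQ" "\<And>g. g \<in> Y \<Longrightarrow> T (R g) = g" by metis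
  define \<Phi> where "\<Phi> g = f - K (R g)" for g
  have contr: "dist (\<Phi> g) (\<Phi> g') \<le> 1/2 * dist g g'" if "g \<in> Y" "g' \<in> Y" for g g'
  proof -
    have d: "R g - R g' \<in> domQ" using that R(1) domQ by auto
    have "dist (\<Phi> g) (\<Phi> g') = norm (K (R g - R g'))"
      using that R(1) by (simp add: \<Phi>_def dist_norm K norm_minus_commute)
    also have "\<dots> \<le> 1/2 * (m * norm (R g - R g'))" using K_le[OF d] by simp
    also have "\<dots> \<le> 1/2 * norm (T (R g - R g'))" using m(2)[OF d] by simp
    also have "T (R g - R g') = g - g'" using that R by (simp add: T)
    finally show ?thesis by (simp add: dist_norm)
  qed
  have "\<exists>!g. g \<in> Y \<and> \<Phi> g = g"
  proof (rule Banach_fix[where c="1/2"])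
    show "complete Y" using Y(1) by (simp add: complete_eq_closed)
    show "Y \<noteq> {}" using f by auto
    show "\<Phi> ` Y \<subseteq> Y" using f R(1) K_Y Y(2) by (auto simp: \<Phi>_def)
  qed (use contr in auto)
  then obtain g where g: "g \<in> Y" "\<Phi> g = g" by blast
  have "T (R g) + K (R g) = f" using R(2)[OF g(1)] g(2) by (simp add: \<Phi>_def algebra_simps)
  then show "f \<in> (\<lambda>u. T u + K u) ` domQ" using R(1)[OF g(1)] by force
qed

text \<open>Because \<open>m\<close> is uniform in \<open>t\<close>, finitely many steps of the
  fixed size \<open>1 / n\<close> with \<open>\<bar>B\<bar> / n \<le> m / 2\<close> lead from
  \<open>T\<close> to \<open>T + K\<close>.\<close>

lemma method_of_continuity:
  fixes T K :: "L2T \<Rightarrow> L2T"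
  assumes Y: "closed Y" "\<And>f g. f \<in> Y \<Longrightarrow> g \<in> Y \<Longrightarrow> f - g \<in> Y" "\<And>f g. f \<in> Y \<Longrightarrow> g \<in> Y \<Longrightarrow> f + g \<in> Y"
      "\<And>f r. f \<in> Y \<Longrightarrow> r *\<^sub>R f \<in> Y"
    and domQ: "\<And>u v. u \<in> domQ \<Longrightarrow> v \<in> domQ \<Longrightarrow> u - v \<in> domQ"
    and T: "\<And>u v. u \<in> domQ \<Longrightarrow> v \<in> domQ \<Longrightarrow> T (u - v) = T u - T v"
    and K: "\<And>u v. u \<in> domQ \<Longrightarrow> v \<in> domQ \<Longrightarrow> K (u - v) = K u - K v"
    and K_Y: "\<And>u. u \<in> domQ \<Longrightarrow> K u \<in> Y" and K_le: "\<And>u. u \<in> domQ \<Longrightarrow> norm (K u) \<le> B * norm u"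
    and m: "0 < m" "\<And>u t. u \<in> domQ \<Longrightarrow> 0 \<le> t \<Longrightarrow> t \<le> 1 \<Longrightarrow> m * norm u \<le> norm (T u + t *\<^sub>R K u)"
    and onto: "T ` domQ = Y"
  shows "(\<lambda>u. T u + K u) ` domQ = Y"
proof -
  obtain n0 :: nat where n0: "2 * \<bar>B\<bar> / m \<le> real n0" using real_arch_simple by blast
  define n where "n = Suc n0"
  have n: "0 < real n" "\<bar>B\<bar> / real n \<le> m / 2"
    using n0 m(1) by (auto simp: n_def field_simps)
  have maps: "T u + t *\<^sub>R K u \<in> Y" if "u \<in> domQ" for u t
  proof -
    have "T u \<in> Y" using that onto by blast
    then show ?thesis by (rule Y(3)[OF _ Y(4)[OF K_Y[OF that]]])
  qed
  have "(\<lambda>u. T u + (real i / real n) *\<^sub>R K u) ` domQ = Y" if "i \<le> n" for i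
    using that
  proof (induction i)
    case 0
    then show ?case using onto by simp
  next
    case (Suc i)
    have "Y \<subseteq> (\<lambda>u. (T u + (real i / real n) *\<^sub>R K u) + (1 / real n) *\<^sub>R K u) ` domQ"
    proof (rule continuity_step[OF Y(1,2) domQ _ _ _ _ m(1)])
      show "norm ((1 / real n) *\<^sub>R K u) \<le> m / 2 * norm u" if "u \<in> domQ" for u
      proof -
        have "norm (K u) \<le> \<bar>B\<bar> * norm u"
          using K_le[OF that] mult_right_mono[OF abs_ge_self[of B] norm_ge_zero[of u]] by (rule order_trans)
        then have "norm ((1 / real n) *\<^sub>R K u) \<le> (1 / real n) * (\<bar>B\<bar> * norm u)"
          unfolding norm_scaleR using n(1) by (intro mult_mono) auto
        also have "\<dots> = (\<bar>B\<bar> / real n) * norm u" by simp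
        also have "\<dots> \<le> m / 2 * norm u" using n(2) by (intro mult_right_mono) auto
        finally show ?thesis .
      qed
      show "m * norm u \<le> norm (T u + (real i / real n) *\<^sub>R K u)" if "u \<in> domQ" for u
        using m(2)[OF that, of "real i / real n"] Suc.prems n(1) by simp
      show "(\<lambda>u. T u + (real i / real n) *\<^sub>R K u) ` domQ = Y" using Suc by simp
    qed (simp_all add: T K K_Y Y(4) scaleR_diff_right)
    also have "(\<lambda>u. (T u + (real i / real n) *\<^sub>R K u) + (1 / real n) *\<^sub>R K u)
        = (\<lambda>u. T u + (real (Suc i) / real n) *\<^sub>R K u)"
      by (simp add: add_divide_distrib algebra_simps)
    finally show ?case using maps by blast
  qed
  from this[of n] n(1) show ?thesis by simp
qed

lemma norm_orth_proj_le: "norm (orth_proj (Y_space l) f) \<le> norm f"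
proof -
  let ?p = "orth_proj (Y_space l) f"
  have "cinner ?p ?p = cinner f ?p" by (rule orth_proj_Y(2)[OF orth_proj_Y(1)])
  then have "(norm ?p)\<^sup>2 = Re (cinner f ?p)" by (metis cinner_self Re_complex_of_real)
  also have "\<dots> \<le> norm f * norm ?p" using Re_cinner_le[of f ?p] by linarith
  finally have "norm ?p * norm ?p \<le> norm f * norm ?p" by (simp add: power2_eq_square)
  then show ?thesis by (cases "norm ?p = 0") (auto simp: mult_le_cancel_right_pos)
qed

lemma A_inv_diff: "l \<noteq> 0 \<Longrightarrow> A_inv l (u - v) = A_inv l u - A_inv l v"
proof (rule fcoeff_eqI)
  fix n assume l: "l \<noteq> 0"
  let ?N = "complex_of_real ((real_of_int n)\<^sup>2 + (real_of_int l)\<^sup>2)"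
  have "(real_of_int n)\<^sup>2 + (real_of_int l)\<^sup>2 > 0" 
    using l_square_ge_1[OF l] zero_le_power2[of "real_of_int n"] by linarith
  then have nz: "- ?N \<noteq> 0" by (simp only: neg_equal_0_iff_equal of_real_eq_0_iff)
  have "- ?N * fcoeff (A_inv l (u - v)) n = - ?N * fcoeff (A_inv l u) n - (- ?N * fcoeff (A_inv l v) n)"
    unfolding fcoeff_A_inv[OF l, symmetric] by simp
  then have "- ?N * fcoeff (A_inv l (u - v)) n = - ?N * fcoeff (A_inv l u - A_inv l v) n"
    unfolding fcoeff_diff right_diff_distrib .
  then show "fcoeff (A_inv l (u - v)) n = fcoeff (A_inv l u - A_inv l v) n"
    using nz by (simp only: mult_cancel_left) blast
qed

lemma QL_dom_diff: "u \<in> QL_dom l \<Longrightarrow> v \<in> QL_dom l \<Longrightarrow> u - v \<in> QL_dom l"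
  using W22_subspace(1)[of u "(-1) *\<^sub>C v"] W22_subspace(2)[of v "-1"] Y_space_subspace(2)[of u l v]
  by (auto simp: QL_dom_def minus_L2T_def uminus_L2T_def)

lemma A_op_diff: "u \<in> W22 \<Longrightarrow> v \<in> W22 \<Longrightarrow> u - v \<in> W22 \<Longrightarrow> A_op l (u - v) = A_op l u - A_op l v"
  by (rule fcoeff_eqI) (simp only: fcoeff_A_op fcoeff_diff right_diff_distrib)

section \<open>The projected operator and its resolvent\<close>

locale kolmogorov =
  fixes l :: int and \<beta> :: real
  assumes l: "l \<noteq> 0" and \<beta>: "\<beta> \<noteq> 0"
begin

definition "Y = Y_space l"
definition "domQ = QL_dom l"
text \<open>The projection is applied to the bounded part alone, since \<open>A_op l\<close> already
  preserves \<open>Y_space l\<close>.\<close>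

definition "Kop u = orth_proj Y (rmult sin (u + A_inv l u))"
definition "QL u = A_op l u - (\<i> * of_real \<beta>) *\<^sub>C Kop u"

lemma domQ_iff: "u \<in> domQ \<longleftrightarrow> u \<in> W22 \<and> u \<in> Y" by (simp add: domQ_def QL_dom_def Y_def)

lemma sf: "u \<in> domQ \<Longrightarrow> stream_function l u"
  by unfold_locales (auto simp: l domQ_iff Y_def)

lemma Y_closure: "f \<in> Y \<Longrightarrow> g \<in> Y \<Longrightarrow> f - g \<in> Y" "f \<in> Y \<Longrightarrow> g \<in> Y \<Longrightarrow> f + g \<in> Y"
  "f \<in> Y \<Longrightarrow> c *\<^sub>C f \<in> Y" "f \<in> Y \<Longrightarrow> r *\<^sub>R f \<in> Y" "f \<in> Y \<Longrightarrow> - f \<in> Y"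
  using Y_space_subspace(1-4) Y_space_subspace(3)[of f l "-1"] by (auto simp: Y_def uminus_L2T_def)

lemma closed_Y: "closed Y" unfolding Y_def by (rule closed_Y_space)
lemma A_Y: "u \<in> domQ \<Longrightarrow> A_op l u \<in> Y" using A_op_in_Y by (auto simp: domQ_iff Y_def)
lemma Kop_Y: "Kop u \<in> Y" by (simp add: Kop_def Y_def orth_proj_Y)
lemma QL_Y: "u \<in> domQ \<Longrightarrow> QL u \<in> Y" using A_Y Kop_Y Y_closure by (simp add: QL_def)

lemma cinner_Kop: "z \<in> Y \<Longrightarrow> cinner (Kop u) z = cinner (rmult sin (u + A_inv l u)) z"
  by (simp add: Kop_def Y_def orth_proj_Y)

lemma QL_op_eq: "u \<in> domQ \<Longrightarrow> \<alpha> * of_int l = \<beta> \<Longrightarrow> QL_op \<alpha> l u = QL u"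
  unfolding QL_op_def
  by (rule orth_proj_Y_eqI)
    (use QL_Y in \<open>auto simp: QL_def Y_def[symmetric] L_op_def cinner_diff_left cinner_Kop Lambda_op_eq\<close>)

lemma sin_cont: "continuous_on UNIV (sin :: real \<Rightarrow> real)" by (intro continuous_intros)

lemma Kop_diff: "Kop (u - v) = Kop u - Kop v"
proof -
  have "rmult sin (u - v + A_inv l (u - v)) = rmult sin (u + A_inv l u) - rmult sin (v + A_inv l v)"
    unfolding rmult_diff[OF sin_cont, symmetric] A_inv_diff[OF l] by (simp add: algebra_simps)
  then show ?thesis
    unfolding Kop_def Y_def
    by (intro orth_proj_Y_eqI) (auto simp: cinner_diff_left orth_proj_Y intro: Y_space_subspace orth_proj_Y)
qed

lemma norm_Kop_le: "u \<in> domQ \<Longrightarrow> norm (Kop u) \<le> norm u"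
proof -
  assume u: "u \<in> domQ"
  interpret stream_function l u by (rule sf[OF u])
  have "norm (Kop u) \<le> norm (rmult sin w)"
    unfolding Kop_def Y_def w_def \<psi>_def by (rule norm_orth_proj_le)
  also have "\<dots> \<le> 1 * norm w" by (rule norm_rmult_le[OF sin_cont]) (rule abs_sin_le_one)
  finally show ?thesis using norm_w_le_u by simp
qed

lemma A_onto: "A_op l ` domQ = Y"
proof
  show "Y \<subseteq> A_op l ` domQ"
  proof
    fix f assume f: "f \<in> Y"
    have "A_inv l f \<in> domQ" using f A_inv(1)[OF l] A_inv_in_Y[OF l] by (auto simp: domQ_iff Y_def)
    then show "f \<in> A_op l ` domQ" using A_inv(2)[OF l, of f] by (metis imageI)
  qed
qed (use A_Y in auto)

lemma domQ_diff: "u \<in> domQ \<Longrightarrow> v \<in> domQ \<Longrightarrow> u - v \<in> domQ"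
  unfolding domQ_def by (rule QL_dom_diff)

lemma A_diff: "u \<in> domQ \<Longrightarrow> v \<in> domQ \<Longrightarrow> A_op l (u - v) = A_op l u - A_op l v"
  using A_op_diff domQ_diff by (auto simp: domQ_iff)

lemma QL_diff: "u \<in> domQ \<Longrightarrow> v \<in> domQ \<Longrightarrow> QL (u - v) = QL u - QL v"
  by (simp add: QL_def A_diff Kop_diff scaleC_diff_right)

text \<open>The test function is again \<open>w\<close>: the transport part contributes only an
  imaginary number, and \<open>cinner u w\<close> is real and nonnegative. Allowing every real
  \<open>b\<close> makes the bound uniform along the homotopy in \<open>onto_right\<close>.\<close>

lemma dissipative:
  assumes u: "u \<in> domQ" and "0 \<le> Re \<zeta>" and f: "f = \<zeta> *\<^sub>C u - A_op l u + (\<i> * of_real b) *\<^sub>C Kop u"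
  shows "1/2 * norm u \<le> norm f"
proof -
  interpret stream_function l u by (rule sf[OF u])
  have wY: "w \<in> Y" using w_Y by (simp add: Y_def)
  have uw: "Re (\<zeta> * cinner u w) = Re \<zeta> * Re (cinner u w)" using reals(1) by simp
  have "Re (cinner 0 0) \<le> Re (cinner u w)"
  proof (rule Re_cinner_le_fcoeffI)
    fix n
    have "- N n * (1 - N n) = N n * (N n - 1)" by (simp add: algebra_simps)
    then have "- N n * (1 - N n) * (cmod (fcoeff \<psi> n))\<^sup>2 \<ge> 0" using N_ge[of n] by simp
    then show "Re (fcoeff 0 n * cnj (fcoeff 0 n)) \<le> Re (fcoeff u n * cnj (fcoeff w n))"
      unfolding coeffs(1,2) mult_cnj_real by simp
  qed
  then have "0 \<le> Re \<zeta> * Re (cinner u w)" using assms(2) by simp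
  moreover have "Re (cinner f w) = Re \<zeta> * Re (cinner u w) - Re (cinner Au w)"
  proof -
    have "cinner (Kop u) w = of_real (qform sin w)"
      unfolding cinner_Kop[OF wY] \<psi>_def[symmetric] w_def[symmetric] by (rule cinner_rmult_self[OF sin_cont])
    then have K0: "Re (\<i> * of_real b * cinner (Kop u) w) = 0" by simp
    show ?thesis
      unfolding f cinner_add_left cinner_diff_left cinner_scaleC_left Au_def[symmetric]
        plus_complex.sel minus_complex.sel uw K0 by simp
  qed
  ultimately have "D\<^sup>2 \<le> 2 * Re (cinner f w)" using coercive by linarith
  also have "\<dots> \<le> 2 * (norm f * norm u)"
    using Re_cinner_le[of f w] mult_left_mono[OF norm_w_le_u norm_ge_zero[of f]] by linarith
  finally have "(norm u)\<^sup>2 \<le> 2 * (norm f * norm u)" using power_mono[OF norm_u_le_D norm_ge_zero, of 2] by linarith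
  then have "norm u * norm u \<le> (2 * norm f) * norm u" by (simp add: power2_eq_square)
  then show ?thesis by (cases "norm u = 0") (auto simp: mult_le_cancel_right_pos)
qed

text \<open>The homotopy starts at \<open>- A_op l\<close>, which Fourier series invert explicitly,
  and switches on \<open>\<zeta>\<close> and \<open>\<beta>\<close> together;
  \<open>t * \<zeta>\<close> stays in the closed right half plane.\<close>

lemma onto_right:
  assumes "0 \<le> Re \<zeta>" shows "(\<lambda>u. \<zeta> *\<^sub>C u - QL u) ` domQ = Y"
proof -
  have "(\<lambda>u. - A_op l u + (\<zeta> *\<^sub>C u + (\<i> * of_real \<beta>) *\<^sub>C Kop u)) ` domQ = Y"
  proof (rule method_of_continuity[where B="cmod \<zeta> + \<bar>\<beta>\<bar>" and m="1/2"])
    show "(\<lambda>u. - A_op l u) ` domQ = Y"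
    proof -
      have "f \<in> uminus ` Y" if "f \<in> Y" for f
        using imageI[OF Y_closure(5)[OF that], of uminus] by simp
      then have "uminus ` Y = Y" using Y_closure(5) by blast
      then show ?thesis unfolding A_onto[symmetric] image_image .
    qed
    show "1/2 * norm u \<le> norm (- A_op l u + t *\<^sub>R (\<zeta> *\<^sub>C u + (\<i> * of_real \<beta>) *\<^sub>C Kop u))"
      if "u \<in> domQ" "0 \<le> t" for u t
    proof (rule dissipative[OF that(1), of "of_real t * \<zeta>" _ "t * \<beta>"])
      show "- A_op l u + t *\<^sub>R (\<zeta> *\<^sub>C u + (\<i> * of_real \<beta>) *\<^sub>C Kop u)
        = (of_real t * \<zeta>) *\<^sub>C u - A_op l u + (\<i> * of_real (t * \<beta>)) *\<^sub>C Kop u"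
        unfolding scaleC_of_real[symmetric] by (simp add: scaleC_add_right mult_ac)
    qed (use assms that in simp)
    show "norm (\<zeta> *\<^sub>C u + (\<i> * of_real \<beta>) *\<^sub>C Kop u) \<le> (cmod \<zeta> + \<bar>\<beta>\<bar>) * norm u" if "u \<in> domQ" for u
      using norm_triangle_ineq[of "\<zeta> *\<^sub>C u" "(\<i> * of_real \<beta>) *\<^sub>C Kop u"]
        mult_left_mono[OF norm_Kop_le[OF that], of "\<bar>\<beta>\<bar>"]
      by (simp add: norm_mult distrib_right)
  qed (use closed_Y Y_closure domQ_diff Kop_Y in \<open>auto simp: A_diff Kop_diff scaleC_diff_right domQ_iff\<close>)
  also have "(\<lambda>u. - A_op l u + (\<zeta> *\<^sub>C u + (\<i> * of_real \<beta>) *\<^sub>C Kop u)) = (\<lambda>u. \<zeta> *\<^sub>C u - QL u)"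
    by (auto simp: QL_def)
  finally show ?thesis .
qed

lemma resolvent_equation:
  assumes u: "u \<in> domQ" and f: "f = (\<i> * of_real lam) *\<^sub>C u + QL u"
  shows "resolvent_equation l u f \<beta> (lam / \<beta>)"
proof -
  interpret stream_function l u by (rule sf[OF u])
  show ?thesis
  proof
    fix z assume "z \<in> Y_space l"
    then have z: "z \<in> Y" by (simp add: Y_def)
    show "cinner f z = cinner Au z - \<i> * of_real \<beta> * cinner (rmult sin w) z
        + \<i> * of_real (\<beta> * (lam / \<beta>)) * cinner u z"
      unfolding f QL_def cinner_add_left cinner_diff_left cinner_scaleC_left cinner_Kop[OF z]
      using \<beta> by (simp add: Au_def w_def \<psi>_def)
  qed (rule \<beta>)
qed

text \<open>One constant serves all regimes: \<open>4 * 10^12\<close> is twice the constant of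
  \<open>estimate_inside\<close>, the factor 2 coming from \<open>norm_u_le_w\<close>. The other two
  regimes produce 2 and 74.\<close>

definition bound :: "real \<Rightarrow> real" where
  "bound \<mu> = (if \<bar>\<mu>\<bar> > 1 + 1 / \<bar>\<beta>\<bar> powr (1/2) then 4 * 10^12 / (\<bar>\<beta>\<bar> * (\<bar>\<mu>\<bar> - 1))
     else if \<bar>\<mu>\<bar> > 1 - 1 / \<bar>\<beta>\<bar> powr (1/2) then 4 * 10^12 / \<bar>\<beta>\<bar> powr (1/2)
     else 4 * 10^12 / (\<bar>\<beta>\<bar> powr (2/3) * (1 - \<bar>\<mu>\<bar>) powr (1/3)))"

lemma root_\<beta>: "0 < 1 / \<bar>\<beta>\<bar> powr (1/2)" "\<bar>\<beta>\<bar> * (1 / \<bar>\<beta>\<bar> powr (1/2))\<^sup>2 = 1"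
  using \<beta> by (auto simp: power_divide powr_power)

lemma norm_le_bound:
  assumes u: "u \<in> domQ" and f: "f = (\<i> * of_real lam) *\<^sub>C u + QL u"
  shows "norm u \<le> bound (lam / \<beta>) * norm f"
proof -
  let ?\<mu> = "lam / \<beta>" and ?b = "1 / \<bar>\<beta>\<bar> powr (1/2)"
  interpret resolvent_equation l u f \<beta> ?\<mu> by (rule resolvent_equation[OF u f])
  consider "\<bar>?\<mu>\<bar> > 1 + ?b" | "\<not> \<bar>?\<mu>\<bar> > 1 + ?b" "\<bar>?\<mu>\<bar> > 1 - ?b"
    | "\<not> \<bar>?\<mu>\<bar> > 1 + ?b" "\<not> \<bar>?\<mu>\<bar> > 1 - ?b" by blast
  then show ?thesis
  proof cases
    case 1
    then have gt: "\<bar>?\<mu>\<bar> > 1" using root_\<beta> by linarith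
    then have p: "0 < \<bar>\<beta>\<bar> * (\<bar>?\<mu>\<bar> - 1)" using \<beta> by simp
    have "norm w \<le> norm f / (\<bar>\<beta>\<bar> * (\<bar>?\<mu>\<bar> - 1))"
      using estimate_outside[OF gt] p by (simp add: pos_le_divide_eq mult.commute)
    then have "norm u \<le> 2 * (norm f / (\<bar>\<beta>\<bar> * (\<bar>?\<mu>\<bar> - 1)))" using norm_u_le_w by linarith
    also have "\<dots> \<le> 4 * 10^12 * (norm f / (\<bar>\<beta>\<bar> * (\<bar>?\<mu>\<bar> - 1)))" using p by (intro mult_right_mono) auto
    finally show ?thesis using 1 by (simp add: bound_def)
  next
    case 2
    have "\<bar>\<bar>?\<mu>\<bar> - 1\<bar> \<le> ?b" using 2 by linarith
    then have "norm w \<le> 37 * norm f * ?b" by (rule estimate_edge[OF _ root_\<beta>])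
    then have "norm u \<le> 74 * (norm f * ?b)" using norm_u_le_w by linarith
    also have "\<dots> \<le> 4 * 10^12 * (norm f * ?b)" using root_\<beta> by (intro mult_right_mono) auto
    finally show ?thesis unfolding bound_def using 2 by simp
  next
    case 3
    then have lt: "\<bar>?\<mu>\<bar> < 1" "?b \<le> 1 - \<bar>?\<mu>\<bar>" using root_\<beta> by linarith+
    have "\<bar>\<beta>\<bar> * ?b\<^sup>2 \<le> \<bar>\<beta>\<bar> * (1 - \<bar>?\<mu>\<bar>)\<^sup>2"
      using lt root_\<beta> by (intro mult_left_mono power_mono) auto
    then have "\<bar>\<beta>\<bar> powr (2/3) * (1 - \<bar>?\<mu>\<bar>) powr (1/3) * norm w \<le> 2 * 10^12 * norm f"
      using estimate_inside[OF lt(1)] root_\<beta> by simp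
    moreover have p: "0 < \<bar>\<beta>\<bar> powr (2/3) * (1 - \<bar>?\<mu>\<bar>) powr (1/3)" using \<beta> lt by simp
    ultimately have "norm w \<le> 2 * 10^12 * norm f / (\<bar>\<beta>\<bar> powr (2/3) * (1 - \<bar>?\<mu>\<bar>) powr (1/3))"
      by (simp only: pos_le_divide_eq mult.commute)
    then have "norm u \<le> 4 * 10^12 * norm f / (\<bar>\<beta>\<bar> powr (2/3) * (1 - \<bar>?\<mu>\<bar>) powr (1/3))"
      using norm_u_le_w by linarith
    then show ?thesis unfolding bound_def using 3 by simp
  qed
qed

lemma bound_nonneg: "0 \<le> bound \<mu>"
proof -
  have "\<not> \<bar>\<mu>\<bar> > 1 + 1 / \<bar>\<beta>\<bar> powr (1/2) \<or> 1 \<le> \<bar>\<mu>\<bar>" using root_\<beta>(1) by linarith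
  then show ?thesis by (auto simp: bound_def)
qed

text \<open>The outer and inner branches are largest where they meet the edge regime, at distance
  \<open>\<bar>\<beta>\<bar> powr (-1/2)\<close> from 1; for the inner one the exponents combine to
  \<open>2/3 - 1/6 = 1/2\<close>.\<close>

lemma bound_le: "bound \<mu> \<le> 4 * 10^12 / \<bar>\<beta>\<bar> powr (1/2)"
proof -
  let ?b = "1 / \<bar>\<beta>\<bar> powr (1/2)"
  have N: "0 < \<bar>\<beta>\<bar>" using \<beta> by simp
  have half: "0 < \<bar>\<beta>\<bar> powr (1/2)" using \<beta> by simp
  consider "\<bar>\<mu>\<bar> > 1 + ?b" | "\<not> \<bar>\<mu>\<bar> > 1 + ?b" "\<bar>\<mu>\<bar> > 1 - ?b"
    | "\<not> \<bar>\<mu>\<bar> > 1 + ?b" "\<not> \<bar>\<mu>\<bar> > 1 - ?b" by blast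
  then show ?thesis
  proof cases
    case 1
    have "\<bar>\<beta>\<bar> powr (1/2) = \<bar>\<beta>\<bar> * ?b"
      using N powr_add[of "\<bar>\<beta>\<bar>" "1/2" "1/2"] by (simp add: field_simps)
    also have "\<dots> \<le> \<bar>\<beta>\<bar> * (\<bar>\<mu>\<bar> - 1)" using 1 by (intro mult_left_mono) auto
    finally show ?thesis using 1 half by (simp add: bound_def frac_le)
  next
    case 2 then show ?thesis unfolding bound_def by simp
  next
    case 3
    have "\<bar>\<beta>\<bar> powr (1/2) = \<bar>\<beta>\<bar> powr (2/3) * ?b powr (1/3)"
      using N by (simp add: powr_divide powr_powr powr_diff[symmetric])
    also have "\<dots> \<le> \<bar>\<beta>\<bar> powr (2/3) * (1 - \<bar>\<mu>\<bar>) powr (1/3)"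
      using 3 root_\<beta>(1) by (intro mult_left_mono powr_mono2) auto
    finally show ?thesis unfolding bound_def using 3 half by (simp add: frac_le)
  qed
qed

lemma lower_bound:
  assumes u: "u \<in> domQ"
  shows "\<bar>\<beta>\<bar> powr (1/2) / (4 * 10^12) * norm u \<le> norm ((\<i> * of_real lam) *\<^sub>C u + QL u)"
proof -
  let ?f = "(\<i> * of_real lam) *\<^sub>C u + QL u"
  have p: "0 < \<bar>\<beta>\<bar> powr (1/2)" using \<beta> by simp
  have "norm u \<le> 4 * 10^12 / \<bar>\<beta>\<bar> powr (1/2) * norm ?f"
    using norm_le_bound[OF u refl] mult_right_mono[OF bound_le norm_ge_zero] order_trans by blast
  then show ?thesis using p by (simp add: field_simps)
qed

text \<open>The constant \<open>8 * 10^12\<close> takes half of the lower bound on the imaginary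
  axis: moving left by less than that half loses at most that half. To the right of the axis
  \<open>dissipative\<close> gives 1/2.\<close>

lemma lower_bound_resolvent:
  assumes u: "u \<in> domQ" and \<zeta>: "Re \<zeta> > - (\<bar>\<beta>\<bar> powr (1/2) / (8 * 10^12))"
  shows "min (1/2) (\<bar>\<beta>\<bar> powr (1/2) / (8 * 10^12)) * norm u \<le> norm (\<zeta> *\<^sub>C u - QL u)"
proof (cases "0 \<le> Re \<zeta>")
  case True
  have "\<zeta> *\<^sub>C u - QL u = \<zeta> *\<^sub>C u - A_op l u + (\<i> * of_real \<beta>) *\<^sub>C Kop u" by (simp add: QL_def)
  from dissipative[OF u True this] show ?thesis
    by (rule order_trans[rotated]) (intro mult_right_mono, auto)
next
  case False
  let ?m = "\<bar>\<beta>\<bar> powr (1/2) / (8 * 10^12)"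
  \<comment> \<open>Since \<open>lower_bound\<close> concerns \<open>\<i> * lam + QL\<close>, the
    choice \<open>lam = - Im \<zeta>\<close> matches \<open>\<zeta> - QL\<close> up to sign and the
    real part.\<close>
  have e: "\<zeta> = of_real (Re \<zeta>) - \<i> * of_real (- Im \<zeta>)" by (simp add: complex_eq_iff)
  have eq: "(\<i> * of_real (- Im \<zeta>)) *\<^sub>C u + QL u = Re \<zeta> *\<^sub>R u - (\<zeta> *\<^sub>C u - QL u)"
    by (subst (2) e) (rule L2T_eqI, simp add: cinner_diff_left cinner_add_left algebra_simps)
  have "2 * ?m * norm u \<le> norm (Re \<zeta> *\<^sub>R u - (\<zeta> *\<^sub>C u - QL u))"
    using lower_bound[OF u, of "- Im \<zeta>"] unfolding eq by simp
  also have "\<dots> \<le> norm (Re \<zeta> *\<^sub>R u) + norm (\<zeta> *\<^sub>C u - QL u)" by (rule norm_triangle_ineq4)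
  also have "norm (Re \<zeta> *\<^sub>R u) \<le> ?m * norm u" unfolding norm_scaleR using False \<zeta> by (intro mult_right_mono) auto
  finally have le: "2 * ?m * norm u \<le> ?m * norm u + norm (\<zeta> *\<^sub>C u - QL u)" by simp
  have "M * x \<le> y" if "2 * M * x \<le> M * x + y" for M x y :: real using that by simp
  from this[OF le] have "?m * norm u \<le> norm (\<zeta> *\<^sub>C u - QL u)" .
  then show ?thesis by (rule order_trans[rotated]) (intro mult_right_mono, auto)
qed

text \<open>The homotopy runs horizontally from the imaginary axis, where \<open>onto_right\<close>
  applies; along it the real part stays between \<open>Re \<zeta>\<close> and 0, so the lower bound
  is uniform.\<close>

lemma onto_left:
  assumes \<zeta>: "Re \<zeta> > - (\<bar>\<beta>\<bar> powr (1/2) / (8 * 10^12))"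
  shows "(\<lambda>u. \<zeta> *\<^sub>C u - QL u) ` domQ = Y"
proof (cases "0 \<le> Re \<zeta>")
  case False
  let ?m = "min (1/2) (\<bar>\<beta>\<bar> powr (1/2) / (8 * 10^12))"
  let ?T = "\<lambda>u. (\<i> * of_real (Im \<zeta>)) *\<^sub>C u - QL u"
  have T_eq: "?T u + t *\<^sub>R (Re \<zeta> *\<^sub>R u) = (of_real (t * Re \<zeta>) + \<i> * of_real (Im \<zeta>)) *\<^sub>C u - QL u" for u t
    by (rule L2T_eqI) (simp add: cinner_diff_left cinner_add_left algebra_simps)
  have "(\<lambda>u. ?T u + Re \<zeta> *\<^sub>R u) ` domQ = Y"
  proof (rule method_of_continuity[where B="\<bar>Re \<zeta>\<bar>" and m="?m"])
    show "?T ` domQ = Y" by (rule onto_right) simp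
    show "0 < ?m" using \<beta> by simp
    show "?m * norm u \<le> norm (?T u + t *\<^sub>R (Re \<zeta> *\<^sub>R u))" if "u \<in> domQ" "0 \<le> t" "t \<le> 1" for u t
    proof -
      have "1 * Re \<zeta> \<le> t * Re \<zeta>" using that False by (intro mult_right_mono_neg) auto
      then show ?thesis unfolding T_eq using \<zeta> by (intro lower_bound_resolvent[OF that(1)]) simp
    qed
  qed (use closed_Y Y_closure domQ_diff in \<open>auto simp: QL_diff scaleC_diff_right scaleR_diff_right domQ_iff\<close>)
  also have "(\<lambda>u. ?T u + Re \<zeta> *\<^sub>R u) = (\<lambda>u. \<zeta> *\<^sub>C u - QL u)"
  proof
    fix u
    have "of_real (1 * Re \<zeta>) + \<i> * of_real (Im \<zeta>) = \<zeta>" by (simp add: complex_eq_iff)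
    then show "?T u + Re \<zeta> *\<^sub>R u = \<zeta> *\<^sub>C u - QL u" using T_eq[of u 1] by (metis scaleR_one)
  qed
  finally show ?thesis .
qed (rule onto_right)

lemma bij_betw_resolvent:
  assumes \<zeta>: "Re \<zeta> > - (\<bar>\<beta>\<bar> powr (1/2) / (8 * 10^12))"
  shows "bij_betw (\<lambda>u. \<zeta> *\<^sub>C u - QL u) domQ Y"
proof -
  have "inj_on (\<lambda>u. \<zeta> *\<^sub>C u - QL u) domQ"
  proof (rule inj_onI)
    fix u v assume uv: "u \<in> domQ" "v \<in> domQ" "\<zeta> *\<^sub>C u - QL u = \<zeta> *\<^sub>C v - QL v"
    have "\<zeta> *\<^sub>C (u - v) - QL (u - v) = (\<zeta> *\<^sub>C u - QL u) - (\<zeta> *\<^sub>C v - QL v)"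
      using uv(1,2) by (simp add: QL_diff scaleC_diff_right)
    then have "\<zeta> *\<^sub>C (u - v) - QL (u - v) = 0" using uv(3) by simp
    then have "min (1/2) (\<bar>\<beta>\<bar> powr (1/2) / (8 * 10^12)) * norm (u - v) \<le> 0"
      using lower_bound_resolvent[OF domQ_diff[OF uv(1,2)] \<zeta>] by simp
    moreover have "0 < min (1/2) (\<bar>\<beta>\<bar> powr (1/2) / (8 * 10^12))" using \<beta> by simp
    ultimately have "norm (u - v) \<le> 0" by (meson mult_pos_pos not_le)
    then show "u = v" by simp
  qed
  then show ?thesis using onto_left[OF \<zeta>] by (simp add: bij_betw_def)
qed

end

section \<open>Spectrum and resolvent of \<open>QL_op\<close>\<close>

locale kolmogorov_\<alpha> = kolmogorov +
  fixes \<alpha> :: real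
  assumes \<alpha>: "\<alpha> * of_int l = \<beta>"
begin

lemma QL_op_dom: "u \<in> domQ \<Longrightarrow> QL_op \<alpha> l u = QL u"
  using QL_op_eq \<alpha> by blast

lemma resolvent_set_right:
  assumes \<zeta>: "Re \<zeta> > - (\<bar>\<beta>\<bar> powr (1/2) / (8 * 10^12))"
  shows "\<zeta> \<in> resolvent_set (Y_space l) (QL_dom l) (QL_op \<alpha> l)"
proof -
  let ?m = "min (1/2) (\<bar>\<beta>\<bar> powr (1/2) / (8 * 10^12))"
  let ?R = "\<lambda>u. \<zeta> *\<^sub>C u - QL_op \<alpha> l u"
  have m: "0 < ?m" using \<beta> by simp
  have bij: "bij_betw ?R domQ Y"
    using bij_betw_resolvent[OF \<zeta>] by (rule iffD1[OF bij_betw_cong, rotated]) (simp add: QL_op_dom)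
  have "norm (inv_into domQ ?R f) \<le> 1 / ?m * norm f" if "f \<in> Y" for f
  proof -
    let ?u = "inv_into domQ ?R f"
    have u: "?u \<in> domQ" "?R ?u = f"
      using that bij bij_betw_inv_into_right[OF bij] by (auto simp: bij_betw_def inv_into_into)
    have "?m * norm ?u \<le> norm f"
      using lower_bound_resolvent[OF u(1) \<zeta>] u by (simp add: QL_op_dom)
    then have "norm ?u \<le> norm f / ?m" using m by (simp only: pos_le_divide_eq mult.commute)
    then show ?thesis by simp
  qed
  then show ?thesis using bij unfolding resolvent_set_def Y_def domQ_def by blast
qed

text \<open>The supremum lives in the extended reals, so it suffices to bound each point of the
  spectrum, even if there were none.\<close>

lemma spectrum_bound:
  "(SUP \<zeta>\<in>op_spectrum (Y_space l) (QL_dom l) (QL_op \<alpha> l). ereal (Re \<zeta>))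
    \<le> ereal (- (1 / (8 * 10^12)) * \<bar>\<beta>\<bar> powr (1/2))"
proof (rule SUP_least)
  fix \<zeta> assume "\<zeta> \<in> op_spectrum (Y_space l) (QL_dom l) (QL_op \<alpha> l)"
  then have "\<not> Re \<zeta> > - (\<bar>\<beta>\<bar> powr (1/2) / (8 * 10^12))"
    using resolvent_set_right by (auto simp: op_spectrum_def)
  then show "ereal (Re \<zeta>) \<le> ereal (- (1 / (8 * 10^12)) * \<bar>\<beta>\<bar> powr (1/2))" by simp
qed

text \<open>This certifies that the \<open>inv_into\<close> in the norm estimate is a genuine
  inverse.\<close>

lemma imaginary_axis:
  "- (\<i> * of_real lam) \<notin> op_spectrum (Y_space l) (QL_dom l) (QL_op \<alpha> l)"
  using resolvent_set_right[of "- (\<i> * of_real lam)"] \<beta> by (simp add: op_spectrum_def)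

lemma resolvent_norm:
  "op_norm (Y_space l) (inv_into (QL_dom l) (\<lambda>u. (\<i> * of_real lam) *\<^sub>C u + QL_op \<alpha> l u))
    \<le> ereal (bound (lam / \<beta>))"
  unfolding op_norm_def
proof (rule SUP_least)
  let ?R = "\<lambda>u. (\<i> * of_real lam) *\<^sub>C u + QL_op \<alpha> l u"
  fix f assume f: "f \<in> {f \<in> Y_space l. norm f \<le> 1}"
  \<comment> \<open>The map \<open>?R\<close> is the negative of the resolvent map at
    \<open>\<zeta> = - \<i> * lam\<close>, so its surjectivity is applied to
    \<open>- f\<close>.\<close>
  have "- f \<in> (\<lambda>u. (- (\<i> * of_real lam)) *\<^sub>C u - QL u) ` domQ"
    using onto_right[of "- (\<i> * of_real lam)"] f Y_closure(5)[of f] by (simp add: Y_def)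
  then obtain v where v: "v \<in> domQ" "- f = (- (\<i> * of_real lam)) *\<^sub>C v - QL v" by auto
  have "f = ?R v"
    using arg_cong[OF v(2), of uminus] v(1)
    by (simp add: QL_op_dom) (rule L2T_eqI, simp add: cinner_add_left)
  then have im: "f \<in> ?R ` QL_dom l" using v(1) by (auto simp: domQ_def)
  let ?u = "inv_into (QL_dom l) ?R f"
  have u: "?u \<in> domQ" "?R ?u = f"
    using inv_into_into[OF im] f_inv_into_f[OF im] by (simp_all add: domQ_def)
  have "norm ?u \<le> bound (lam / \<beta>) * norm f"
    by (rule norm_le_bound[OF u(1)]) (use u in \<open>simp add: QL_op_dom\<close>)
  also have "\<dots> \<le> bound (lam / \<beta>) * 1" using f bound_nonneg by (intro mult_left_mono) auto
  finally show "ereal (norm ?u) \<le> ereal (bound (lam / \<beta>))" by simp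
qed

end

theorem theorem3p11:
  "\<exists>c C \<alpha>\<^sub>0 :: real. c > 0 \<and> C > 0 \<and> \<alpha>\<^sub>0 > 0 \<and>
     (\<forall>\<alpha> :: real. \<bar>\<alpha>\<bar> \<ge> \<alpha>\<^sub>0 \<longrightarrow>
       (\<forall>(lam :: real) (l :: int). l \<noteq> 0 \<longrightarrow>
          (SUP \<zeta>\<in>op_spectrum (Y_space l) (QL_dom l) (QL_op \<alpha> l). ereal (Re \<zeta>))
            \<le> ereal (- c * \<bar>\<alpha> * of_int l\<bar> powr (1/2)) \<and>
          - (\<i> * of_real lam) \<notin> op_spectrum (Y_space l) (QL_dom l) (QL_op \<alpha> l) \<and>
          op_norm (Y_space l)
              (inv_into (QL_dom l) (\<lambda>u. (\<i> * of_real lam) *\<^sub>C u + QL_op \<alpha> l u))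
            \<le> ereal
               (if \<bar>lam / (\<alpha> * of_int l)\<bar> > 1 + 1 / \<bar>\<alpha> * of_int l\<bar> powr (1/2)
                then C / (\<bar>\<alpha> * of_int l\<bar> * (\<bar>lam / (\<alpha> * of_int l)\<bar> - 1))
                else if \<bar>lam / (\<alpha> * of_int l)\<bar> > 1 - 1 / \<bar>\<alpha> * of_int l\<bar> powr (1/2)
                then C / \<bar>\<alpha> * of_int l\<bar> powr (1/2)
                else C / (\<bar>\<alpha> * of_int l\<bar> powr (2/3) *
                          (1 - \<bar>lam / (\<alpha> * of_int l)\<bar>) powr (1/3)))))"
proof (intro exI conjI allI impI)
  fix \<alpha> lam :: real and l :: int
  assume "1 \<le> \<bar>\<alpha>\<bar>" "l \<noteq> 0"
  then interpret kolmogorov_\<alpha> l "\<alpha> * of_int l" \<alpha> by unfold_locales auto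
  show "(SUP \<zeta>\<in>op_spectrum (Y_space l) (QL_dom l) (QL_op \<alpha> l). ereal (Re \<zeta>))
      \<le> ereal (- (1 / (8 * 10^12)) * \<bar>\<alpha> * of_int l\<bar> powr (1/2))"
    by (rule spectrum_bound)
  show "- (\<i> * of_real lam) \<notin> op_spectrum (Y_space l) (QL_dom l) (QL_op \<alpha> l)"
    by (rule imaginary_axis)
  show "op_norm (Y_space l)
              (inv_into (QL_dom l) (\<lambda>u. (\<i> * of_real lam) *\<^sub>C u + QL_op \<alpha> l u))
            \<le> ereal
               (if \<bar>lam / (\<alpha> * of_int l)\<bar> > 1 + 1 / \<bar>\<alpha> * of_int l\<bar> powr (1/2)
                then 4 * 10^12 / (\<bar>\<alpha> * of_int l\<bar> * (\<bar>lam / (\<alpha> * of_int l)\<bar> - 1))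
                else if \<bar>lam / (\<alpha> * of_int l)\<bar> > 1 - 1 / \<bar>\<alpha> * of_int l\<bar> powr (1/2)
                then 4 * 10^12 / \<bar>\<alpha> * of_int l\<bar> powr (1/2)
                else 4 * 10^12 / (\<bar>\<alpha> * of_int l\<bar> powr (2/3) *
                          (1 - \<bar>lam / (\<alpha> * of_int l)\<bar>) powr (1/3)))"
    using resolvent_norm[of lam] unfolding bound_def .
qed simp_all

end
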